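(* The INZ-type Lagrangian formulation and the "clone" Lagrangian formulation of six-dimensional chiral two-form theories do not include the Lagrangian description of the Bialynicki-Birula theory (the theory with PST/Hamiltonian function $\mathcal H_{\rm BB}=p$). Specifically: (i) For $\mathcal H=p$ the quartic invariant $I$ of the auxiliary field vanishes, $I=0$, as an off-shell constraint, so that an interaction function $\mathcal V(I)$ cannot be obtained as a result of the canonical "Legendre" transform of $\mathcal H=p$. (ii) The choice $\mathcal V(I)=\pm\frac12\sqrt{I/6}$ (the $\gamma\to\infty$ limit of the ModMax function $\mathcal V(I)=-\frac12\tanh\frac\gamma2\sqrt{I/6}$) does not describe the Bialynicki-Birula theory: it yields, off the mass shell, $p=\mathcal H=0$, which is not the case for the theory $\mathcal H=p$ even on-shell. Instead it is just the $\gamma\to\infty$ limit of the ModMax theory $\mathcal H_{\rm MM}=\cosh(\gamma)\,s-\sinh(\gamma)\sqrt{s^2-p^2}$, in which finiteness of $\mathcal H_{\rm MM}$ requires $s-\sqrt{s^2-p^2}=0$, i.e. $p=0$.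
   Context: $A_{\mu\nu}$ is a two-form gauge field in six dimensions (mostly plus signature), $F_3=dA_2$, $F^*$ its Hodge dual, $v_\mu=\partial_\mu a/\sqrt{-\partial_\nu a\,\partial^\nu a}$ a unit timelike vector built from an auxiliary scalar $a(x)$, $E_{\mu\nu}=F_{\mu\nu\rho}v^\rho$, $B_{\mu\nu}=F^*_{\mu\nu\rho}v^\rho$, $s=\frac14B_{\mu\nu}B^{\mu\nu}$, $p=\sqrt{p_\mu p^\mu}$, $p^\mu=-\frac1{8\sqrt{-g}}\varepsilon^{\mu\nu\rho\lambda\sigma\kappa}B_{\rho\lambda}B_{\sigma\kappa}v_\nu$. PST formulation: $\mathcal L=\sqrt{-g}\left(\frac14E^{\mu\nu}B_{\mu\nu}-\mathcal H(s,p)\right)$; $\mathcal H$ is the Hamiltonian density in the gauge $v_\mu=\delta_\mu^0$. INZ-type formulation: $\mathcal L=\sqrt{-g}\left(\frac14(E_{\mu\nu}-B_{\mu\nu})B^{\mu\nu}+\frac12(B_{\mu\nu}+\Lambda_{\mu\nu})(B^{\mu\nu}+\Lambda^{\mu\nu})-\mathcal V(I)\right)$, where $\Lambda_{\mu\nu\rho}=\Lambda^*_{\mu\nu\rho}$ is an auxiliary self-dual three-form, $\Lambda_{\mu\nu}=\Lambda_{\mu\nu\rho}v^\rho$, $I=M_\mu{}^\nu M_\nu{}^\mu$ with $M_\mu{}^\nu=\Lambda_{\mu\rho\lambda}\Lambda^{\nu\rho\lambda}$, and $\mathcal V$ is an arbitrary function. The algebraic equation of motion of $\Lambda$ is $B_{\mu\nu}=-\Lambda_{\mu\nu}+\partial\mathcal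 V/\partial\Lambda^{\mu\nu}$. Eliminating $\Lambda$ with it gives the PST theory with $\mathcal H=\frac14B_{\mu\nu}B^{\mu\nu}-\frac12(\Lambda+B)_{\mu\nu}(\Lambda+B)^{\mu\nu}+\mathcal V(I)$, for which $2\,\partial\mathcal H/\partial B^{\mu\nu}=-B_{\mu\nu}-2\Lambda_{\mu\nu}$ and hence $I=6(s^2-p^2)\left(\mathcal H_p^2-(1+\mathcal H_s)^2\right)^2$. "Off-shell" means using this algebraic equation but not the dynamical field equation of $A_{\mu\nu}$. "Clone" formulation: $\mathcal L=-\frac{\sqrt{-g}}{4!}X_{\mu\nu\rho}X^{\mu\nu\rho}+\frac{a(x)}{12}\varepsilon^{\mu\nu\rho\sigma\lambda\kappa}F_{\mu\nu\rho}Q_{\sigma\lambda\kappa}-\sqrt{-g}\,\mathcal V(I(X^+))$, where $X_3=F_3+a(x)Q_3$, $Q_3=d\tilde A_2$ is the field strength of an additional two-form gauge field, $a(x)$ is an auxiliary scalar, $X^+_3=\frac12(X_3+X_3^* )$, and $I(X^+)=X^+_{\mu\nu\rho}X^{+\nu\rho\lambda}X^+_{\lambda\kappa\sigma}X^{+\kappa\sigma\mu}$. Its non-linear self-duality condition and on-shell energy-momentum tensor coincide with those of the INZ-type formulation with the same $\mathcal V$. *)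

theory Defs
  imports "HOL-Analysis.Analysis"
begin

section \<open>Tensor algebra at a point of a six-dimensional Lorentzian spacetime\<close>

text \<open>
  The index type is \<open>6\<close>, with elements \<open>0,\<dots>,5\<close>; the metric \<open>g\<close> is the matrix of the
  components with lower indices.  All tensors are given by their components with lower indices,
  unless raised explicitly.
\<close>

type_synonym vec6 = "real^6"
type_synonym tensor2 = "real^6^6"
type_synonym tensor3 = "real^6^6^6"

definition minkowski :: tensor2 where
  "minkowski = (\<chi> i j. if i = j then (if i = 0 then - 1 else 1) else 0)"

definition lorentzian :: "tensor2 \<Rightarrow> bool" where
  "lorentzian g \<longleftrightarrow> transpose g = g \<and>
     (\<exists>P. invertible P \<and> transpose P ** g ** P = minkowski)"

definition vol :: "tensor2 \<Rightarrow> real" where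
  "vol g = sqrt (- det g)"

definition raise1 :: "tensor2 \<Rightarrow> vec6 \<Rightarrow> vec6" where
  "raise1 g u = (\<chi> \<mu>. \<Sum>\<alpha>\<in>UNIV. matrix_inv g $ \<mu> $ \<alpha> * u $ \<alpha>)"

definition raise2 :: "tensor2 \<Rightarrow> tensor2 \<Rightarrow> tensor2" where
  "raise2 g T = (\<chi> \<mu> \<nu>. \<Sum>\<alpha>\<in>UNIV. \<Sum>\<beta>\<in>UNIV.
     matrix_inv g $ \<mu> $ \<alpha> * matrix_inv g $ \<nu> $ \<beta> * T $ \<alpha> $ \<beta>)"

definition raise3 :: "tensor2 \<Rightarrow> tensor3 \<Rightarrow> tensor3" where
  "raise3 g T = (\<chi> \<mu> \<nu> \<rho>. \<Sum>\<alpha>\<in>UNIV. \<Sum>\<beta>\<in>UNIV. \<Sum>\<gamma>\<in>UNIV.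
     matrix_inv g $ \<mu> $ \<alpha> * matrix_inv g $ \<nu> $ \<beta> * matrix_inv g $ \<rho> $ \<gamma> * T $ \<alpha> $ \<beta> $ \<gamma>)"

definition sq1 :: "tensor2 \<Rightarrow> vec6 \<Rightarrow> real" where
  "sq1 g u = (\<Sum>\<mu>\<in>UNIV. u $ \<mu> * raise1 g u $ \<mu>)"

definition contr2 :: "tensor2 \<Rightarrow> tensor2 \<Rightarrow> tensor2 \<Rightarrow> real" where
  "contr2 g S T = (\<Sum>\<mu>\<in>UNIV. \<Sum>\<nu>\<in>UNIV. S $ \<mu> $ \<nu> * raise2 g T $ \<mu> $ \<nu>)"

definition contr3 :: "tensor2 \<Rightarrow> tensor3 \<Rightarrow> tensor3 \<Rightarrow> real" where
  "contr3 g S T = (\<Sum>\<mu>\<in>UNIV. \<Sum>\<nu>\<in>UNIV. \<Sum>\<rho>\<in>UNIV. S $ \<mu> $ \<nu> $ \<rho> * raise3 g T $ \<mu> $ \<nu> $ \<rho>)"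

text \<open>The permutation symbol, normalised by \<open>eps 0 1 2 3 4 5 = 1\<close>.\<close>

definition eps :: "6 \<Rightarrow> 6 \<Rightarrow> 6 \<Rightarrow> 6 \<Rightarrow> 6 \<Rightarrow> 6 \<Rightarrow> real" where
  "eps i0 i1 i2 i3 i4 i5 =
     (let f = id(0 := i0, 1 := i1, 2 := i2, 3 := i3, 4 := i4, 5 := i5)
      in if bij f then of_int (sign f) else 0)"

definition three_forms :: "tensor3 set" where
  "three_forms = {F. \<forall>\<mu> \<nu> \<rho>. F $ \<nu> $ \<mu> $ \<rho> = - F $ \<mu> $ \<nu> $ \<rho> \<and> F $ \<mu> $ \<rho> $ \<nu> = - F $ \<mu> $ \<nu> $ \<rho>}"

definition two_forms :: "tensor2 set" where
  "two_forms = {A. \<forall>\<mu> \<nu>. A $ \<nu> $ \<mu> = - A $ \<mu> $ \<nu>}"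

text \<open>
  The Hodge dual is an involution on three-forms.  Its overall sign is a matter of orientation,
  but relative to the topological term \<open>\<epsilon> F Q\<close> of the clone Lagrangian it is not: with
  the sign below the clone equations contain \<open>X - X\<^sup>*\<close> (rather than \<open>X + X\<^sup>*\<close>),
  as they must to be a non-linear deformation of self-duality.
\<close>

definition dual3 :: "tensor2 \<Rightarrow> tensor3 \<Rightarrow> tensor3" where
  "dual3 g F = (\<chi> \<mu> \<nu> \<rho>. vol g / 6 *
     (\<Sum>\<alpha>\<in>UNIV. \<Sum>\<beta>\<in>UNIV. \<Sum>\<gamma>\<in>UNIV. eps \<mu> \<nu> \<rho> \<alpha> \<beta> \<gamma> * raise3 g F $ \<alpha> $ \<beta> $ \<gamma>))"

definition self_dual :: "tensor2 \<Rightarrow> tensor3 set" where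
  "self_dual g = {L \<in> three_forms. dual3 g L = L}"

definition unit_timelike :: "tensor2 \<Rightarrow> vec6 \<Rightarrow> bool" where
  "unit_timelike g v \<longleftrightarrow> sq1 g v = - 1"

text \<open>Contraction \<open>T\<^sub>\<mu>\<^sub>\<nu>\<^sub>\<rho> v\<^sup>\<rho>\<close>.\<close>

definition slot :: "tensor2 \<Rightarrow> vec6 \<Rightarrow> tensor3 \<Rightarrow> tensor2" where
  "slot g v T = (\<chi> \<mu> \<nu>. \<Sum>\<rho>\<in>UNIV. T $ \<mu> $ \<nu> $ \<rho> * raise1 g v $ \<rho>)"

definition E_of :: "tensor2 \<Rightarrow> vec6 \<Rightarrow> tensor3 \<Rightarrow> tensor2" where
  "E_of g v F = slot g v F"

definition B_of :: "tensor2 \<Rightarrow> vec6 \<Rightarrow> tensor3 \<Rightarrow> tensor2" where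
  "B_of g v F = slot g v (dual3 g F)"

text \<open>The values taken by \<open>E\<close> and \<open>B\<close>: two-forms annihilated by \<open>v\<close>.\<close>

definition transverse2 :: "tensor2 \<Rightarrow> vec6 \<Rightarrow> tensor2 set" where
  "transverse2 g v = {B \<in> two_forms. \<forall>\<mu>. (\<Sum>\<nu>\<in>UNIV. B $ \<mu> $ \<nu> * raise1 g v $ \<nu>) = 0}"

definition s_inv :: "tensor2 \<Rightarrow> tensor2 \<Rightarrow> real" where
  "s_inv g B = contr2 g B B / 4"

definition p_vec :: "tensor2 \<Rightarrow> vec6 \<Rightarrow> tensor2 \<Rightarrow> vec6" where
  "p_vec g v B = (\<chi> \<mu>. - 1 / (8 * vol g) *
     (\<Sum>\<nu>\<in>UNIV. \<Sum>\<rho>\<in>UNIV. \<Sum>\<tau>\<in>UNIV. \<Sum>\<sigma>\<in>UNIV. \<Sum>\<kappa>\<in>UNIV.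
        eps \<mu> \<nu> \<rho> \<tau> \<sigma> \<kappa> * B $ \<rho> $ \<tau> * B $ \<sigma> $ \<kappa> * v $ \<nu>))"

text \<open>\<open>p_vec\<close> has an upper index, whence the metric itself below.\<close>

definition p_inv :: "tensor2 \<Rightarrow> vec6 \<Rightarrow> tensor2 \<Rightarrow> real" where
  "p_inv g v B = sqrt (\<Sum>\<mu>\<in>UNIV. \<Sum>\<nu>\<in>UNIV. g $ \<mu> $ \<nu> * p_vec g v B $ \<mu> * p_vec g v B $ \<nu>)"

text \<open>\<open>M_mat g L $ \<mu> $ \<nu>\<close> is \<open>M\<^sub>\<mu>\<^sup>\<nu> = \<Lambda>\<^sub>\<mu>\<^sub>\<rho>\<^sub>\<lambda> \<Lambda>\<^sup>\<nu>\<^sup>\<rho>\<^sup>\<lambda>\<close>.\<close>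

definition M_mat :: "tensor2 \<Rightarrow> tensor3 \<Rightarrow> real^6^6" where
  "M_mat g L = (\<chi> \<mu> \<nu>. \<Sum>\<rho>\<in>UNIV. \<Sum>\<tau>\<in>UNIV. L $ \<mu> $ \<rho> $ \<tau> * raise3 g L $ \<nu> $ \<rho> $ \<tau>)"

definition I_inv :: "tensor2 \<Rightarrow> tensor3 \<Rightarrow> real" where
  "I_inv g L = (\<Sum>\<mu>\<in>UNIV. \<Sum>\<nu>\<in>UNIV. M_mat g L $ \<mu> $ \<nu> * M_mat g L $ \<nu> $ \<mu>)"


section \<open>The PST and INZ-type formulations\<close>

definition pst_lagrangian ::
  "tensor2 \<Rightarrow> vec6 \<Rightarrow> (real \<Rightarrow> real \<Rightarrow> real) \<Rightarrow> tensor2 \<Rightarrow> tensor2 \<Rightarrow> real" where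
  "pst_lagrangian g v H E B = vol g * (contr2 g E B / 4 - H (s_inv g B) (p_inv g v B))"

definition inz_lagrangian ::
  "tensor2 \<Rightarrow> vec6 \<Rightarrow> (real \<Rightarrow> real) \<Rightarrow> tensor2 \<Rightarrow> tensor2 \<Rightarrow> tensor3 \<Rightarrow> real" where
  "inz_lagrangian g v V E B L = vol g *
     (contr2 g (E - B) B / 4 + contr2 g (B + slot g v L) (B + slot g v L) / 2 - V (I_inv g L))"

text \<open>
  Derivatives with respect to a two-form are normalised by
  \<open>\<delta>f = (\<partial>f/\<partial>\<Lambda>\<^sup>\<mu>\<^sup>\<nu>) \<delta>\<Lambda>\<^sup>\<mu>\<^sup>\<nu>\<close>, summed over all \<open>\<mu>,\<nu>\<close>.  The variations of \<open>\<Lambda>\<close>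
  are self-dual three-forms, those of \<open>B\<close> are transverse two-forms.  In particular the equations
  below contain the requirement that the differentiated function be differentiable.
\<close>

definition inz_algebraic_eq ::
  "tensor2 \<Rightarrow> vec6 \<Rightarrow> (real \<Rightarrow> real) \<Rightarrow> tensor2 \<Rightarrow> tensor3 \<Rightarrow> bool" where
  "inz_algebraic_eq g v V B L \<longleftrightarrow> B \<in> transverse2 g v \<and> L \<in> self_dual g \<and>
     (\<exists>G \<in> transverse2 g v.
        ((\<lambda>L. V (I_inv g L)) has_derivative (\<lambda>D. contr2 g G (slot g v D))) (at L within self_dual g) \<and>
        B = - slot g v L + G)"

definition inz_hamiltonian ::
  "tensor2 \<Rightarrow> vec6 \<Rightarrow> (real \<Rightarrow> real) \<Rightarrow> tensor2 \<Rightarrow> tensor3 \<Rightarrow> real" where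
  "inz_hamiltonian g v V B L = contr2 g B B / 4
     - contr2 g (slot g v L + B) (slot g v L + B) / 2 + V (I_inv g L)"

text \<open>
  Eliminating \<open>\<Lambda>\<close> along a differentiable branch \<open>\<Lambda>(B)\<close> of solutions of its algebraic
  equation over \<open>U\<close> turns the INZ-type Lagrangian into the PST Lagrangian with function \<open>H\<close>.
\<close>

definition inz_yields ::
  "tensor2 \<Rightarrow> vec6 \<Rightarrow> (real \<Rightarrow> real) \<Rightarrow> (real \<Rightarrow> real \<Rightarrow> real) \<Rightarrow> tensor2 set \<Rightarrow> bool" where
  "inz_yields g v V H U \<longleftrightarrow> (\<exists>L. L differentiable_on U \<and>
     (\<forall>B\<in>U. inz_algebraic_eq g v V B (L B) \<and>
        (\<forall>E\<in>transverse2 g v. inz_lagrangian g v V E B (L B) = pst_lagrangian g v H E B)))"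

text \<open>
  The auxiliary field that a function \<open>H(s,p)\<close> prescribes through
  \<open>2 \<partial>H/\<partial>B\<^sup>\<mu>\<^sup>\<nu> = - B\<^sub>\<mu>\<^sub>\<nu> - 2 \<Lambda>\<^sub>\<mu>\<^sub>\<nu>\<close>.
\<close>

definition legendre_pair ::
  "tensor2 \<Rightarrow> vec6 \<Rightarrow> (real \<Rightarrow> real \<Rightarrow> real) \<Rightarrow> tensor2 \<Rightarrow> tensor3 \<Rightarrow> bool" where
  "legendre_pair g v H B L \<longleftrightarrow> B \<in> transverse2 g v \<and> L \<in> self_dual g \<and>
     (\<exists>G \<in> transverse2 g v.
        ((\<lambda>B. H (s_inv g B) (p_inv g v B)) has_derivative (\<lambda>D. contr2 g G D)) (at B within transverse2 g v) \<and>
        2 *\<^sub>R G = - B - 2 *\<^sub>R slot g v L)"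

definition H_BB :: "real \<Rightarrow> real \<Rightarrow> real" where
  "H_BB s p = p"

definition H_MM :: "real \<Rightarrow> real \<Rightarrow> real \<Rightarrow> real" where
  "H_MM \<gamma> s p = cosh \<gamma> * s - sinh \<gamma> * sqrt (s\<^sup>2 - p\<^sup>2)"

definition V_MM :: "real \<Rightarrow> real \<Rightarrow> real" where
  "V_MM \<gamma> I = - (1 / 2) * tanh (\<gamma> / 2) * sqrt (I / 6)"

text \<open>For \<open>e = -1\<close> and \<open>e = 1\<close>: the limits of \<open>V_MM\<close> for \<open>\<gamma> \<rightarrow> \<infinity>\<close> and \<open>\<gamma> \<rightarrow> -\<infinity>\<close>.\<close>

definition V_lim :: "real \<Rightarrow> real \<Rightarrow> real" where
  "V_lim e I = e * (1 / 2) * sqrt (I / 6)"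


section \<open>Fields and field equations\<close>

definition partial :: "6 \<Rightarrow> (vec6 \<Rightarrow> 'a::real_normed_vector) \<Rightarrow> vec6 \<Rightarrow> 'a" where
  "partial \<mu> f x = frechet_derivative f (at x) (axis \<mu> 1)"

primrec ck_on :: "nat \<Rightarrow> vec6 set \<Rightarrow> (vec6 \<Rightarrow> 'a::real_normed_vector) \<Rightarrow> bool" where
  "ck_on 0 U f \<longleftrightarrow> continuous_on U f"
| "ck_on (Suc k) U f \<longleftrightarrow> (\<forall>x\<in>U. f differentiable (at x)) \<and> (\<forall>\<mu>. ck_on k U (partial \<mu> f))"

definition smooth_on :: "vec6 set \<Rightarrow> (vec6 \<Rightarrow> 'a::real_normed_vector) \<Rightarrow> bool" where
  "smooth_on U f \<longleftrightarrow> (\<forall>k. ck_on k U f)"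

definition metric_field :: "vec6 set \<Rightarrow> (vec6 \<Rightarrow> tensor2) \<Rightarrow> bool" where
  "metric_field U g \<longleftrightarrow> smooth_on U g \<and> (\<forall>x\<in>U. lorentzian (g x))"

definition gauge_field :: "vec6 set \<Rightarrow> (vec6 \<Rightarrow> tensor2) \<Rightarrow> bool" where
  "gauge_field U A \<longleftrightarrow> smooth_on U A \<and> (\<forall>x\<in>U. A x \<in> two_forms)"

definition field_strength :: "(vec6 \<Rightarrow> tensor2) \<Rightarrow> vec6 \<Rightarrow> tensor3" where
  "field_strength A x = (\<chi> \<mu> \<nu> \<rho>. partial \<mu> (\<lambda>y. A y $ \<nu> $ \<rho>) x
     + partial \<nu> (\<lambda>y. A y $ \<rho> $ \<mu>) x + partial \<rho> (\<lambda>y. A y $ \<mu> $ \<nu>) x)"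

definition grad :: "(vec6 \<Rightarrow> real) \<Rightarrow> vec6 \<Rightarrow> vec6" where
  "grad a x = (\<chi> \<mu>. partial \<mu> a x)"

definition unit_of :: "tensor2 \<Rightarrow> vec6 \<Rightarrow> vec6" where
  "unit_of g u = (1 / sqrt (- sq1 g u)) *\<^sub>R u"

text \<open>
  Euler--Lagrange equation \<open>\<partial>\<^sub>\<mu> (\<partial>L/\<partial>F\<^sub>\<mu>\<^sub>\<nu>\<^sub>\<rho>) = 0\<close> of a two-form gauge field that enters
  the density \<open>Lag\<close> (at \<open>x\<close>, all other fields fixed) only through its field strength \<open>F\<close>.
  The momentum \<open>P\<close> has upper indices, so the Euclidean inner product is the index contraction.
\<close>

definition two_form_eq :: "vec6 set \<Rightarrow> (vec6 \<Rightarrow> tensor3 \<Rightarrow> real) \<Rightarrow> (vec6 \<Rightarrow> tensor3) \<Rightarrow> bool" where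
  "two_form_eq U Lag F \<longleftrightarrow> (\<exists>P. \<forall>x\<in>U. P x \<in> three_forms \<and>
     (Lag x has_derivative (\<lambda>D. P x \<bullet> D)) (at (F x) within three_forms) \<and>
     P differentiable (at x) \<and>
     (\<forall>\<nu> \<rho>. (\<Sum>\<mu>\<in>UNIV. partial \<mu> (\<lambda>y. P y $ \<mu> $ \<nu> $ \<rho>) x) = 0))"

text \<open>The same for a scalar that enters only through its gradient.\<close>

definition scalar_eq :: "vec6 set \<Rightarrow> (vec6 \<Rightarrow> vec6 \<Rightarrow> real) \<Rightarrow> (vec6 \<Rightarrow> vec6) \<Rightarrow> bool" where
  "scalar_eq U Lag u \<longleftrightarrow> (\<exists>P. \<forall>x\<in>U.
     (Lag x has_derivative (\<lambda>D. P x \<bullet> D)) (at (u x)) \<and>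
     P differentiable (at x) \<and>
     (\<Sum>\<mu>\<in>UNIV. partial \<mu> (\<lambda>y. P y $ \<mu>) x) = 0)"

text \<open>
  On-shell PST configurations: the Euler--Lagrange equations of \<open>A\<close> and \<open>a\<close>, together with
  the non-linear self-duality \<open>E\<^sub>\<mu>\<^sub>\<nu> = 2 \<partial>H/\<partial>B\<^sup>\<mu>\<^sup>\<nu>\<close>, to which the equation of \<open>A\<close> is
  integrated by means of the local symmetry \<open>\<delta>A = da \<and> \<phi>\<close> of the PST action.
\<close>

definition pst_on_shell ::
  "vec6 set \<Rightarrow> (vec6 \<Rightarrow> tensor2) \<Rightarrow> (real \<Rightarrow> real \<Rightarrow> real) \<Rightarrow>
   (vec6 \<Rightarrow> tensor2) \<Rightarrow> (vec6 \<Rightarrow> real) \<Rightarrow> bool" where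
  "pst_on_shell U g H A a \<longleftrightarrow>
     metric_field U g \<and> gauge_field U A \<and> smooth_on U a \<and> (\<forall>x\<in>U. sq1 (g x) (grad a x) < 0) \<and>
     (let F = field_strength A; v = (\<lambda>x. unit_of (g x) (grad a x));
          Lag = (\<lambda>x w F. pst_lagrangian (g x) w H (E_of (g x) w F) (B_of (g x) w F))
      in two_form_eq U (\<lambda>x. Lag x (v x)) F \<and>
         scalar_eq U (\<lambda>x u. Lag x (unit_of (g x) u) (F x)) (grad a) \<and>
         (\<forall>x\<in>U. \<exists>G\<in>transverse2 (g x) (v x).
            ((\<lambda>B. H (s_inv (g x) B) (p_inv (g x) (v x) B)) has_derivative (\<lambda>D. contr2 (g x) G D))
              (at (B_of (g x) (v x) (F x)) within transverse2 (g x) (v x)) \<and>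
            E_of (g x) (v x) (F x) = 2 *\<^sub>R G))"

text \<open>
  The clone Lagrangian, with \<open>k\<close> the numerical coefficient of \<open>a \<epsilon> F Q\<close>.
  \<open>I_inv\<close> of \<open>X\<^sup>+\<close> is \<open>X\<^sup>+\<^sub>\<mu>\<^sub>\<nu>\<^sub>\<rho> X\<^sup>+\<^sup>\<nu>\<^sup>\<rho>\<^sup>\<lambda> X\<^sup>+\<^sub>\<lambda>\<^sub>\<kappa>\<^sub>\<sigma> X\<^sup>+\<^sup>\<kappa>\<^sup>\<sigma>\<^sup>\<mu>\<close>
  by cyclicity of three-form indices.
\<close>

definition plus_part :: "tensor2 \<Rightarrow> tensor3 \<Rightarrow> tensor3" where
  "plus_part g X = (1 / 2) *\<^sub>R (X + dual3 g X)"

definition clone_lagrangian ::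
  "real \<Rightarrow> tensor2 \<Rightarrow> (real \<Rightarrow> real) \<Rightarrow> tensor3 \<Rightarrow> tensor3 \<Rightarrow> real \<Rightarrow> real" where
  "clone_lagrangian k g V F Q a =
     (let X = F + a *\<^sub>R Q in
        - vol g / fact 4 * contr3 g X X
        + k * a * (\<Sum>\<mu>\<in>UNIV. \<Sum>\<nu>\<in>UNIV. \<Sum>\<rho>\<in>UNIV. \<Sum>\<sigma>\<in>UNIV. \<Sum>\<tau>\<in>UNIV. \<Sum>\<kappa>\<in>UNIV.
             eps \<mu> \<nu> \<rho> \<sigma> \<tau> \<kappa> * F $ \<mu> $ \<nu> $ \<rho> * Q $ \<sigma> $ \<tau> $ \<kappa>)
        - vol g * V (I_inv g (plus_part g X)))"

definition clone_X :: "(vec6 \<Rightarrow> tensor2) \<Rightarrow> (vec6 \<Rightarrow> tensor2) \<Rightarrow> (vec6 \<Rightarrow> real) \<Rightarrow> vec6 \<Rightarrow> tensor3" where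
  "clone_X A A' a x = field_strength A x + a x *\<^sub>R field_strength A' x"

text \<open>
  The gradient of \<open>a\<close> must be nowhere null (in particular nowhere zero): it is by contraction
  with it that the equations of \<open>A\<close> and \<open>A'\<close> become algebraic, and contraction with a null
  vector does not determine the anti-self-dual part of \<open>X\<close>.
\<close>

definition clone_on_shell ::
  "real \<Rightarrow> vec6 set \<Rightarrow> (vec6 \<Rightarrow> tensor2) \<Rightarrow> (real \<Rightarrow> real) \<Rightarrow>
   (vec6 \<Rightarrow> tensor2) \<Rightarrow> (vec6 \<Rightarrow> tensor2) \<Rightarrow> (vec6 \<Rightarrow> real) \<Rightarrow> bool" where
  "clone_on_shell k U g V A A' a \<longleftrightarrow>
     metric_field U g \<and> gauge_field U A \<and> gauge_field U A' \<and> smooth_on U a \<and>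
     (\<forall>x\<in>U. sq1 (g x) (grad a x) \<noteq> 0) \<and>
     (let F = field_strength A; Q = field_strength A'
      in two_form_eq U (\<lambda>x F. clone_lagrangian k (g x) V F (Q x) (a x)) F \<and>
         two_form_eq U (\<lambda>x Q. clone_lagrangian k (g x) V (F x) Q (a x)) Q \<and>
         (\<forall>x\<in>U. ((\<lambda>\<alpha>. clone_lagrangian k (g x) V (F x) (Q x) \<alpha>) has_real_derivative 0) (at (a x))))"

text \<open>
  The coefficient of the topological term is written as \<open>1/12\<close> in the literature.  With \<open>eps\<close>
  normalised to \<open>1\<close>, the coefficient for which the field equations reduce to
  \<open>X\<^sup>-\<^sub>\<mu>\<^sub>\<nu> = \<partial>V/\<partial>X\<^sup>+\<^sup>\<mu>\<^sup>\<nu>\<close>, as in the INZ-type formulation, is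
  \<open>1/2 \<cdot> (1/3!)\<^sup>2 = 1/72\<close>.
\<close>

definition clone_coeffs :: "real set" where
  "clone_coeffs = {1 / 12, 1 / 72}"

end

(* A frame of positive determinant in which the metric is Minkowski and v^mu = (1,0,...,0) carries
   everything to one standard point, where a self-dual three-form is the same thing as its transverse
   two-form Lambda_ij = Lambda_ij0, and I = 96 (s^2 - p^2) evaluated on the latter. A further rotation
   gives the two-form the normal form with the two blocks x >= y >= 0, so that s = (x^2 + y^2)/2,
   p = x y and I = 24 (x^2 - y^2)^2.

   At a normal form, s and p are even in each of the eight directions off the two blocks, hence the
   gradient of any function of s and p has only the two block components. For H = p they are
   (y, x)/2, so that Lambda has equal blocks -(x + y)/2 and I = 0. Conversely, at equal blocks V(I)
   is even in the directions (1,1) and (1,-1) as well, so its gradient vanishes for every V, the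
   algebraic equation becomes B = -Lambda and forces s = p; this fails on open sets. For
   V = (k/2) sqrt(I/6) = k (x^2 - y^2) the gradient is (k x, -k y), and all claims about V_lim and
   V_MM become identities in x, y and k.

   For the clone theory, combining the two gauge field equations with the Bianchi identities leaves
   the contraction of an algebraic expression with the gradient of a. For a timelike gradient this is
   the INZ equation for a multiple of B. The Bialynicki-Birula configuration has X^+ with I = 0, so
   V drops out, and what remains forces the gradient of a to be null. *)

theory Submission
  imports Defs
begin

section \<open>The permutation symbol\<close>

text \<open>Nothing is known about V, not even differentiability, so no chain rule through I is
  available. What the equations do supply is a derivative within a subspace of variations, and its
  restriction to a line inside that subspace is an ordinary real derivative. Arguments by symmetry
  along a line need no more than its existence; this is what makes the reduction to two numbers x
  and y worthwhile.

  For general H the two blocks of the auxiliary field are -((1 + H_s) x + H_p y)/2 and -((1 + H_s) y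
  + H_p x)/2. The difference of their squares is ((1 + H_s)^2 - H_p^2) (x^2 - y^2)/4, the origin of
  the factor H_p^2 - (1 + H_s)^2 in I, and this factor is zero for H = p.

  No Legendre relation is assumed of a theory that would yield H = p: it is derived from the
  differentiable branch in \<open>inz_yields\<close>, as an envelope argument. The regularity of the
  branch is used nowhere else.\<close>

abbreviation univ_sum :: "('i \<Rightarrow> 'a) \<Rightarrow> 'a::comm_monoid_add" (binder \<open>\<Sum>\<^sub>u\<close> 10) where
  "univ_sum f \<equiv> sum f UNIV"

lemma UNIV_6: "(UNIV :: 6 set) = {0,1,2,3,4,5}"
proof -
  have "card {0,1,2,3,4,5::6} = CARD(6)" by simp
  then show ?thesis by (metis card_eq_UNIV_imp_eq_UNIV finite)
qed

lemma sum_6: "(\<Sum>\<^sub>ui. f (i::6)) = f 0 + f 1 + f 2 + f 3 + f 4 + (f 5 :: 'a::comm_monoid_add)"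
  unfolding UNIV_6 by (simp add: add.assoc)

lemma all_6: "(\<forall>i::6. P i) \<longleftrightarrow> P 0 \<and> P 1 \<and> P 2 \<and> P 3 \<and> P 4 \<and> P 5"
  by (metis UNIV_6 UNIV_I insertE singletonD)

lemma cases_6: "(i::6) = 0 \<or> i = 1 \<or> i = 2 \<or> i = 3 \<or> i = 4 \<or> i = 5"
  using UNIV_6 by auto

text \<open>The order on indices orients the antisymmetry rules: simplification sorts indices
  upwards, and the side conditions i < j keep it from looping.\<close>

lemma less_6:
  "(0::6) < 1" "(0::6) < 2" "(0::6) < 3" "(0::6) < 4" "(0::6) < 5"
  "(1::6) < 2" "(1::6) < 3" "(1::6) < 4" "(1::6) < 5"
  "(2::6) < 3" "(2::6) < 4" "(2::6) < 5" "(3::6) < 4" "(3::6) < 5" "(4::6) < 5"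
  by (simp_all add: less_bit0_def bit0.Rep_numeral bit0.Rep_0 bit0.Rep_1)

definition rows6 :: "vec6 \<Rightarrow> vec6 \<Rightarrow> vec6 \<Rightarrow> vec6 \<Rightarrow> vec6 \<Rightarrow> vec6 \<Rightarrow> real^6^6" where
  "rows6 u0 u1 u2 u3 u4 u5 = (\<chi> r. if r = 0 then u0 else if r = 1 then u1 else if r = 2 then u2
     else if r = 3 then u3 else if r = 4 then u4 else u5)"

text \<open>With unit vectors as rows, only the permutation \<open>p = f\<close> survives in the
  Leibniz formula. Multilinearity, alternation and the transformation law of \<open>eps\<close> are
  then those of the determinant.\<close>

lemma eps_det: "eps i0 i1 i2 i3 i4 i5 =
  det (rows6 (axis i0 1) (axis i1 1) (axis i2 1) (axis i3 1) (axis i4 1) (axis i5 1))"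
proof -
  define f where "f = id(0 := i0, 1 := i1, 2 := i2, 3 := i3, 4 := i4, 5 := i5 :: 6)"
  define A where "A = rows6 (axis i0 1) (axis i1 1) (axis i2 1) (axis i3 1) (axis i4 1) (axis i5 1)"
  have A: "A $ r $ c = (if f r = c then 1 else 0)" for r c
    using cases_6[of r] unfolding A_def rows6_def f_def by (auto simp: axis_def)
  have pr: "(\<Prod>i\<in>UNIV. A $ i $ p i) = (if p = f then 1 else 0)" for p
  proof (cases "p = f")
    case False
    then obtain i where "p i \<noteq> f i" by auto
    then have "A $ i $ p i = 0" by (simp add: A)
    then show ?thesis using False by (metis (mono_tags, lifting) UNIV_I finite prod_zero)
  qed (simp add: A)
  have "det A = (\<Sum>p | p permutes UNIV. of_int (sign p) * (if p = f then 1 else 0))"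
    unfolding det_def pr ..
  also have "\<dots> = (if f permutes UNIV then of_int (sign f) else 0)"
    by (simp add: if_distrib if_distribR sum.delta cong: if_cong)
  also have "\<dots> = eps i0 i1 i2 i3 i4 i5"
    by (simp add: eps_def f_def[symmetric] permutes_def bij_iff)
  finally show ?thesis by (simp add: A_def)
qed

lemma det_linear_slot:
  fixes x :: "real^'n"
  shows "(\<Sum>\<^sub>ui. x $ i * det (\<chi> r. if r = k then axis i 1 else c r)) = det (\<chi> r. if r = k then x else c r)"
proof -
  have "x = (\<Sum>\<^sub>ui. x $ i *s axis i 1)" by (simp add: basis_expansion)
  then have "det (\<chi> r. if r = k then x else c r)
      = det (\<chi> r. if r = k then (\<Sum>\<^sub>ui. x $ i *s axis i 1) else c r)"
    by (rule arg_cong)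
  also have "\<dots> = (\<Sum>\<^sub>ui. det (\<chi> r. if r = k then x $ i *s axis i 1 else c r))"
    by (subst det_linear_row_sum) auto
  also have "\<dots> = (\<Sum>\<^sub>ui. x $ i * det (\<chi> r. if r = k then axis i 1 else c r))"
    by (subst det_row_mul) auto
  finally show ?thesis by simp
qed

text \<open>The shape that \<open>det_linear_slot\<close> expects; the zero vector is a placeholder
  for the row that is overwritten.\<close>

lemma rows6_slot:
  "rows6 u0 u1 u2 u3 u4 u5 = (\<chi> r. if r = 0 then u0 else rows6 0 u1 u2 u3 u4 u5 $ r)"
  "rows6 u0 u1 u2 u3 u4 u5 = (\<chi> r. if r = 1 then u1 else rows6 u0 0 u2 u3 u4 u5 $ r)"
  "rows6 u0 u1 u2 u3 u4 u5 = (\<chi> r. if r = 2 then u2 else rows6 u0 u1 0 u3 u4 u5 $ r)"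
  "rows6 u0 u1 u2 u3 u4 u5 = (\<chi> r. if r = 3 then u3 else rows6 u0 u1 u2 0 u4 u5 $ r)"
  "rows6 u0 u1 u2 u3 u4 u5 = (\<chi> r. if r = 4 then u4 else rows6 u0 u1 u2 u3 0 u5 $ r)"
  "rows6 u0 u1 u2 u3 u4 u5 = (\<chi> r. if r = 5 then u5 else rows6 u0 u1 u2 u3 u4 0 $ r)"
  by (simp_all add: rows6_def vec_eq_iff[where 'a=vec6] all_6)

lemma rows6_linear:
  "(\<Sum>\<^sub>ui. x $ i * det (rows6 (axis i 1) u1 u2 u3 u4 u5)) = det (rows6 x u1 u2 u3 u4 u5)"
  "(\<Sum>\<^sub>ui. x $ i * det (rows6 u0 (axis i 1) u2 u3 u4 u5)) = det (rows6 u0 x u2 u3 u4 u5)"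
  "(\<Sum>\<^sub>ui. x $ i * det (rows6 u0 u1 (axis i 1) u3 u4 u5)) = det (rows6 u0 u1 x u3 u4 u5)"
  "(\<Sum>\<^sub>ui. x $ i * det (rows6 u0 u1 u2 (axis i 1) u4 u5)) = det (rows6 u0 u1 u2 x u4 u5)"
  "(\<Sum>\<^sub>ui. x $ i * det (rows6 u0 u1 u2 u3 (axis i 1) u5)) = det (rows6 u0 u1 u2 u3 x u5)"
  "(\<Sum>\<^sub>ui. x $ i * det (rows6 u0 u1 u2 u3 u4 (axis i 1))) = det (rows6 u0 u1 u2 u3 u4 x)"
  subgoal by (subst (1 2) rows6_slot(1)) (rule det_linear_slot)
  subgoal by (subst (1 2) rows6_slot(2)) (rule det_linear_slot)
  subgoal by (subst (1 2) rows6_slot(3)) (rule det_linear_slot)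
  subgoal by (subst (1 2) rows6_slot(4)) (rule det_linear_slot)
  subgoal by (subst (1 2) rows6_slot(5)) (rule det_linear_slot)
  subgoal by (subst (1 2) rows6_slot(6)) (rule det_linear_slot)
  done

text \<open>The transformation of one lower index under the frame P. An upper index transforms by
  \<open>tr (transpose Q)\<close>, where Q is the inverse of P.\<close>

definition tr :: "real^6^6 \<Rightarrow> (6 \<Rightarrow> real) \<Rightarrow> 6 \<Rightarrow> real" where
  "tr P x a = (\<Sum>\<^sub>ui. P $ i $ a * x i)"

text \<open>Contracting every index with P turns the unit rows into columns of P, that is,
  multiplies the matrix of rows by \<open>transpose P\<close> from the right. The factor is
  multiplicativity of the determinant.\<close>

lemma eps_tr:
  "tr P (\<lambda>i0. tr P (\<lambda>i1. tr P (\<lambda>i2. tr P (\<lambda>i3. tr P (\<lambda>i4. tr P (\<lambda>i5.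
     eps i0 i1 i2 i3 i4 i5) a5) a4) a3) a2) a1) a0 = det P * eps a0 a1 a2 a3 a4 a5"
proof -
  have col: "P $ i $ a = column a P $ i" for i a by (simp add: column_def)
  have "rows6 (column a0 P) (column a1 P) (column a2 P) (column a3 P) (column a4 P) (column a5 P)
     = rows6 (axis a0 1) (axis a1 1) (axis a2 1) (axis a3 1) (axis a4 1) (axis a5 1) ** transpose P"
  proof -
    have *: "(\<Sum>\<^sub>uk. axis a 1 $ k * P $ c $ k) = P $ c $ a" for a c
      
      unfolding axis_def by (simp add: if_distrib[of "\<lambda>x. x * _"] cong: if_cong)
    show ?thesis
      by (simp add: vec_eq_iff[where 'a=vec6] vec_eq_iff[where 'b=6] rows6_def matrix_matrix_mult_def
          transpose_def column_def * all_6)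
  qed
  then show ?thesis
    unfolding tr_def eps_det col rows6_linear by (simp add: det_mul det_transpose mult.commute)
qed

lemma eps_repeat:
  "eps a a c d e f = 0" "eps a b a d e f = 0" "eps a b c a e f = 0" "eps a b c d a f = 0"
  "eps a b c d e a = 0" "eps b a a d e f = 0" "eps b a c a e f = 0" "eps b a c d a f = 0"
  "eps b a c d e a = 0" "eps b c a a e f = 0" "eps b c a d a f = 0" "eps b c a d e a = 0"
  "eps b c d a a f = 0" "eps b c d a e a = 0" "eps b c d e a a = 0"
proof -
  have *: "eps i0 i1 i2 i3 i4 i5 = 0"
    if "x \<noteq> y" "(id(0 := i0, 1 := i1, 2 := i2, 3 := i3, 4 := i4, 5 := i5)) x
        = (id(0 := i0, 1 := i1, 2 := i2, 3 := i3, 4 := i4, 5 := i5)) y" for i0 i1 i2 i3 i4 i5 and x y :: 6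
    using that unfolding eps_def Let_def by (meson bij_is_inj injD)
  show "eps a a c d e f = 0" by (rule *[of 0 1]) auto
  show "eps a b a d e f = 0" by (rule *[of 0 2]) auto
  show "eps a b c a e f = 0" by (rule *[of 0 3]) auto
  show "eps a b c d a f = 0" by (rule *[of 0 4]) auto
  show "eps a b c d e a = 0" by (rule *[of 0 5]) auto
  show "eps b a a d e f = 0" by (rule *[of 1 2]) auto
  show "eps b a c a e f = 0" by (rule *[of 1 3]) auto
  show "eps b a c d a f = 0" by (rule *[of 1 4]) auto
  show "eps b a c d e a = 0" by (rule *[of 1 5]) auto
  show "eps b c a a e f = 0" by (rule *[of 2 3]) auto
  show "eps b c a d a f = 0" by (rule *[of 2 4]) auto
  show "eps b c a d e a = 0" by (rule *[of 2 5]) auto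
  show "eps b c d a a f = 0" by (rule *[of 3 4]) auto
  show "eps b c d a e a = 0" by (rule *[of 3 5]) auto
  show "eps b c d e a a = 0" by (rule *[of 4 5]) auto
qed

lemma eps_swap:
  "eps b a c d e f = - eps a b c d e f" "eps c b a d e f = - eps c a b d e f"
  "eps c d b a e f = - eps c d a b e f" "eps c d e b a f = - eps c d e a b f"
  "eps c d e f b a = - eps c d e f a b"
proof -
  have *: "det A = - det B" if "x \<noteq> y" "A = (\<chi> i. B $ Transposition.transpose x y i)"
    for A B :: "real^6^6" and x y
    using that det_permute_rows[of "Transposition.transpose x y" B]
    by (simp add: permutes_swap_id sign_swap_id)
  note d = rows6_def vec_eq_iff[where 'a=vec6] all_6 Transposition.transpose_def
  show "eps b a c d e f = - eps a b c d e f" unfolding eps_det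
    by (rule *[of 0 1]) (simp_all add: d)
  show "eps c b a d e f = - eps c a b d e f" unfolding eps_det
    by (rule *[of 1 2]) (simp_all add: d)
  show "eps c d b a e f = - eps c d a b e f" unfolding eps_det
    by (rule *[of 2 3]) (simp_all add: d)
  show "eps c d e b a f = - eps c d e a b f" unfolding eps_det
    by (rule *[of 3 4]) (simp_all add: d)
  show "eps c d e f b a = - eps c d e f a b" unfolding eps_det
    by (rule *[of 4 5]) (simp_all add: d)
qed

text \<open>The swaps as conditional rewrite rules; together with \<open>eps_repeat\<close> they
  evaluate \<open>eps\<close> at any concrete indices.\<close>

lemma eps_sort:
  "a < b \<Longrightarrow> eps b a c d e f = - eps a b c d e f" "a < b \<Longrightarrow> eps c b a d e f = - eps c a b d e f"
  "a < b \<Longrightarrow> eps c d b a e f = - eps c d a b e f" "a < b \<Longrightarrow> eps c d e b a f = - eps c d e a b f"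
  "a < b \<Longrightarrow> eps c d e f b a = - eps c d e f a b"
  by (rule eps_swap)+

lemma eps_012345: "eps 0 1 2 3 4 5 = 1"
proof -
  have "id(0 := 0, 1 := 1, 2 := 2, 3 := 3, 4 := 4, 5 := 5 :: 6) = id" by auto
  then show ?thesis by (simp add: eps_def Let_def)
qed

lemmas eps_eval = eps_012345 eps_repeat eps_sort less_6

section \<open>Change of frame\<close>

definition tr2 :: "real^6^6 \<Rightarrow> (6 \<Rightarrow> 6 \<Rightarrow> real) \<Rightarrow> 6 \<Rightarrow> 6 \<Rightarrow> real" where
  "tr2 P f a b = tr P (\<lambda>i. tr P (f i) b) a"

definition tr3 :: "real^6^6 \<Rightarrow> (6 \<Rightarrow> 6 \<Rightarrow> 6 \<Rightarrow> real) \<Rightarrow> 6 \<Rightarrow> 6 \<Rightarrow> 6 \<Rightarrow> real" where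
  "tr3 P f a b c = tr P (\<lambda>i. tr2 P (f i) b c) a"

lemma tr_sum: "tr P (\<lambda>i. \<Sum>k\<in>A. f i k) a = (\<Sum>k\<in>A. tr P (\<lambda>i. f i k) a)"
  unfolding tr_def sum_distrib_left by (rule sum.swap)

lemma tr_cmult: "tr P (\<lambda>i. c * f i) a = c * tr P f a"
  by (simp add: tr_def sum_distrib_left mult.left_commute)

lemma tr_mult_right: "tr P (\<lambda>i. f i * c) a = tr P f a * c"
  by (simp add: tr_def sum_distrib_right mult.assoc)

lemma tr_add: "tr P (\<lambda>i. f i + h i) a = tr P f a + tr P h a"
  by (simp add: tr_def sum.distrib algebra_simps)

lemma tr_minus: "tr P (\<lambda>i. - f i) a = - tr P f a"
  by (simp add: tr_def sum_negf)

lemma tr_zero: "tr P (\<lambda>i. 0) a = 0"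
  by (simp add: tr_def)

lemma tr_commute: "tr P (\<lambda>i. tr R (\<lambda>j. f i j) b) a = tr R (\<lambda>j. tr P (\<lambda>i. f i j) a) b"
  unfolding tr_def[of R] by (simp add: tr_sum tr_cmult)

lemma tr_tr: "tr A (tr B x) a = tr (B ** A) x a"
proof -
  have "tr A (tr B x) a = (\<Sum>\<^sub>ui j. B $ j $ i * A $ i $ a * x j)"
    by (simp add: tr_def sum_distrib_left mult_ac)
  also have "\<dots> = (\<Sum>\<^sub>uj i. B $ j $ i * A $ i $ a * x j)" by (rule sum.swap)
  finally show ?thesis by (simp add: tr_def matrix_matrix_mult_def sum_distrib_right)
qed

lemma tr_one: "tr (mat 1) x a = x a"
  by (simp add: tr_def mat_def if_distrib[of "\<lambda>x. x * _"] cong: if_cong)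

lemma tr2_tr: "tr2 A (\<lambda>j l. tr B (\<lambda>k. F k j l) i) b c = tr B (\<lambda>k. tr2 A (F k) b c) i"
proof -
  have "tr A (\<lambda>l. tr B (\<lambda>k. F k j l) i) c = tr B (\<lambda>k. tr A (F k j) c) i" for j
    by (rule tr_commute)
  then show ?thesis unfolding tr2_def by (simp add: tr_commute[of A B])
qed

lemma tr2_tr2: "tr2 A (tr2 B f) a b = tr2 (B ** A) f a b"
proof -
  have "tr A (\<lambda>j. tr B (\<lambda>k. tr B (f k) j) i) b = tr B (\<lambda>k. tr A (tr B (f k)) b) i" for i
    by (rule tr_commute)
  then have "tr2 A (tr2 B f) a b = tr A (tr B (\<lambda>k. tr A (tr B (f k)) b)) a"
    unfolding tr2_def by simp
  then show ?thesis by (simp add: tr_tr tr2_def)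
qed

lemma tr3_tr3: "tr3 A (tr3 B f) a b c = tr3 (B ** A) f a b c"
proof -
  have "tr2 A (\<lambda>j l. tr B (\<lambda>k. tr2 B (f k) j l) i) b c = tr B (\<lambda>k. tr2 A (tr2 B (f k)) b c) i" for i
    by (rule tr2_tr)
  then have "tr3 A (tr3 B f) a b c = tr A (tr B (\<lambda>k. tr2 A (tr2 B (f k)) b c)) a"
    unfolding tr3_def by simp
  then show ?thesis by (simp add: tr_tr tr3_def tr2_tr2)
qed

lemma tr2_one: "tr2 (mat 1) f a b = f a b" and tr3_one: "tr3 (mat 1) h a b c = h a b c"
  by (simp_all add: tr2_def tr3_def tr_one)

lemma tr3_last: "tr3 P f a b c = tr2 P (\<lambda>i j. tr P (f i j) c) a b"
  unfolding tr3_def tr2_def ..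

lemma tr2_sum: "tr2 P (\<lambda>i j. \<Sum>k\<in>A. f i j k) a b = (\<Sum>k\<in>A. tr2 P (\<lambda>i j. f i j k) a b)"
  by (simp add: tr2_def tr_sum)

lemma tr3_sum: "tr3 P (\<lambda>i j l. \<Sum>k\<in>A. f i j l k) a b c = (\<Sum>k\<in>A. tr3 P (\<lambda>i j l. f i j l k) a b c)"
  by (simp add: tr3_def tr2_sum tr_sum)

lemma tr2_mult_right: "tr2 P (\<lambda>i j. f i j * k) a b = tr2 P f a b * k"
  by (simp add: tr2_def tr_mult_right)

lemma tr3_mult_right: "tr3 P (\<lambda>i j l. f i j l * k) a b c = tr3 P f a b c * k"
  by (simp add: tr3_def tr2_mult_right tr_mult_right)

lemma tr2_cmult: "tr2 P (\<lambda>i j. k * f i j) a b = k * tr2 P f a b"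
  by (simp add: tr2_def tr_cmult)

lemma tr3_cmult: "tr3 P (\<lambda>i j l. k * f i j l) a b c = k * tr3 P f a b c"
  by (simp add: tr3_def tr2_cmult tr_cmult)

lemma tr2_add: "tr2 P (\<lambda>i j. f i j + h i j) a b = tr2 P f a b + tr2 P h a b"
  by (simp add: tr2_def tr_add)

lemma tr3_add: "tr3 P (\<lambda>i j l. f i j l + h i j l) a b c = tr3 P f a b c + tr3 P h a b c"
  by (simp add: tr3_def tr2_add tr_add)

lemma tr2_swap: "tr2 P f b a = tr2 P (\<lambda>i j. f j i) a b"
  unfolding tr2_def by (rule tr_commute)

lemma tr2_minus: "tr2 P (\<lambda>i j. - f i j) a b = - tr2 P f a b"
  by (simp add: tr2_def tr_minus)

lemma tr3_swap12: "tr3 P f b a c = tr3 P (\<lambda>i j k. f j i k) a b c"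
  unfolding tr3_last by (rule tr2_swap)

lemma tr3_swap23: "tr3 P f a c b = tr3 P (\<lambda>i j k. f i k j) a b c"
proof -
  have "tr2 P (f i) c b = tr2 P (\<lambda>j k. f i k j) b c" for i by (rule tr2_swap)
  then show ?thesis unfolding tr3_def by simp
qed

lemma tr3_minus: "tr3 P (\<lambda>i j l. - f i j l) a b c = - tr3 P f a b c"
  by (simp add: tr3_def tr2_minus tr_minus)

text \<open>A lower index contributes P and an upper one the inverse of P, so the two cancel. All
  invariance statements below reduce to this one, index by index.\<close>

lemma tr_contr:
  assumes "P ** Q = mat 1"
  shows "(\<Sum>\<^sub>ua. tr P x a * tr (transpose Q) y a) = (\<Sum>\<^sub>ui. x i * y i)"
proof -
  have e: "tr P x a * tr (transpose Q) y a = tr P (\<lambda>i. x i * tr (transpose Q) y a) a" for a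
    by (simp add: tr_mult_right)
  have "(\<Sum>\<^sub>ua. tr P x a * tr (transpose Q) y a)
      = (\<Sum>\<^sub>ua i. P $ i $ a * (x i * tr (transpose Q) y a))"
    unfolding e unfolding tr_def[of P] ..
  also have "\<dots> = (\<Sum>\<^sub>ui a. P $ i $ a * (x i * tr (transpose Q) y a))"
    by (rule sum.swap)
  also have "\<dots> = (\<Sum>\<^sub>ui. x i * tr (transpose P) (tr (transpose Q) y) i)"
    unfolding tr_def[of "transpose P"] by (simp add: transpose_def sum_distrib_left mult_ac)
  also have "\<dots> = (\<Sum>\<^sub>ui. x i * tr (transpose (P ** Q)) y i)"
    by (simp add: tr_tr matrix_transpose_mul)
  finally show ?thesis by (simp add: assms transpose_mat tr_one)
qed

lemma tr_contr':
  assumes "P ** Q = mat 1"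
  shows "(\<Sum>\<^sub>ua. tr (transpose Q) y a * tr P x a) = (\<Sum>\<^sub>ui. y i * x i)"
  using tr_contr[OF assms, of x y] by (simp add: mult.commute)

lemma tr2_contr:
  assumes "P ** Q = mat 1"
  shows "(\<Sum>\<^sub>ua b. tr2 P x a b * tr2 (transpose Q) y a b) = (\<Sum>\<^sub>ui j. x i j * y i j)"
proof -
  have "(\<Sum>\<^sub>ua b. tr2 P x a b * tr2 (transpose Q) y a b)
      = (\<Sum>\<^sub>ub a. tr2 P x a b * tr2 (transpose Q) y a b)" by (rule sum.swap)
  also have "\<dots> = (\<Sum>\<^sub>ub i. tr P (x i) b * tr (transpose Q) (y i) b)"
    by (simp add: tr2_def tr_contr[OF assms])
  also have "\<dots> = (\<Sum>\<^sub>ui b. tr P (x i) b * tr (transpose Q) (y i) b)" by (rule sum.swap)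
  finally show ?thesis by (simp add: tr_contr[OF assms])
qed

lemma sum_rotate3: "(\<Sum>a\<in>A. \<Sum>b\<in>B. \<Sum>c\<in>C. f a b c) = (\<Sum>b\<in>B. \<Sum>c\<in>C. \<Sum>a\<in>A. f a b c)"
  by (subst sum.swap, rule sum.cong, rule refl, rule sum.swap)

lemma tr3_contr:
  assumes "P ** Q = mat 1"
  shows "(\<Sum>\<^sub>ua b c. tr3 P x a b c * tr3 (transpose Q) y a b c)
    = (\<Sum>\<^sub>ui j k. x i j k * y i j k)"
proof -
  have "(\<Sum>\<^sub>ua b c. tr3 P x a b c * tr3 (transpose Q) y a b c)
      = (\<Sum>\<^sub>ub c a. tr3 P x a b c * tr3 (transpose Q) y a b c)"
    by (rule sum_rotate3)
  also have "\<dots> = (\<Sum>\<^sub>ub c i. tr2 P (x i) b c * tr2 (transpose Q) (y i) b c)"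
    by (simp add: tr3_def tr_contr[OF assms])
  also have "\<dots> = (\<Sum>\<^sub>ui b c. tr2 P (x i) b c * tr2 (transpose Q) (y i) b c)"
    by (rule sum_rotate3[symmetric])
  finally show ?thesis by (simp add: tr2_contr[OF assms])
qed

section \<open>Pull-back of covariant tensors along a frame\<close>

definition pull1 :: "real^6^6 \<Rightarrow> vec6 \<Rightarrow> vec6" where
  "pull1 P u = (\<chi> a. tr P (\<lambda>i. u $ i) a)"

definition pull2 :: "real^6^6 \<Rightarrow> tensor2 \<Rightarrow> tensor2" where
  "pull2 P T = (\<chi> a b. tr2 P (\<lambda>i j. T $ i $ j) a b)"

definition pull3 :: "real^6^6 \<Rightarrow> tensor3 \<Rightarrow> tensor3" where
  "pull3 P T = (\<chi> a b c. tr3 P (\<lambda>i j k. T $ i $ j $ k) a b c)"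

lemma pull1_pull1: "pull1 A (pull1 B u) = pull1 (B ** A) u"
  by (simp add: pull1_def tr_tr vec_eq_iff)

lemma pull2_pull2: "pull2 A (pull2 B u) = pull2 (B ** A) u"
  by (simp add: pull2_def tr2_tr2 vec_eq_iff)

lemma pull3_pull3: "pull3 A (pull3 B u) = pull3 (B ** A) u"
  by (simp add: pull3_def tr3_tr3 vec_eq_iff)

lemma pull_one: "pull1 (mat 1) u = u" "pull2 (mat 1) T = T" "pull3 (mat 1) L = L"
  by (simp_all add: pull1_def pull2_def pull3_def tr_one tr2_one tr3_one vec_eq_iff)

lemma linear_pull: "linear (pull1 P)" "linear (pull2 P)" "linear (pull3 P)"
  by (rule linearI; simp add: pull1_def pull2_def pull3_def vec_eq_iff
      tr_add tr2_add tr3_add tr_cmult tr2_cmult tr3_cmult)+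

lemma pull2_matrix: "pull2 P T = transpose P ** T ** P"
proof -
  have "(\<Sum>\<^sub>ui. P $ i $ a * (\<Sum>\<^sub>uj. P $ j $ b * T $ i $ j))
      = (\<Sum>\<^sub>uj. (\<Sum>\<^sub>ui. P $ i $ a * T $ i $ j) * P $ j $ b)" for a b
    unfolding sum_distrib_left sum_distrib_right by (subst sum.swap) (simp add: mult_ac)
  then show ?thesis
    by (simp add: pull2_def tr2_def tr_def matrix_matrix_mult_def transpose_def vec_eq_iff)
qed

lemma two_forms_skew: "B \<in> two_forms \<Longrightarrow> B $ j $ i = - B $ i $ j"
  unfolding two_forms_def by blast

lemma three_forms_skew:
  assumes "F \<in> three_forms"
  shows "F $ j $ i $ k = - F $ i $ j $ k" "F $ i $ k $ j = - F $ i $ j $ k"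
  using assms unfolding three_forms_def by blast+

lemma pull2_two_forms: assumes "B \<in> two_forms" shows "pull2 P B \<in> two_forms"
proof -
  have "tr2 P (\<lambda>i j. B $ i $ j) b a = - tr2 P (\<lambda>i j. B $ i $ j) a b" for a b
    unfolding tr2_swap[of P "\<lambda>i j. B $ i $ j" b a] by (subst two_forms_skew[OF assms]) (simp add: tr2_minus)
  then show ?thesis unfolding two_forms_def pull2_def mem_Collect_eq vec_lambda_beta by blast
qed

lemma matrix_inv_inverse:
  assumes "invertible A" shows "A ** matrix_inv A = mat 1 \<and> matrix_inv A ** A = mat 1"
  using assms unfolding invertible_def matrix_inv_def by (rule someI_ex)

lemma raise_tr:
  "raise1 g u $ a = tr (transpose (matrix_inv g)) (\<lambda>i. u $ i) a"
  "raise2 g T $ a $ b = tr2 (transpose (matrix_inv g)) (\<lambda>i j. T $ i $ j) a b"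
  "raise3 g L $ a $ b $ c = tr3 (transpose (matrix_inv g)) (\<lambda>i j k. L $ i $ j $ k) a b c"
  by (simp_all add: raise1_def raise2_def raise3_def tr_def tr2_def tr3_def transpose_def
      sum_distrib_left mult_ac)

text \<open>The determinant is positive because \<open>vol\<close> is the positive square root: a
  frame of the other orientation would reverse the sign of \<open>dual3\<close> and turn self-dual
  forms into anti-self-dual ones.\<close>

locale frame_change =
  fixes P Q g :: "real^6^6"
  assumes PQ: "P ** Q = mat 1" and det_pos: "0 < det P" and inv: "invertible g"
begin

lemma QP: "Q ** P = mat 1"
  using PQ by (simp add: matrix_left_right_inverse)

lemma pull_inverse:
  "pull1 P (pull1 Q u) = u" "pull2 P (pull2 Q T) = T" "pull3 P (pull3 Q L) = L"
  "pull1 Q (pull1 P u) = u" "pull2 Q (pull2 P T) = T" "pull3 Q (pull3 P L) = L"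
  by (simp_all add: pull1_pull1 pull2_pull2 pull3_pull3 pull_one PQ QP)

lemma det_Q: "det P * det Q = 1"
  using PQ by (metis det_I det_mul)

lemma inv_g: "g ** matrix_inv g = mat 1" "matrix_inv g ** g = mat 1"
  using matrix_inv_inverse[OF inv] by auto

lemma inv_pull: "invertible (pull2 P g)"
  and matrix_inv_pull: "matrix_inv (pull2 P g) = Q ** matrix_inv g ** transpose Q"
proof -
  have t: "transpose Q ** transpose P = mat 1"
    by (metis PQ matrix_transpose_mul transpose_mat)
  have "Q ** matrix_inv g ** transpose Q ** pull2 P g
      = Q ** (matrix_inv g ** ((transpose Q ** transpose P) ** (g ** P)))"
    by (simp add: pull2_matrix matrix_mul_assoc)
  also have "\<dots> = Q ** ((matrix_inv g ** g) ** P)" by (simp add: t matrix_mul_assoc)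
  also have "\<dots> = mat 1" by (simp add: inv_g QP)
  finally have l: "Q ** matrix_inv g ** transpose Q ** pull2 P g = mat 1" .
  then have r: "pull2 P g ** (Q ** matrix_inv g ** transpose Q) = mat 1"
    by (simp add: matrix_left_right_inverse)
  show "invertible (pull2 P g)" using l r unfolding invertible_def by blast
  then have "matrix_inv (pull2 P g) ** pull2 P g = mat 1" using matrix_inv_inverse by blast
  then have "matrix_inv (pull2 P g) ** (pull2 P g ** (Q ** matrix_inv g ** transpose Q))
      = Q ** matrix_inv g ** transpose Q" by (simp add: matrix_mul_assoc)
  then show "matrix_inv (pull2 P g) = Q ** matrix_inv g ** transpose Q" by (simp add: r)
qed

text \<open>By \<open>raise_tr\<close>, raising an index is itself a \<open>tr\<close>. Commuting it
  with the change of frame once, at the level of matrices, gives the transformation of raised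
  tensors of every rank.\<close>

lemma up_pull: "P ** transpose (matrix_inv (pull2 P g)) = transpose (matrix_inv g) ** transpose Q"
proof -
  have "P ** transpose (matrix_inv (pull2 P g)) = (P ** Q) ** (transpose (matrix_inv g) ** transpose Q)"
    by (simp add: matrix_inv_pull matrix_transpose_mul matrix_mul_assoc)
  then show ?thesis by (simp add: PQ)
qed

lemma raise1_pull: "raise1 (pull2 P g) (pull1 P u) $ a = tr (transpose Q) (\<lambda>i. raise1 g u $ i) a"
  by (simp add: raise_tr pull1_def tr_tr up_pull)

lemma raise2_pull: "raise2 (pull2 P g) (pull2 P T) $ a $ b = tr2 (transpose Q) (\<lambda>i j. raise2 g T $ i $ j) a b"
  by (simp add: raise_tr pull2_def[of P T] tr2_tr2 up_pull)

lemma raise3_pull: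
  "raise3 (pull2 P g) (pull3 P L) $ a $ b $ c = tr3 (transpose Q) (\<lambda>i j k. raise3 g L $ i $ j $ k) a b c"
  by (simp add: raise_tr pull3_def tr3_tr3 up_pull)

lemma sq1_pull: "sq1 (pull2 P g) (pull1 P u) = sq1 g u"
  unfolding sq1_def raise1_pull by (simp add: pull1_def tr_contr[OF PQ])

lemma contr2_pull: "contr2 (pull2 P g) (pull2 P S) (pull2 P T) = contr2 g S T"
  unfolding contr2_def raise2_pull by (simp add: pull2_def[of P S] tr2_contr[OF PQ])

lemma contr3_pull: "contr3 (pull2 P g) (pull3 P S) (pull3 P T) = contr3 g S T"
  unfolding contr3_def raise3_pull by (simp add: pull3_def[of P S] tr3_contr[OF PQ])

lemma slot_pull: "slot (pull2 P g) (pull1 P v) (pull3 P T) = pull2 P (slot g v T)"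
proof -
  have "(\<Sum>\<^sub>uc. tr3 P (\<lambda>i j k. T $ i $ j $ k) a b c * tr (transpose Q) (\<lambda>i. raise1 g v $ i) c)
      = tr2 P (\<lambda>i j. \<Sum>\<^sub>uc. tr P (\<lambda>k. T $ i $ j $ k) c * tr (transpose Q) (\<lambda>i. raise1 g v $ i) c) a b" for a b
    by (simp add: tr3_last tr2_sum tr2_mult_right)
  then show ?thesis
    by (simp add: slot_def raise1_pull vec_eq_iff pull3_def pull2_def[where T = "vec_lambda _"]
        tr_contr[OF PQ])
qed

lemma contract_pull:
  "(\<Sum>\<^sub>u\<nu>. pull2 P B $ a $ \<nu> * raise1 (pull2 P g) (pull1 P v) $ \<nu>)
   = tr P (\<lambda>i. \<Sum>\<^sub>u\<nu>. B $ i $ \<nu> * raise1 g v $ \<nu>) a"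
proof -
  have "tr2 P (\<lambda>i j. B $ i $ j) a \<nu> * tr (transpose Q) (\<lambda>i. raise1 g v $ i) \<nu>
      = tr P (\<lambda>i. tr P (\<lambda>j. B $ i $ j) \<nu> * tr (transpose Q) (\<lambda>i. raise1 g v $ i) \<nu>) a" for \<nu>
    by (simp add: tr2_def tr_mult_right)
  then show ?thesis
    by (simp add: raise1_pull pull2_def[of P B] tr_contr[OF PQ] flip: tr_sum)
qed

lemma s_inv_pull: "s_inv (pull2 P g) (pull2 P B) = s_inv g B"
  by (simp add: s_inv_def contr2_pull)

lemma vol_pull: "vol (pull2 P g) = det P * vol g"
proof -
  have "- det (pull2 P g) = (det P)\<^sup>2 * - det g"
    by (simp add: pull2_matrix det_mul det_transpose power2_eq_square)
  then show ?thesis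
    using det_pos unfolding vol_def by (simp only: real_sqrt_mult) simp
qed

lemma M_mat_pull: "M_mat (pull2 P g) (pull3 P L) $ a $ b
    = tr P (\<lambda>i. tr (transpose Q) (\<lambda>j. M_mat g L $ i $ j) b) a"
proof -
  have "M_mat (pull2 P g) (pull3 P L) $ a $ b
      = (\<Sum>\<^sub>u\<rho> \<tau>. tr P (\<lambda>i. tr2 P (\<lambda>j k. L $ i $ j $ k) \<rho> \<tau>) a *
           tr (transpose Q) (\<lambda>i. tr2 (transpose Q) (\<lambda>j k. raise3 g L $ i $ j $ k) \<rho> \<tau>) b)"
    unfolding M_mat_def vec_lambda_beta raise3_pull unfolding pull3_def tr3_def vec_lambda_beta ..
  also have "\<dots> = tr P (\<lambda>i. tr (transpose Q) (\<lambda>j. \<Sum>\<^sub>u\<rho> \<tau>.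
      tr2 P (\<lambda>j k. L $ i $ j $ k) \<rho> \<tau> * tr2 (transpose Q) (\<lambda>l k. raise3 g L $ j $ l $ k) \<rho> \<tau>) b) a"
    by (simp add: tr_sum tr_cmult tr_mult_right)
  finally show ?thesis by (simp add: tr2_contr[OF PQ] M_mat_def)
qed

lemma I_inv_pull: "I_inv (pull2 P g) (pull3 P L) = I_inv g L"
proof -
  let ?M = "\<lambda>i j. M_mat g L $ i $ j"
  have "I_inv (pull2 P g) (pull3 P L) = (\<Sum>\<^sub>ub a.
      tr P (\<lambda>i. tr (transpose Q) (?M i) b) a * tr (transpose Q) (\<lambda>i. tr P (\<lambda>j. ?M j i) b) a)"
    unfolding I_inv_def M_mat_pull by (subst sum.swap) (simp add: tr_commute[of P "transpose Q"])
  also have "\<dots> = (\<Sum>\<^sub>ub i. tr (transpose Q) (?M i) b * tr P (\<lambda>j. ?M j i) b)"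
    by (simp add: tr_contr[OF PQ])
  also have "\<dots> = (\<Sum>\<^sub>ui b. tr (transpose Q) (?M i) b * tr P (\<lambda>j. ?M j i) b)"
    by (rule sum.swap)
  finally show ?thesis by (simp add: tr_contr'[OF PQ] I_inv_def)
qed

text \<open>The factor \<open>det P\<close> of the new volume is absorbed by \<open>eps\<close>,
  which then has all six indices transformed: three are the free indices of the dual, the other
  three cancel against the raised form.\<close>

lemma dual3_pull: "dual3 (pull2 P g) (pull3 P F) = pull3 P (dual3 g F)"
proof -
  let ?R = "\<lambda>i j k. raise3 g F $ i $ j $ k"
  have e: "det P * eps a b c d e f = tr3 P (\<lambda>i j k. tr3 P (eps i j k) d e f) a b c" for a b c d e f
    unfolding eps_tr[symmetric] tr3_def tr2_def ..
  have "dual3 (pull2 P g) (pull3 P F) $ a $ b $ c = pull3 P (dual3 g F) $ a $ b $ c" for a b c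
  proof -
    have "dual3 (pull2 P g) (pull3 P F) $ a $ b $ c
       = vol g / 6 * (\<Sum>\<^sub>ud e f. (det P * eps a b c d e f) * tr3 (transpose Q) ?R d e f)"
      by (simp add: dual3_def raise3_pull vol_pull sum_distrib_left mult_ac)
    also have "(\<Sum>\<^sub>ud e f. (det P * eps a b c d e f) * tr3 (transpose Q) ?R d e f)
       = tr3 P (\<lambda>i j k. \<Sum>\<^sub>ud e f. tr3 P (eps i j k) d e f * tr3 (transpose Q) ?R d e f) a b c"
      unfolding e by (simp add: tr3_sum tr3_mult_right)
    also have "vol g / 6 * \<dots> = pull3 P (dual3 g F) $ a $ b $ c"
      unfolding pull3_def dual3_def vec_lambda_beta tr3_cmult tr3_contr[OF PQ] ..
    finally show ?thesis .
  qed
  then show ?thesis by (simp add: vec_eq_iff)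
qed

text \<open>Here \<open>eps\<close> carries upper indices, so it transforms with
  \<open>transpose Q\<close>; the required determinant 1 / det P comes from dividing by the
  volume.\<close>

lemma p_vec_pull: "p_vec (pull2 P g) (pull1 P v) (pull2 P B) $ a = tr (transpose Q) (\<lambda>i. p_vec g v B $ i) a"
proof -
  let ?T = "transpose Q" and ?B = "\<lambda>i j. B $ i $ j" and ?v = "\<lambda>i. v $ i"
  have dQ: "det ?T = 1 / det P"
    using det_Q det_pos by (simp add: det_transpose field_simps)
  have e: "eps a b c d e f / det P = tr ?T (\<lambda>m. tr ?T (\<lambda>n. tr2 ?T (\<lambda>i j. tr2 ?T (eps m n i j) e f) c d) b) a"
    for a b c d e f
    using eps_tr[of ?T f e d c b a] unfolding dQ tr2_def by simp
  have "p_vec (pull2 P g) (pull1 P v) (pull2 P B) $ a = - 1 / (8 * vol g) *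
      (\<Sum>\<^sub>ub c d e f.
        (eps a b c d e f / det P) * tr2 P ?B e f * tr2 P ?B c d * tr P ?v b)"
    using det_pos by (simp add: p_vec_def vol_pull pull1_def pull2_def[of P B] sum_distrib_left
        field_simps)
  also have "(\<Sum>\<^sub>ub c d e f.
        (eps a b c d e f / det P) * tr2 P ?B e f * tr2 P ?B c d * tr P ?v b)
    = tr ?T (\<lambda>m. \<Sum>\<^sub>ub. tr ?T (\<lambda>n. \<Sum>\<^sub>uc d. tr2 ?T (\<lambda>i j. \<Sum>\<^sub>ue f.
         tr2 ?T (eps m n i j) e f * tr2 P ?B e f) c d * tr2 P ?B c d) b * tr P ?v b) a"
    unfolding e
    by (simp only: tr_sum tr2_sum tr_mult_right tr2_mult_right sum_distrib_right)
  also have "\<dots> = tr ?T (\<lambda>m. \<Sum>\<^sub>ub c d e f.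
        eps m b c d e f * ?B c d * ?B e f * v $ b) a"
  proof -
    have c2: "(\<Sum>\<^sub>ua b. tr2 ?T y a b * tr2 P x a b) = (\<Sum>\<^sub>ui j. y i j * x i j)" for x y
      using tr2_contr[OF PQ, of x y] by (simp add: mult.commute)
    show ?thesis
      unfolding c2 tr_contr'[OF PQ] by (simp add: sum_distrib_right sum_distrib_left mult_ac)
  qed
  finally have "p_vec (pull2 P g) (pull1 P v) (pull2 P B) $ a = - 1 / (8 * vol g) * \<dots>" .
  then show ?thesis unfolding p_vec_def[of g] vec_lambda_beta tr_cmult .
qed

lemma p_inv_pull: "p_inv (pull2 P g) (pull1 P v) (pull2 P B) = p_inv g v B"
proof -
  have "tr (transpose Q) x a * tr (transpose Q) x b = tr2 (transpose Q) (\<lambda>i j. x i * x j) a b" for x a b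
    by (simp add: tr2_def tr_cmult tr_mult_right mult.commute)
  then show ?thesis
    unfolding p_inv_def p_vec_pull
    by (simp add: pull2_def[of P g] mult.assoc tr2_contr[OF PQ])
qed

lemma transverse2_pull:
  assumes "B \<in> transverse2 g v" shows "pull2 P B \<in> transverse2 (pull2 P g) (pull1 P v)"
  using assms by (simp add: transverse2_def pull2_two_forms contract_pull tr_zero)

lemma three_forms_pull:
  assumes "L \<in> three_forms" shows "pull3 P L \<in> three_forms"
proof -
  note L = three_forms_skew[OF assms]
  have "tr3 P (\<lambda>i j k. L $ i $ j $ k) b a c = - tr3 P (\<lambda>i j k. L $ i $ j $ k) a b c" for a b c
    unfolding tr3_swap12[of P "\<lambda>i j k. L $ i $ j $ k" b a c] by (subst L(1)) (simp add: tr3_minus)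
  moreover have "tr3 P (\<lambda>i j k. L $ i $ j $ k) a c b = - tr3 P (\<lambda>i j k. L $ i $ j $ k) a b c" for a b c
    unfolding tr3_swap23[of P "\<lambda>i j k. L $ i $ j $ k" a c b] by (subst L(2)) (simp add: tr3_minus)
  ultimately show ?thesis
    unfolding three_forms_def pull3_def mem_Collect_eq vec_lambda_beta by blast
qed

lemma self_dual_pull:
  assumes "L \<in> self_dual g" shows "pull3 P L \<in> self_dual (pull2 P g)"
  using assms by (simp add: self_dual_def three_forms_pull dual3_pull)

lemma plus_part_pull: "plus_part (pull2 P g) (pull3 P X) = pull3 P (plus_part g X)"
  using linear_pull(3)[of P] by (simp add: plus_part_def dual3_pull linear_add linear_cmul)

lemma inverse_change: "frame_change Q P (pull2 P g)"
  using QP det_Q det_pos inv_pull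
  by (unfold_locales) (auto simp: zero_less_mult_iff, metis less_asym zero_less_mult_pos zero_less_one)

end

section \<open>Minkowski space\<close>

text \<open>These are lower components. Raising with the mostly plus metric gives the vector
  (1,0,...,0), so that \<open>slot0\<close> reads off the components whose last index is 0.\<close>

abbreviation v0 :: vec6 where "v0 \<equiv> - axis 0 1"

notation minkowski (\<open>\<eta>\<close>)

abbreviation "trans0 \<equiv> transverse2 \<eta> v0"
abbreviation "slot0 \<equiv> slot \<eta> v0"
abbreviation "p0 \<equiv> p_inv \<eta> v0"
abbreviation "sd0 \<equiv> self_dual \<eta>"
abbreviation "B0 \<equiv> B_of \<eta> v0"

abbreviation V_grad :: "(real \<Rightarrow> real) \<Rightarrow> tensor3 \<Rightarrow> tensor2 \<Rightarrow> bool" where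
  "V_grad V L G \<equiv> ((\<lambda>L. V (I_inv \<eta> L)) has_derivative (\<lambda>D. contr2 \<eta> G (slot0 D))) (at L within sd0)"

abbreviation p_grad :: "tensor2 \<Rightarrow> tensor2 \<Rightarrow> bool" where
  "p_grad B G \<equiv> (p0 has_derivative (\<lambda>D. contr2 \<eta> G D)) (at B within trans0)"

abbreviation sg :: "6 \<Rightarrow> real" where "sg i \<equiv> if i = 0 then - 1 else 1"

lemma minkowski_square: "minkowski ** \<eta> = mat 1"
  by (simp add: minkowski_def matrix_matrix_mult_def mat_def vec_eq_iff if_distrib[of "\<lambda>x. x * _"]
      cong: if_cong)

lemma invertible_minkowski: "invertible \<eta>"
  using minkowski_square invertible_def by blast

lemma matrix_inv_minkowski: "matrix_inv \<eta> = \<eta>"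
proof -
  have "matrix_inv \<eta> = (matrix_inv \<eta> ** \<eta>) ** \<eta>"
    by (simp add: minkowski_square flip: matrix_mul_assoc)
  then show ?thesis using matrix_inv_inverse[OF invertible_minkowski] by simp
qed

lemma det_minkowski: "det \<eta> = - 1"
proof -
  have "det \<eta> = (\<Prod>i\<in>UNIV. \<eta> $ i $ i)"
    by (rule det_diagonal) (simp add: minkowski_def)
  also have "\<dots> = - 1" unfolding UNIV_6 by (simp add: minkowski_def)
  finally show ?thesis .
qed

lemma vol_minkowski: "vol \<eta> = 1"
  by (simp add: vol_def det_minkowski)

lemma tr_minkowski: "tr (transpose \<eta>) f a = sg a * f a"
  by (simp add: tr_def transpose_def minkowski_def if_distrib[of "\<lambda>x. x * _"] cong: if_cong)

lemma raise_minkowski: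
  "raise1 \<eta> u $ a = sg a * u $ a"
  "raise2 \<eta> T $ a $ b = sg a * sg b * T $ a $ b"
  "raise3 \<eta> L $ a $ b $ c = sg a * sg b * sg c * L $ a $ b $ c"
  by (simp_all add: raise_tr matrix_inv_minkowski tr2_def tr3_def tr_minkowski)

lemma sq1_minkowski: "sq1 \<eta> u = (u$1)\<^sup>2 + (u$2)\<^sup>2 + (u$3)\<^sup>2 + (u$4)\<^sup>2 + (u$5)\<^sup>2 - (u$0)\<^sup>2"
  by (simp add: sq1_def raise_minkowski sum_6 power2_eq_square)

lemma raise_v0: "raise1 \<eta> v0 $ a = (if a = 0 then 1 else 0)"
  by (simp add: raise_minkowski axis_def)

lemma slot_v0: "slot0 T $ a $ b = T $ a $ b $ 0"
  by (simp add: slot_def raise_v0 if_distrib cong: if_cong)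

lemma two_forms_diag: "B \<in> two_forms \<Longrightarrow> B $ i $ i = 0"
  using two_forms_skew[of B i i] by simp

lemma three_forms_diag:
  assumes "F \<in> three_forms"
  shows "F $ i $ i $ k = 0" "F $ i $ k $ k = 0" "F $ i $ k $ i = 0"
proof -
  have *: "F $ i $ i $ k = 0" for i k using three_forms_skew(1)[OF assms, of i i k] by simp
  then show "F $ i $ i $ k = 0" .
  show "F $ i $ k $ k = 0" using three_forms_skew(2)[OF assms, of i k k] by simp
  show "F $ i $ k $ i = 0" using three_forms_skew(2)[OF assms, of i k i] *[of i k] by simp
qed

lemma three_forms_sort:
  assumes "F \<in> three_forms"
  shows "i < j \<Longrightarrow> F $ j $ i $ k = - F $ i $ j $ k" "j < k \<Longrightarrow> F $ i $ k $ j = - F $ i $ j $ k"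
  using three_forms_skew[OF assms] by blast+

lemma two_forms_sort:
  assumes "B \<in> two_forms"
  shows "i < j \<Longrightarrow> B $ j $ i = - B $ i $ j"
  using two_forms_skew[OF assms] by blast

lemma two_form_eqI:
  assumes "F \<in> two_forms" "G \<in> two_forms"
    and "F$0$1 = G$0$1" "F$0$2 = G$0$2" "F$0$3 = G$0$3" "F$0$4 = G$0$4" "F$0$5 = G$0$5"
    "F$1$2 = G$1$2" "F$1$3 = G$1$3" "F$1$4 = G$1$4" "F$1$5 = G$1$5" "F$2$3 = G$2$3"
    "F$2$4 = G$2$4" "F$2$5 = G$2$5" "F$3$4 = G$3$4" "F$3$5 = G$3$5" "F$4$5 = G$4$5"
  shows "F = G"
  using assms(3-) by (simp add: vec_eq_iff[where 'a=real] vec_eq_iff[where 'a=vec6] all_6 less_6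
      two_forms_sort[OF assms(1)] two_forms_diag[OF assms(1)]
      two_forms_sort[OF assms(2)] two_forms_diag[OF assms(2)])

lemma three_form_eqI:
  assumes "F \<in> three_forms" "G \<in> three_forms"
    and "F$0$1$2 = G$0$1$2" "F$0$1$3 = G$0$1$3" "F$0$1$4 = G$0$1$4" "F$0$1$5 = G$0$1$5"
    "F$0$2$3 = G$0$2$3" "F$0$2$4 = G$0$2$4" "F$0$2$5 = G$0$2$5"
    "F$0$3$4 = G$0$3$4" "F$0$3$5 = G$0$3$5" "F$0$4$5 = G$0$4$5"
    "F$1$2$3 = G$1$2$3" "F$1$2$4 = G$1$2$4" "F$1$2$5 = G$1$2$5"
    "F$1$3$4 = G$1$3$4" "F$1$3$5 = G$1$3$5" "F$1$4$5 = G$1$4$5"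
    "F$2$3$4 = G$2$3$4" "F$2$3$5 = G$2$3$5" "F$2$4$5 = G$2$4$5" "F$3$4$5 = G$3$4$5"
  shows "F = G"
  using assms(3-) by (simp add: vec_eq_iff[where 'a=real] vec_eq_iff[where 'a=vec6] vec_eq_iff[where 'a=tensor2]
      all_6 less_6 three_forms_sort[OF assms(1)] three_forms_diag[OF assms(1)]
      three_forms_sort[OF assms(2)] three_forms_diag[OF assms(2)])

lemma dual3_three_forms: "dual3 g F \<in> three_forms"
proof -
  have "dual3 g F $ b $ a $ c = - dual3 g F $ a $ b $ c" for a b c
    unfolding dual3_def vec_lambda_beta by (subst eps_swap(1)) (simp add: sum_negf)
  moreover have "dual3 g F $ a $ c $ b = - dual3 g F $ a $ b $ c" for a b c
    unfolding dual3_def vec_lambda_beta by (subst eps_swap(2)) (simp add: sum_negf)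
  ultimately show ?thesis unfolding three_forms_def mem_Collect_eq by blast
qed

text \<open>The first ten entries are the components with a time index, the last ten the spatial
  ones; for a self-dual form each half determines the other.\<close>

lemma dual3_minkowski:
  assumes "F \<in> three_forms"
  shows "dual3 \<eta> F $0$1$2 = F$3$4$5" "dual3 \<eta> F $0$1$3 = - F$2$4$5"
    "dual3 \<eta> F $0$1$4 = F$2$3$5" "dual3 \<eta> F $0$1$5 = - F$2$3$4"
    "dual3 \<eta> F $0$2$3 = F$1$4$5" "dual3 \<eta> F $0$2$4 = - F$1$3$5"
    "dual3 \<eta> F $0$2$5 = F$1$3$4" "dual3 \<eta> F $0$3$4 = F$1$2$5"
    "dual3 \<eta> F $0$3$5 = - F$1$2$4" "dual3 \<eta> F $0$4$5 = F$1$2$3"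
    "dual3 \<eta> F $1$2$3 = F$0$4$5" "dual3 \<eta> F $1$2$4 = - F$0$3$5"
    "dual3 \<eta> F $1$2$5 = F$0$3$4" "dual3 \<eta> F $1$3$4 = F$0$2$5"
    "dual3 \<eta> F $1$3$5 = - F$0$2$4" "dual3 \<eta> F $1$4$5 = F$0$2$3"
    "dual3 \<eta> F $2$3$4 = - F$0$1$5" "dual3 \<eta> F $2$3$5 = F$0$1$4"
    "dual3 \<eta> F $2$4$5 = - F$0$1$3" "dual3 \<eta> F $3$4$5 = F$0$1$2"
  by (simp_all add: dual3_def vol_minkowski raise_minkowski sum_6 eps_eval
      three_forms_sort[OF assms] three_forms_diag[OF assms])

lemma dual3_dual3_minkowski:
  assumes "F \<in> three_forms" shows "dual3 \<eta> (dual3 \<eta> F) = F"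
  by (rule three_form_eqI[OF dual3_three_forms assms])
    (simp_all add: dual3_minkowski[OF dual3_three_forms] dual3_minkowski[OF assms])

section \<open>The linear spaces of variations, and the invariants in components\<close>

lemma subspace_three_forms: "subspace three_forms"
proof (intro subspaceI)
  fix x y :: tensor3 assume xy: "x \<in> three_forms" "y \<in> three_forms"
  have "(x + y) $ j $ i $ k = - (x + y) $ i $ j $ k" "(x + y) $ i $ k $ j = - (x + y) $ i $ j $ k" for i j k
    unfolding vector_add_component xy[THEN three_forms_skew(1), of j i k] xy[THEN three_forms_skew(2), of i k j]
    by simp_all
  then show "x + y \<in> three_forms" unfolding three_forms_def by blast
next
  fix c :: real and x :: tensor3 assume x: "x \<in> three_forms"
  have "(c *\<^sub>R x) $ j $ i $ k = - (c *\<^sub>R x) $ i $ j $ k" "(c *\<^sub>R x) $ i $ k $ j = - (c *\<^sub>R x) $ i $ j $ k" for i j k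
    unfolding vector_scaleR_component x[THEN three_forms_skew(1), of j i k] x[THEN three_forms_skew(2), of i k j]
    by simp_all
  then show "c *\<^sub>R x \<in> three_forms" unfolding three_forms_def by blast
qed (simp add: three_forms_def)

lemma subspace_two_forms: "subspace two_forms"
proof (intro subspaceI)
  fix x y :: tensor2 assume xy: "x \<in> two_forms" "y \<in> two_forms"
  have "(x + y) $ j $ i = - (x + y) $ i $ j" for i j
    unfolding vector_add_component xy[THEN two_forms_skew, of j i] by simp
  then show "x + y \<in> two_forms" unfolding two_forms_def by blast
next
  fix c :: real and x :: tensor2 assume x: "x \<in> two_forms"
  have "(c *\<^sub>R x) $ j $ i = - (c *\<^sub>R x) $ i $ j" for i j
    unfolding vector_scaleR_component x[THEN two_forms_skew, of j i] by simp
  then show "c *\<^sub>R x \<in> two_forms" unfolding two_forms_def by blast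
qed (simp add: two_forms_def)

lemma linear_raise3: "linear (raise3 g)"
  by (rule linearI) (simp_all add: raise_tr vec_eq_iff tr3_add tr3_cmult)

lemma linear_dual3: "linear (dual3 g)"
  by (rule linearI) (simp_all add: dual3_def vec_eq_iff linear_add[OF linear_raise3]
      linear_cmul[OF linear_raise3] distrib_left sum.distrib sum_distrib_left mult.left_commute)

lemma linear_plus_part: "linear (plus_part g)"
  using linear_dual3[of g]
  by (intro linearI) (simp_all add: plus_part_def linear_add linear_cmul algebra_simps)

lemma linear_slot: "linear (slot g v)"
  by (rule linearI) (simp_all add: slot_def vec_eq_iff distrib_right sum.distrib sum_distrib_left mult.assoc)

lemma subspace_self_dual: "subspace (self_dual g)"
  using subspace_three_forms linear_dual3[of g]
  unfolding self_dual_def subspace_def by (auto simp: linear_add linear_cmul linear_0)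

lemma subspace_transverse2: "subspace (transverse2 g v)"
  using subspace_two_forms unfolding transverse2_def subspace_def
  by (auto simp: distrib_right sum.distrib mult.assoc simp flip: sum_distrib_left)

lemma slot_transverse2:
  assumes "L \<in> three_forms" shows "slot g v L \<in> transverse2 g v"
proof -
  let ?u = "raise1 g v"
  have "slot g v L $ b $ a = - slot g v L $ a $ b" for a b
    unfolding slot_def vec_lambda_beta
    by (subst three_forms_skew(1)[OF assms]) (simp add: sum_negf)
  moreover have "(\<Sum>\<^sub>ub. slot g v L $ a $ b * ?u $ b) = 0" for a
  proof -
    have "(\<Sum>\<^sub>ub. slot g v L $ a $ b * ?u $ b) = (\<Sum>\<^sub>ub c. L $ a $ b $ c * ?u $ c * ?u $ b)"
      by (simp add: slot_def sum_distrib_right)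
    also have "\<dots> = (\<Sum>\<^sub>uc b. L $ a $ b $ c * ?u $ c * ?u $ b)" by (rule sum.swap)
    also have "\<dots> = - (\<Sum>\<^sub>uc b. L $ a $ c $ b * ?u $ b * ?u $ c)"
      by (subst three_forms_skew(2)[OF assms]) (simp add: sum_negf mult_ac)
    finally show ?thesis by (simp add: slot_def sum_distrib_right)
  qed
  ultimately show ?thesis unfolding transverse2_def two_forms_def by blast
qed

lemma transverse2_v0: "trans0 = {B \<in> two_forms. \<forall>i. B $ i $ 0 = 0}"
  by (simp add: transverse2_def raise_v0 if_distrib cong: if_cong)

lemma transverse2_zero:
  assumes "B \<in> trans0" shows "B $ i $ 0 = 0" "B $ 0 $ i = 0"
proof -
  show *: "B $ i $ 0 = 0" for i using assms by (simp add: transverse2_v0)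
  have "B \<in> two_forms" using assms by (simp add: transverse2_v0)
  then show "B $ 0 $ i = 0" using two_forms_skew[of B 0 i] *[of i] by simp
qed

lemma transverse2_two_forms: "B \<in> transverse2 g v \<Longrightarrow> B \<in> two_forms"
  by (simp add: transverse2_def)

lemma transverse_eqI:
  assumes "F \<in> trans0" "G \<in> trans0"
    "F$1$2 = G$1$2" "F$1$3 = G$1$3" "F$1$4 = G$1$4" "F$1$5 = G$1$5" "F$2$3 = G$2$3"
    "F$2$4 = G$2$4" "F$2$5 = G$2$5" "F$3$4 = G$3$4" "F$3$5 = G$3$5" "F$4$5 = G$4$5"
  shows "F = G"
  by (rule two_form_eqI) (use assms in \<open>auto simp: transverse2_zero transverse2_two_forms\<close>)

lemma contr2_transverse:
  assumes "F \<in> trans0" "G \<in> trans0"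
  shows "contr2 \<eta> F G = 2 * (F$1$2 * G$1$2 + F$1$3 * G$1$3 + F$1$4 * G$1$4 + F$1$5 * G$1$5
    + F$2$3 * G$2$3 + F$2$4 * G$2$4 + F$2$5 * G$2$5 + F$3$4 * G$3$4 + F$3$5 * G$3$5 + F$4$5 * G$4$5)"
  using assms[THEN transverse2_two_forms]
  by (simp add: contr2_def raise_minkowski sum_6 less_6 two_forms_sort two_forms_diag
      transverse2_zero[OF assms(1)] transverse2_zero[OF assms(2)])

lemma s_inv_minkowski:
  assumes "B \<in> trans0"
  shows "s_inv \<eta> B = ((B$1$2)\<^sup>2 + (B$1$3)\<^sup>2 + (B$1$4)\<^sup>2 + (B$1$5)\<^sup>2 + (B$2$3)\<^sup>2
    + (B$2$4)\<^sup>2 + (B$2$5)\<^sup>2 + (B$3$4)\<^sup>2 + (B$3$5)\<^sup>2 + (B$4$5)\<^sup>2) / 2"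
  by (simp add: s_inv_def contr2_transverse[OF assms assms] power2_eq_square)

text \<open>The Pfaffian of the 4 x 4 block of B with indices i, j, k, l, up to a factor a component
  of B \<and> B.\<close>

definition pf :: "tensor2 \<Rightarrow> 6 \<Rightarrow> 6 \<Rightarrow> 6 \<Rightarrow> 6 \<Rightarrow> real" where
  "pf B i j k l = B$i$j * B$k$l - B$i$k * B$j$l + B$i$l * B$j$k"

text \<open>Reduces a double sum to the ten ordered spatial pairs. Used for the inner and then for
  the outer pair of indices, it spares the expansion of the fivefold sum in
  \<open>p_vec\<close>.\<close>

lemma sum_skew:
  assumes "B \<in> trans0" and f: "\<And>i j. f j i = - f i j"
  shows "(\<Sum>\<^sub>ui j. f i j * B $ i $ j) = 2 * (f 1 2 * B$1$2 + f 1 3 * B$1$3 + f 1 4 * B$1$4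
    + f 1 5 * B$1$5 + f 2 3 * B$2$3 + f 2 4 * B$2$4 + f 2 5 * B$2$5 + f 3 4 * B$3$4 + f 3 5 * B$3$5 + f 4 5 * B$4$5)"
proof -
  have "i < j \<Longrightarrow> f j i = - f i j" for i j using f .
  moreover have "B \<in> two_forms" using assms by (simp add: transverse2_def)
  ultimately show ?thesis
    by (simp add: sum_6 less_6 two_forms_sort two_forms_diag transverse2_zero[OF assms(1)])
qed

lemma p_vec_minkowski:
  assumes "B \<in> trans0"
  shows "p_vec \<eta> v0 B $ 0 = 0"
    "p_vec \<eta> v0 B $ 1 = - pf B 2 3 4 5" "p_vec \<eta> v0 B $ 2 = pf B 1 3 4 5"
    "p_vec \<eta> v0 B $ 3 = - pf B 1 2 4 5" "p_vec \<eta> v0 B $ 4 = pf B 1 2 3 5"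
    "p_vec \<eta> v0 B $ 5 = - pf B 1 2 3 4"
proof -
  define h where "h m \<rho> \<tau> = (\<Sum>\<^sub>u\<sigma> \<kappa>. eps m 0 \<rho> \<tau> \<sigma> \<kappa> * B $ \<sigma> $ \<kappa>)" for m \<rho> \<tau>
  have v: "v0 $ n = (if n = 0 then - 1 else 0)" for n by (simp add: axis_def)
  have "p_vec \<eta> v0 B $ m = - 1 / 8 * (\<Sum>\<^sub>un. (\<Sum>\<^sub>u\<rho> \<tau> \<sigma> \<kappa>.
      eps m n \<rho> \<tau> \<sigma> \<kappa> * B $ \<rho> $ \<tau> * B $ \<sigma> $ \<kappa>) * v0 $ n)" for m
    by (simp only: p_vec_def vec_lambda_beta vol_minkowski sum_distrib_right mult_1_right)
  then have p: "p_vec \<eta> v0 B $ m = (\<Sum>\<^sub>u\<rho> \<tau>. h m \<rho> \<tau> * B $ \<rho> $ \<tau>) / 8" for m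
    unfolding v by (simp add: h_def if_distrib sum_distrib_left sum_distrib_right mult_ac cong: if_cong)
  have h: "h m \<rho> \<tau> = 2 * (eps m 0 \<rho> \<tau> 1 2 * B$1$2 + eps m 0 \<rho> \<tau> 1 3 * B$1$3 + eps m 0 \<rho> \<tau> 1 4 * B$1$4
    + eps m 0 \<rho> \<tau> 1 5 * B$1$5 + eps m 0 \<rho> \<tau> 2 3 * B$2$3 + eps m 0 \<rho> \<tau> 2 4 * B$2$4 + eps m 0 \<rho> \<tau> 2 5 * B$2$5
    + eps m 0 \<rho> \<tau> 3 4 * B$3$4 + eps m 0 \<rho> \<tau> 3 5 * B$3$5 + eps m 0 \<rho> \<tau> 4 5 * B$4$5)" for m \<rho> \<tau>
    unfolding h_def by (rule sum_skew[OF assms eps_swap(5)])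
  have skew: "h m \<tau> \<rho> = - h m \<rho> \<tau>" for m \<rho> \<tau>
    unfolding h_def by (subst eps_swap(3)) (simp add: sum_negf)
  show "p_vec \<eta> v0 B $ 0 = 0" unfolding p sum_skew[OF assms skew] by (simp add: h eps_eval pf_def)
  show "p_vec \<eta> v0 B $ 1 = - pf B 2 3 4 5" unfolding p sum_skew[OF assms skew] by (simp add: h eps_eval pf_def)
  show "p_vec \<eta> v0 B $ 2 = pf B 1 3 4 5" unfolding p sum_skew[OF assms skew] by (simp add: h eps_eval pf_def)
  show "p_vec \<eta> v0 B $ 3 = - pf B 1 2 4 5" unfolding p sum_skew[OF assms skew] by (simp add: h eps_eval pf_def)
  show "p_vec \<eta> v0 B $ 4 = pf B 1 2 3 5" unfolding p sum_skew[OF assms skew] by (simp add: h eps_eval pf_def)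
  show "p_vec \<eta> v0 B $ 5 = - pf B 1 2 3 4" unfolding p sum_skew[OF assms skew] by (simp add: h eps_eval pf_def)
qed

lemma p_inv_minkowski:
  assumes "B \<in> trans0"
  shows "p0 B = sqrt ((pf B 2 3 4 5)\<^sup>2 + (pf B 1 3 4 5)\<^sup>2 + (pf B 1 2 4 5)\<^sup>2
    + (pf B 1 2 3 5)\<^sup>2 + (pf B 1 2 3 4)\<^sup>2)"
proof -
  have "minkowski $ i $ j = (if i = j then sg i else 0)" for i j by (simp add: minkowski_def)
  then show ?thesis
    by (simp add: p_inv_def sum_6 p_vec_minkowski[OF assms] power2_eq_square)
qed

text \<open>Self-duality makes M quadratic in the two-form B: the time-time entry is -4 s, the mixed
  entries are -4 p_i and 4 p_i, and the spatial block is 4 (s - B B^T). The trace of the square is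
  therefore 16 s^2 - 32 p^2 + (80 s^2 - 64 p^2).\<close>

lemma I_inv_minkowski:
  assumes "L \<in> sd0"
  defines "B \<equiv> slot0 L"
  shows "I_inv \<eta> L = 96 * ((s_inv \<eta> B)\<^sup>2 - (p0 B)\<^sup>2)"
proof -
  have L: "L \<in> three_forms" and dual: "dual3 \<eta> L = L"
    using assms by (simp_all add: self_dual_def)
  have B: "B \<in> trans0" unfolding B_def by (rule slot_transverse2[OF L])
  have Lb: "L $ i $ j $ k = B $ i $ j" if "k = 0" for i j k
    by (simp add: B_def slot_v0 that)
  have t: "L$0$1$2 = B$1$2" "L$0$1$3 = B$1$3" "L$0$1$4 = B$1$4" "L$0$1$5 = B$1$5" "L$0$2$3 = B$2$3"
    "L$0$2$4 = B$2$4" "L$0$2$5 = B$2$5" "L$0$3$4 = B$3$4" "L$0$3$5 = B$3$5" "L$0$4$5 = B$4$5"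
    by (simp_all add: B_def slot_v0 less_6 three_forms_sort[OF L])
  note sp = dual3_minkowski(11-20)[OF L, unfolded dual t]
  note comp = sp t three_forms_sort[OF L] three_forms_diag[OF L] less_6
  define S where "S = s_inv \<eta> B"
  have M: "M_mat \<eta> L $ i $ j = (\<Sum>\<^sub>u\<rho> \<tau>. L $ i $ \<rho> $ \<tau> * (sg j * sg \<rho> * sg \<tau> * L $ j $ \<rho> $ \<tau>))" for i j
    by (simp add: M_mat_def raise_minkowski)
  have Bs: "B \<in> two_forms" using B by (rule transverse2_two_forms)
  note bc = two_forms_sort[OF Bs] two_forms_diag[OF Bs] transverse2_zero[OF B] less_6
  note S = S_def s_inv_minkowski[OF B]
  have M00: "M_mat \<eta> L $ 0 $ 0 = - 4 * S"
    unfolding M S sum_6 by (simp add: comp power2_eq_square)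
  let ?p = "\<lambda>i. p_vec \<eta> v0 B $ i"
  have M0i: "M_mat \<eta> L $ 0 $ 1 = - 4 * ?p 1" "M_mat \<eta> L $ 0 $ 2 = - 4 * ?p 2"
    "M_mat \<eta> L $ 0 $ 3 = - 4 * ?p 3" "M_mat \<eta> L $ 0 $ 4 = - 4 * ?p 4"
    "M_mat \<eta> L $ 0 $ 5 = - 4 * ?p 5"
    unfolding M sum_6 p_vec_minkowski[OF B] pf_def by (simp_all add: comp)
  have Mi0: "M_mat \<eta> L $ 1 $ 0 = 4 * ?p 1" "M_mat \<eta> L $ 2 $ 0 = 4 * ?p 2"
    "M_mat \<eta> L $ 3 $ 0 = 4 * ?p 3" "M_mat \<eta> L $ 4 $ 0 = 4 * ?p 4"
    "M_mat \<eta> L $ 5 $ 0 = 4 * ?p 5"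
    unfolding M sum_6 p_vec_minkowski[OF B] pf_def by (simp_all add: comp)
  have Mii: "M_mat \<eta> L $ 1 $ 1 = 4 * (S - ((B$1$2)\<^sup>2 + (B$1$3)\<^sup>2 + (B$1$4)\<^sup>2 + (B$1$5)\<^sup>2))"
    "M_mat \<eta> L $ 2 $ 2 = 4 * (S - ((B$1$2)\<^sup>2 + (B$2$3)\<^sup>2 + (B$2$4)\<^sup>2 + (B$2$5)\<^sup>2))"
    "M_mat \<eta> L $ 3 $ 3 = 4 * (S - ((B$1$3)\<^sup>2 + (B$2$3)\<^sup>2 + (B$3$4)\<^sup>2 + (B$3$5)\<^sup>2))"
    "M_mat \<eta> L $ 4 $ 4 = 4 * (S - ((B$1$4)\<^sup>2 + (B$2$4)\<^sup>2 + (B$3$4)\<^sup>2 + (B$4$5)\<^sup>2))"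
    "M_mat \<eta> L $ 5 $ 5 = 4 * (S - ((B$1$5)\<^sup>2 + (B$2$5)\<^sup>2 + (B$3$5)\<^sup>2 + (B$4$5)\<^sup>2))"
    unfolding M S sum_6 by (simp_all add: comp power2_eq_square field_simps)
  have Mij: "M_mat \<eta> L $ 1 $ 2 = - 4 * (B$1$3 * B$2$3 + B$1$4 * B$2$4 + B$1$5 * B$2$5)"
    "M_mat \<eta> L $ 1 $ 3 = - 4 * (- B$1$2 * B$2$3 + B$1$4 * B$3$4 + B$1$5 * B$3$5)"
    "M_mat \<eta> L $ 1 $ 4 = - 4 * (- B$1$2 * B$2$4 - B$1$3 * B$3$4 + B$1$5 * B$4$5)"
    "M_mat \<eta> L $ 1 $ 5 = - 4 * (- B$1$2 * B$2$5 - B$1$3 * B$3$5 - B$1$4 * B$4$5)"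
    "M_mat \<eta> L $ 2 $ 1 = - 4 * (B$2$3 * B$1$3 + B$2$4 * B$1$4 + B$2$5 * B$1$5)"
    "M_mat \<eta> L $ 2 $ 3 = - 4 * (B$1$2 * B$1$3 + B$2$4 * B$3$4 + B$2$5 * B$3$5)"
    "M_mat \<eta> L $ 2 $ 4 = - 4 * (B$1$2 * B$1$4 - B$2$3 * B$3$4 + B$2$5 * B$4$5)"
    "M_mat \<eta> L $ 2 $ 5 = - 4 * (B$1$2 * B$1$5 - B$2$3 * B$3$5 - B$2$4 * B$4$5)"
    "M_mat \<eta> L $ 3 $ 1 = - 4 * (- B$2$3 * B$1$2 + B$3$4 * B$1$4 + B$3$5 * B$1$5)"
    "M_mat \<eta> L $ 3 $ 2 = - 4 * (B$1$3 * B$1$2 + B$3$4 * B$2$4 + B$3$5 * B$2$5)"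
    "M_mat \<eta> L $ 3 $ 4 = - 4 * (B$1$3 * B$1$4 + B$2$3 * B$2$4 + B$3$5 * B$4$5)"
    "M_mat \<eta> L $ 3 $ 5 = - 4 * (B$1$3 * B$1$5 + B$2$3 * B$2$5 - B$3$4 * B$4$5)"
    "M_mat \<eta> L $ 4 $ 1 = - 4 * (- B$2$4 * B$1$2 - B$3$4 * B$1$3 + B$4$5 * B$1$5)"
    "M_mat \<eta> L $ 4 $ 2 = - 4 * (B$1$4 * B$1$2 - B$3$4 * B$2$3 + B$4$5 * B$2$5)"
    "M_mat \<eta> L $ 4 $ 3 = - 4 * (B$1$4 * B$1$3 + B$2$4 * B$2$3 + B$4$5 * B$3$5)"
    "M_mat \<eta> L $ 4 $ 5 = - 4 * (B$1$4 * B$1$5 + B$2$4 * B$2$5 + B$3$4 * B$3$5)"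
    "M_mat \<eta> L $ 5 $ 1 = - 4 * (- B$2$5 * B$1$2 - B$3$5 * B$1$3 - B$4$5 * B$1$4)"
    "M_mat \<eta> L $ 5 $ 2 = - 4 * (B$1$5 * B$1$2 - B$3$5 * B$2$3 - B$4$5 * B$2$4)"
    "M_mat \<eta> L $ 5 $ 3 = - 4 * (B$1$5 * B$1$3 + B$2$5 * B$2$3 - B$4$5 * B$3$4)"
    "M_mat \<eta> L $ 5 $ 4 = - 4 * (B$1$5 * B$1$4 + B$2$5 * B$2$4 + B$3$5 * B$3$4)"
    unfolding M sum_6 by (simp_all add: comp algebra_simps)
  have p: "(p0 B)\<^sup>2 = (?p 1)\<^sup>2 + (?p 2)\<^sup>2 + (?p 3)\<^sup>2 + (?p 4)\<^sup>2 + (?p 5)\<^sup>2"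
    unfolding p_inv_minkowski[OF B] p_vec_minkowski[OF B] by simp
  have S2: "2 * S = (B$1$2)\<^sup>2 + (B$1$3)\<^sup>2 + (B$1$4)\<^sup>2 + (B$1$5)\<^sup>2 + (B$2$3)\<^sup>2
    + (B$2$4)\<^sup>2 + (B$2$5)\<^sup>2 + (B$3$4)\<^sup>2 + (B$3$5)\<^sup>2 + (B$4$5)\<^sup>2"
    unfolding S by simp
  show ?thesis
    unfolding S_def[symmetric] p
    unfolding I_inv_def sum_6 M00 M0i Mi0 Mii Mij p_vec_minkowski[OF B] pf_def
    using S2 by algebra
qed

section \<open>Self-dual forms as lifts of transverse two-forms\<close>

definition wedge :: "vec6 \<Rightarrow> tensor2 \<Rightarrow> tensor3" where
  "wedge n \<omega> = (\<chi> \<mu> \<nu> \<rho>. n $ \<mu> * \<omega> $ \<nu> $ \<rho> + n $ \<nu> * \<omega> $ \<rho> $ \<mu> + n $ \<rho> * \<omega> $ \<mu> $ \<nu>)"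

lemma wedge_three_forms:
  assumes "\<omega> \<in> two_forms" shows "wedge n \<omega> \<in> three_forms"
proof -
  have "wedge n \<omega> $ j $ i $ k = - wedge n \<omega> $ i $ j $ k" "wedge n \<omega> $ i $ k $ j = - wedge n \<omega> $ i $ j $ k" for i j k
    unfolding wedge_def vec_lambda_beta two_forms_skew[OF assms, of k i] two_forms_skew[OF assms, of k j]
      two_forms_skew[OF assms, of j i] by simp_all
  then show ?thesis unfolding three_forms_def by blast
qed

lemma linear_wedge: "linear (wedge n)"
  by (rule linearI) (simp_all add: wedge_def vec_eq_iff algebra_simps)

lemma wedge_v0:
  assumes "B \<in> trans0"
  shows "wedge v0 B $ i $ j $ k = - (if i = 0 then B$j$k else if j = 0 then B$k$i else if k = 0 then B$i$j else 0)"
  by (simp add: wedge_def axis_def transverse2_zero[OF assms])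

text \<open>The form v0 \<and> B is purely electric: the contraction of v0 with itself gives the
  sign, and the dual has spatial components only.\<close>

lemma slot_wedge_v0:
  assumes "B \<in> trans0"
  shows "slot0 (wedge v0 B) = - B" "slot0 (dual3 \<eta> (wedge v0 B)) = 0"
proof -
  show "slot0 (wedge v0 B) = - B"
    by (simp add: vec_eq_iff slot_v0 wedge_v0[OF assms] transverse2_zero[OF assms])
  have w: "wedge v0 B \<in> three_forms" using assms by (simp add: wedge_three_forms transverse2_def)
  have "0 \<in> trans0" by (simp add: subspace_0 subspace_transverse2)
  then show "slot0 (dual3 \<eta> (wedge v0 B)) = 0"
    by (intro transverse_eqI slot_transverse2[OF dual3_three_forms])
      (simp_all add: slot_v0 less_6 three_forms_sort[OF dual3_three_forms]
         dual3_minkowski[OF w] wedge_v0[OF assms])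
qed

text \<open>The inverse of \<open>slot0\<close> on self-dual forms. The factor -2 undoes the 1/2 of
  \<open>plus_part\<close> and the sign in \<open>slot_wedge_v0\<close>.\<close>

definition lift :: "tensor2 \<Rightarrow> tensor3" where
  "lift B = - 2 *\<^sub>R plus_part \<eta> (wedge v0 B)"

lemma linear_lift: "linear lift"
  using linear_compose[OF linear_wedge[of v0] linear_plus_part[of \<eta>]]
  unfolding lift_def by (intro linear_compose_scale_right) (simp add: o_def)

lemma plus_part_minkowski:
  assumes "F \<in> three_forms" shows "plus_part \<eta> F \<in> sd0"
proof -
  have "plus_part \<eta> F \<in> three_forms"
    unfolding plus_part_def using assms dual3_three_forms[of \<eta> F]
    by (intro subspace_scale subspace_add subspace_three_forms)
  moreover have "dual3 \<eta> (plus_part \<eta> F) = plus_part \<eta> F"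
    using linear_dual3[of \<eta>]
    by (simp add: plus_part_def linear_add linear_cmul dual3_dual3_minkowski[OF assms] add.commute)
  ultimately show ?thesis by (simp add: self_dual_def)
qed

lemma lift_self_dual:
  assumes "B \<in> trans0" shows "lift B \<in> sd0"
  unfolding lift_def using assms
  by (intro subspace_scale subspace_self_dual plus_part_minkowski wedge_three_forms transverse2_two_forms)

lemma slot_lift:
  assumes "B \<in> trans0" shows "slot0 (lift B) = B"
  using linear_slot[of \<eta> v0] slot_wedge_v0[OF assms]
  by (simp add: lift_def plus_part_def linear_cmul linear_add linear_neg linear_diff)

lemma self_dual_eqI:
  assumes "L \<in> sd0" "L' \<in> sd0"
    and "slot0 L = slot0 L'"
  shows "L = L'"
proof -
  have L: "L \<in> three_forms" "dual3 \<eta> L = L" and L': "L' \<in> three_forms" "dual3 \<eta> L' = L'"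
    using assms by (auto simp: self_dual_def)
  have "L $ i $ j $ 0 = L' $ i $ j $ 0" for i j
    using assms(3) by (simp add: vec_eq_iff slot_v0)
  then have "L $ 0 $ i $ j = L' $ 0 $ i $ j" for i j
    by (metis three_forms_skew L(1) L'(1))
  moreover note dual3_minkowski(11-20)[OF L(1), unfolded L(2)] dual3_minkowski(11-20)[OF L'(1), unfolded L'(2)]
  ultimately show ?thesis by (intro three_form_eqI[OF L(1) L'(1)]) simp_all
qed

lemma lift_slot: "L \<in> sd0 \<Longrightarrow> lift (slot0 L) = L"
  by (intro self_dual_eqI lift_self_dual slot_lift slot_transverse2) (simp_all add: self_dual_def)

lemma contr3_minkowski:
  assumes "F \<in> three_forms" "G \<in> three_forms"
  shows "contr3 \<eta> F G = 6 * (F$1$2$3 * G$1$2$3 + F$1$2$4 * G$1$2$4 + F$1$2$5 * G$1$2$5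
    + F$1$3$4 * G$1$3$4 + F$1$3$5 * G$1$3$5 + F$1$4$5 * G$1$4$5
    + F$2$3$4 * G$2$3$4 + F$2$3$5 * G$2$3$5 + F$2$4$5 * G$2$4$5 + F$3$4$5 * G$3$4$5
    - F$0$1$2 * G$0$1$2 - F$0$1$3 * G$0$1$3 - F$0$1$4 * G$0$1$4 - F$0$1$5 * G$0$1$5
    - F$0$2$3 * G$0$2$3 - F$0$2$4 * G$0$2$4 - F$0$2$5 * G$0$2$5
    - F$0$3$4 * G$0$3$4 - F$0$3$5 * G$0$3$5 - F$0$4$5 * G$0$4$5)"
  by (simp add: contr3_def raise_minkowski sum_6 less_6
      three_forms_sort[OF assms(1)] three_forms_diag[OF assms(1)]
      three_forms_sort[OF assms(2)] three_forms_diag[OF assms(2)])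

lemma contr3_wedge_v0:
  assumes "F \<in> three_forms" "B \<in> trans0"
  shows "contr3 \<eta> F (wedge v0 B) = 3 * contr2 \<eta> (slot0 F) B"
proof -
  have "wedge v0 B \<in> three_forms" using assms by (simp add: wedge_three_forms transverse2_def)
  then show ?thesis
    by (simp add: contr3_minkowski[OF assms(1)] contr2_transverse[OF slot_transverse2[OF assms(1)] assms(2)]
        slot_v0 wedge_v0[OF assms(2)] less_6 three_forms_sort[OF assms(1)])
qed

text \<open>Without time components the Lorentzian contraction is the Euclidean inner product, hence
  definite. This gives access to Riesz representation and lets a transverse two-form be shown to
  vanish by contracting it with itself.\<close>

lemma transverse_inner:
  assumes "F \<in> trans0" "G \<in> trans0"
  shows "contr2 \<eta> F G = F \<bullet> G"
  using assms[THEN transverse2_two_forms]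
  by (simp add: contr2_transverse[OF assms] inner_vec_def sum_6 less_6 two_forms_sort two_forms_diag
      transverse2_zero[OF assms(1)] transverse2_zero[OF assms(2)])

section \<open>Normal form of a transverse two-form\<close>

definition canonical :: "tensor2 \<Rightarrow> bool" where
  "canonical B \<longleftrightarrow> B \<in> trans0 \<and>
     B$1$3 = 0 \<and> B$1$4 = 0 \<and> B$1$5 = 0 \<and> B$2$3 = 0 \<and> B$2$4 = 0 \<and> B$2$5 = 0 \<and>
     B$3$5 = 0 \<and> B$4$5 = 0 \<and> 0 \<le> B$3$4 \<and> B$3$4 \<le> B$1$2"

definition givens :: "6 \<Rightarrow> 6 \<Rightarrow> real \<Rightarrow> real \<Rightarrow> real^6^6" where
  "givens i j c s = (\<chi> a b. if b = i then (if a = i then c else if a = j then s else 0)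
     else if b = j then (if a = i then - s else if a = j then c else 0)
     else if a = b then 1 else 0)"

lemma tr_givens:
  assumes "i \<noteq> j"
  shows "tr (givens i j c s) f a = (if a = i then c * f i + s * f j else if a = j then c * f j - s * f i else f a)"
proof -
  have e: "(\<Sum>\<^sub>uk. (if k = i then x else if k = j then y else 0) * f k) = x * f i + y * f j" for x y
  proof -
    have "(\<Sum>\<^sub>uk. (if k = i then x else if k = j then y else 0) * f k)
        = (\<Sum>\<^sub>uk. (if k = i then x * f i else 0) + (if k = j then y * f j else 0))"
      using assms by (intro sum.cong) auto
    then show ?thesis by (simp add: sum.distrib)
  qed
  have d: "(\<Sum>\<^sub>uk. (if k = a then 1 else 0) * f k) = f a"
    by (simp add: if_distrib[of "\<lambda>x. x * _"] cong: if_cong)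
  show ?thesis using assms by (simp add: tr_def givens_def e d)
qed

lemma orthogonal_givens:
  assumes "i \<noteq> j" "c\<^sup>2 + s\<^sup>2 = 1"
  shows "orthogonal_matrix (givens i j c s)"
proof -
  let ?T = "givens i j c s"
  have "(transpose ?T ** ?T) $ a $ b = tr ?T (\<lambda>k. ?T $ k $ b) a" for a b
    by (simp add: matrix_matrix_mult_def transpose_def tr_def)
  moreover have "tr ?T (\<lambda>k. ?T $ k $ b) a = (if a = b then 1 else 0)" for a b
    using assms unfolding tr_givens[OF assms(1)] by (auto simp: givens_def power2_eq_square)
  ultimately have "transpose ?T ** ?T = mat 1" by (simp add: vec_eq_iff mat_def)
  then show ?thesis by (simp add: orthogonal_matrix)
qed

text \<open>Orientation is not fixed here, so reflections are included;
  \<open>positive_frame\<close> restores it in \<open>canonical_frame\<close>.\<close>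

definition rotations :: "(real^6^6) set" where
  "rotations = {R. orthogonal_matrix R \<and> (\<forall>a. R $ a $ 0 = (if a = 0 then 1 else 0))}"

lemma givens_rotations:
  assumes "i \<noteq> j" "i \<noteq> 0" "j \<noteq> 0" "c\<^sup>2 + s\<^sup>2 = 1"
  shows "givens i j c s \<in> rotations"
  using assms orthogonal_givens by (auto simp: rotations_def givens_def)

lemma rotations_mult:
  assumes "R \<in> rotations" "T \<in> rotations" shows "R ** T \<in> rotations"
proof -
  have "(\<Sum>\<^sub>uk. R $ a $ k * (if k = 0 then 1 else 0)) = R $ a $ 0" for a
    by (simp add: if_distrib cong: if_cong)
  then show ?thesis
    using assms orthogonal_matrix_mul by (auto simp: rotations_def matrix_matrix_mult_def)
qed

lemma rotations_row:
  assumes "R \<in> rotations" shows "R $ 0 $ a = (if a = 0 then 1 else 0)"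
proof -
  have "(transpose R ** R) $ a $ 0 = (mat 1 :: real^6^6) $ a $ 0"
    using assms by (simp add: rotations_def orthogonal_matrix)
  moreover have "(\<Sum>\<^sub>uk. R $ k $ a * (if k = 0 then 1 else 0)) = R $ 0 $ a"
    by (simp add: if_distrib cong: if_cong)
  ultimately show ?thesis
    using assms by (simp add: rotations_def matrix_matrix_mult_def transpose_def mat_def)
qed

lemma rotations_minkowski:
  assumes "R \<in> rotations"
  shows "pull2 R \<eta> = \<eta>" "pull1 R v0 = v0"
proof -
  have "transpose R ** R = mat 1" using assms by (simp add: rotations_def orthogonal_matrix)
  then have o: "(\<Sum>\<^sub>uk. R $ k $ a * R $ k $ b) = (if a = b then 1 else 0)" for a b
    by (simp add: vec_eq_iff matrix_matrix_mult_def transpose_def mat_def)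
  have e: "(\<Sum>\<^sub>ui. R $ i $ b * \<eta> $ k $ i) = sg k * R $ k $ b" for k b
    by (simp add: minkowski_def if_distrib[of "\<lambda>x. _ * x"] cong: if_cong)
  have "pull2 R \<eta> $ a $ b = (\<Sum>\<^sub>uk. R $ k $ a * (sg k * R $ k $ b))" for a b
    unfolding pull2_def tr2_def tr_def vec_lambda_beta e ..
  also have "\<dots> a b = (\<Sum>\<^sub>uk. R $ k $ a * R $ k $ b - (if k = 0 then 2 * R $ 0 $ a * R $ 0 $ b else 0))" for a b
    by (rule sum.cong) auto
  finally have "pull2 R \<eta> $ a $ b = \<eta> $ a $ b" for a b
    by (auto simp: sum_subtractf o rotations_row[OF assms] minkowski_def)
  then show "pull2 R \<eta> = \<eta>" by (simp add: vec_eq_iff)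
  have "(\<Sum>\<^sub>uk. R $ k $ a * (if k = 0 then - 1 else 0)) = - R $ 0 $ a" for a
    by (simp add: if_distrib cong: if_cong)
  moreover have "v0 $ k = (if k = 0 then - 1 else 0)" for k by (simp add: axis_def)
  ultimately show "pull1 R v0 = v0"
    by (simp add: vec_eq_iff pull1_def tr_def rotations_row[OF assms])
qed

text \<open>Provides the maximiser from which the normal form is read off.\<close>

lemma compact_rotations: "compact rotations"
proof -
  have row: "norm (R $ a) = 1" if "orthogonal_matrix R" for R :: "real^6^6" and a
    using that unfolding orthogonal_matrix_orthonormal_rows by (simp add: row_def)
  have "norm R \<le> (\<Sum>a\<in>(UNIV::6 set). 1)" if "R \<in> rotations" for R
  proof -
    have "norm R \<le> (\<Sum>\<^sub>ua. norm (R $ a))" by (simp add: norm_vec_def L2_set_le_sum)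
    also have "\<dots> = (\<Sum>a\<in>(UNIV::6 set). 1)" using that row by (simp add: rotations_def)
    finally show ?thesis .
  qed
  then have "bounded rotations" by (rule boundedI)
  moreover have "closed rotations"
  proof -
    have eq: "rotations = (\<Inter>a. {R. R $ a $ 0 = (if a = 0 then 1 else 0)}) \<inter>
        (\<Inter>a b. {R. (\<Sum>\<^sub>uk. R $ k $ a * R $ k $ b) = (if a = b then 1 else 0)})"
      by (auto simp: rotations_def orthogonal_matrix vec_eq_iff matrix_matrix_mult_def transpose_def mat_def)
    show ?thesis
      unfolding eq by (intro closed_Int closed_INT ballI closed_Collect_eq continuous_intros)
  qed
  ultimately show ?thesis by (simp add: compact_eq_bounded_closed)
qed

text \<open>On the unit circle c A + s S reaches sqrt (A^2 + S^2), at the point (A, S) / r. A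
  maximum at (1, 0) thus leaves no room for S; this is the first-order condition without
  differentiation in the angle.\<close>

lemma cos_sin_max:
  assumes "\<And>c s::real. c\<^sup>2 + s\<^sup>2 = 1 \<Longrightarrow> c * A + s * S \<le> A"
  shows "S = 0"
proof (rule ccontr)
  assume S: "S \<noteq> 0"
  define r where "r = sqrt (A\<^sup>2 + S\<^sup>2)"
  have r2: "r\<^sup>2 = A\<^sup>2 + S\<^sup>2" by (simp add: r_def)
  have r: "r > 0" using S by (simp add: r_def add_nonneg_pos)
  have "(A / r)\<^sup>2 + (S / r)\<^sup>2 = 1" using r S by (simp add: power_divide r2 flip: add_divide_distrib)
  then have "A / r * A + S / r * S \<le> A" by (rule assms)
  moreover have "A / r * A + S / r * S = r"
    using r r2 by (simp add: field_simps power2_eq_square)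
  ultimately have "r \<le> A" by simp
  then have "r\<^sup>2 \<le> A\<^sup>2" using r by (intro power_mono) auto
  then show False using S r2 by simp
qed

lemma transverse2_rotation:
  assumes "R \<in> rotations" "B \<in> trans0"
  shows "pull2 R B \<in> trans0"
proof -
  have "pull2 R B \<in> two_forms" by (rule pull2_two_forms[OF transverse2_two_forms[OF assms(2)]])
  moreover have "tr R (\<lambda>j. B $ i $ j) 0 = B $ i $ 0" for i
    using assms(1) by (simp add: tr_def rotations_def if_distrib[of "\<lambda>x. x * _"] cong: if_cong)
  ultimately show ?thesis
    by (simp add: transverse2_v0 pull2_def tr2_def transverse2_zero[OF assms(2)] tr_zero)
qed

text \<open>A maximiser of \<open>2 B\<^sub>1\<^sub>2 + B\<^sub>3\<^sub>4\<close> over all rotations is block diagonal, because the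
  first-order conditions for the rotations in the coordinate planes kill the other components.\<close>

lemma canonical_rotation:
  assumes B: "B \<in> trans0"
  shows "\<exists>R\<in>rotations. canonical (pull2 R B)"
proof -
  \<comment> \<open>The weights 2 and 1 must differ. With equal weights the rotations in the planes
    (1,3) and (2,4) would give the same condition, as would those in (1,4) and (2,3); with these
    weights each pair is an independent system that kills two components.\<close>
  define f where "f R = 2 * pull2 R B $ 1 $ 2 + pull2 R B $ 3 $ 4" for R
  have "continuous_on rotations f"
    unfolding f_def pull2_def tr2_def tr_def vec_lambda_beta by (intro continuous_intros)
  moreover have "mat 1 \<in> rotations" using orthogonal_matrix_id unfolding rotations_def by (simp add: mat_def)
  ultimately obtain R where R: "R \<in> rotations" and max: "\<And>T. T \<in> rotations \<Longrightarrow> f T \<le> f R"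
    using continuous_attains_sup[OF compact_rotations] by blast
  define C where "C = pull2 R B"
  have C: "C \<in> trans0" unfolding C_def by (rule transverse2_rotation[OF R B])
  note skew = two_forms_sort[OF transverse2_two_forms[OF C]] two_forms_diag[OF transverse2_two_forms[OF C]] less_6
  have m: "2 * pull2 T C $ 1 $ 2 + pull2 T C $ 3 $ 4 \<le> 2 * C $ 1 $ 2 + C $ 3 $ 4" if "T \<in> rotations" for T
    using max[OF rotations_mult[OF R that]] by (simp add: f_def C_def flip: pull2_pull2)
  have g: "2 * tr2 (givens i j c s) (\<lambda>i j. C $ i $ j) 1 2 + tr2 (givens i j c s) (\<lambda>i j. C $ i $ j) 3 4
      \<le> 2 * C $ 1 $ 2 + C $ 3 $ 4" if "i \<noteq> j" "i \<noteq> 0" "j \<noteq> 0" "c\<^sup>2 + s\<^sup>2 = 1" for i j c s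
    using m[OF givens_rotations[OF that]] by (simp add: pull2_def)
  note t = tr2_def tr_givens skew algebra_simps
  have "- 2 * C$2$3 - C$1$4 = 0"
    by (rule cos_sin_max[of "2 * C$1$2 + C$3$4"]) (use g[of 1 3] in \<open>simp add: t\<close>)
  moreover have "2 * C$1$4 + C$2$3 = 0"
    by (rule cos_sin_max[of "2 * C$1$2 + C$3$4"]) (use g[of 2 4] in \<open>simp add: t\<close>)
  moreover have "- 2 * C$2$4 + C$1$3 = 0"
    by (rule cos_sin_max[of "2 * C$1$2 + C$3$4"]) (use g[of 1 4] in \<open>simp add: t\<close>)
  moreover have "2 * C$1$3 - C$2$4 = 0"
    by (rule cos_sin_max[of "2 * C$1$2 + C$3$4"]) (use g[of 2 3] in \<open>simp add: t\<close>)
  moreover have "- 2 * C$2$5 = 0"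
    by (rule cos_sin_max[of "2 * C$1$2"]) (use g[of 1 5] in \<open>simp add: t\<close>)
  moreover have "2 * C$1$5 = 0"
    by (rule cos_sin_max[of "2 * C$1$2"]) (use g[of 2 5] in \<open>simp add: t\<close>)
  moreover have "- C$4$5 = 0"
    by (rule cos_sin_max[of "C$3$4"]) (use g[of 3 5] in \<open>simp add: t\<close>)
  moreover have "C$3$5 = 0"
    by (rule cos_sin_max[of "C$3$4"]) (use g[of 4 5] in \<open>simp add: t\<close>)
  \<comment> \<open>The half turn in the plane (4,5) reverses the sign of the block 34 and keeps the
    block 12.\<close>
  moreover have "0 \<le> C$3$4" using g[of 4 5 "- 1" 0] by (simp add: t)
  \<comment> \<open>Quarter turns in the planes (1,3) and (2,4) exchange the two blocks, and the
    larger weight selects the larger block.\<close>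
  moreover have "C$3$4 \<le> C$1$2"
    using m[OF rotations_mult[OF givens_rotations[of 1 3 0 1] givens_rotations[of 2 4 0 1]]]
    by (simp add: pull2_def t flip: tr_tr)
  ultimately have "canonical C" using C by (simp add: canonical_def)
  then show ?thesis using R C_def by blast
qed

section \<open>Orientation and adapted frames\<close>

text \<open>A reflection that is invisible to the Minkowski metric, to \<open>v0\<close> and to any
  normal form, whose blocks avoid direction 5. It corrects the orientation of a frame and preserves
  everything achieved so far.\<close>

definition flip5 :: "real^6^6" where
  "flip5 = (\<chi> a b. if a = b then (if a = 5 then - 1 else 1) else 0)"

lemma det_flip5: "det flip5 = - 1"
proof -
  have "det flip5 = (\<Prod>i\<in>UNIV. flip5 $ i $ i)"
    by (rule det_diagonal) (simp add: flip5_def)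
  also have "\<dots> = - 1" unfolding UNIV_6 by (simp add: flip5_def)
  finally show ?thesis .
qed

lemma tr_flip5: "tr flip5 f a = (if a = 5 then - f a else f a)"
  by (simp add: tr_def flip5_def if_distrib[of "\<lambda>x. x * _"] cong: if_cong)

lemma flip5_invariant:
  "pull2 flip5 \<eta> = \<eta>" "pull1 flip5 v0 = v0" "canonical B \<Longrightarrow> pull2 flip5 B = B"
proof -
  show "pull2 flip5 \<eta> = \<eta>" "pull1 flip5 v0 = v0"
    by (auto simp: pull2_def pull1_def tr2_def tr_flip5 vec_eq_iff minkowski_def axis_def)
  assume B: "canonical B"
  then have Bt: "B \<in> trans0" by (simp add: canonical_def)
  note skew = two_forms_sort[OF transverse2_two_forms[OF Bt]] two_forms_diag[OF transverse2_two_forms[OF Bt]] less_6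
    transverse2_zero[OF Bt]
  show "pull2 flip5 B = B"
    using B unfolding canonical_def
    by (simp add: pull2_def tr2_def tr_flip5 vec_eq_iff[where 'a=real] vec_eq_iff[where 'a=vec6] all_6 skew)
qed

lemma positive_frame:
  assumes "invertible P" "invertible g"
  shows "\<exists>P'. (P' = P \<or> P' = P ** flip5) \<and> frame_change P' (matrix_inv P') g"
proof -
  define P' where "P' = (if 0 < det P then P else P ** flip5)"
  have "det P \<noteq> 0" using assms(1) by (simp add: invertible_det_nz)
  then have "0 < det P'" by (simp add: P'_def det_mul det_flip5)
  moreover from this have "invertible P'" by (simp add: invertible_det_nz)
  ultimately have "frame_change P' (matrix_inv P') g"
    using assms matrix_inv_inverse unfolding frame_change_def by blast
  moreover have "P' = P \<or> P' = P ** flip5" by (simp add: P'_def)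
  ultimately show ?thesis by blast
qed

lemma lorentzian_invertible: assumes "lorentzian g" shows "invertible g"
proof -
  obtain P where P: "transpose P ** g ** P = \<eta>" using assms by (auto simp: lorentzian_def)
  have "det (transpose P ** g ** P) \<noteq> 0" unfolding P det_minkowski by simp
  then have "det g \<noteq> 0" by (auto simp: det_mul)
  then show ?thesis by (simp add: invertible_det_nz)
qed

lemma minkowski_frame:
  assumes "lorentzian g" shows "\<exists>P Q. frame_change P Q g \<and> pull2 P g = \<eta>"
proof -
  obtain P where "invertible P" "pull2 P g = \<eta>"
    using assms by (auto simp: lorentzian_def pull2_matrix)
  then show ?thesis
    using positive_frame[of P g] lorentzian_invertible[OF assms] flip5_invariant(1) by (metis pull2_pull2)
qed

text \<open>The reflection that exchanges u and \<open>v0\<close>, in Minkowski signature. Its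
  direction w is the raised difference of \<open>v0\<close> and u, and the square N = -2 - 2 u_0 of
  w vanishes only for u = \<open>v0\<close>. A past-directed u is covered as well, since neither
  time nor space orientation is fixed here.\<close>

lemma householder:
  assumes u: "sq1 \<eta> u = - 1"
  shows "\<exists>H. invertible H \<and> pull2 H \<eta> = \<eta> \<and> pull1 H u = v0"
proof (cases "u $ 0 = - 1")
  case True
  have "(u$1)\<^sup>2 + (u$2)\<^sup>2 + (u$3)\<^sup>2 + (u$4)\<^sup>2 + (u$5)\<^sup>2 = 0"
    using u True by (simp add: sq1_minkowski)
  then have "u$1 = 0 \<and> u$2 = 0 \<and> u$3 = 0 \<and> u$4 = 0 \<and> u$5 = 0"
    by (smt (verit) zero_le_power2 zero_eq_power2)
  then have "u = v0" using True by (simp add: vec_eq_iff all_6 axis_def)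
  then show ?thesis by (intro exI[of _ "mat 1"]) (auto simp: pull_one invertible_def)
next
  case False
  define w where "w = (\<chi> i. if i = 0 then 1 + u $ 0 else - u $ i)"
  define N where "N = - 2 - 2 * u $ 0"
  have N: "N \<noteq> 0" using False by (simp add: N_def)
  define H where "H = (\<chi> i a. (if i = a then 1 else 0) - 2 * w $ i * (sg a * w $ a) / N)"
  have wN: "(\<Sum>\<^sub>ui. sg i * (w $ i)\<^sup>2) = N"
    using u by (simp add: sum_6 w_def sq1_minkowski N_def power2_eq_square algebra_simps)
  have wu: "(\<Sum>\<^sub>ui. w $ i * u $ i) = - N / 2"
    using u by (simp add: sum_6 w_def sq1_minkowski N_def power2_eq_square algebra_simps)
  have trH: "tr H f a = f a - 2 * (sg a * w $ a) / N * (\<Sum>\<^sub>ui. w $ i * f i)" for f a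
  proof -
    have "tr H f a = (\<Sum>\<^sub>ui. (if i = a then f a else 0) - 2 * (sg a * w $ a) / N * (w $ i * f i))"
      unfolding tr_def H_def vec_lambda_beta by (rule sum.cong) (auto simp: algebra_simps)
    then show ?thesis by (simp add: sum_subtractf sum_distrib_left)
  qed
  have "pull1 H u $ a = v0 $ a" for a
    using N by (simp add: pull1_def trH wu) (simp add: w_def axis_def)
  moreover have "pull2 H \<eta> $ a $ b = \<eta> $ a $ b" for a b
  proof -
    have e: "(\<Sum>\<^sub>ui. w $ i * \<eta> $ k $ i) = sg k * w $ k" for k
      by (simp add: minkowski_def if_distrib[of "\<lambda>x. _ * x"] cong: if_cong)
    have "pull2 H \<eta> $ a $ b = tr H (\<lambda>k. \<eta> $ k $ b - 2 * (sg b * w $ b) / N * (sg k * w $ k)) a"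
      by (simp add: pull2_def tr2_def trH e)
    also have "\<dots> = tr H (\<lambda>k. \<eta> $ k $ b) a - 2 * (sg b * w $ b) / N * tr H (\<lambda>k. sg k * w $ k) a"
      unfolding diff_conv_add_uminus tr_add tr_minus tr_cmult ..
    also have "tr H (\<lambda>k. sg k * w $ k) a = - (sg a * w $ a)"
    proof -
      have "(\<Sum>\<^sub>ui. w $ i * (sg i * w $ i)) = N"
        unfolding wN[symmetric] by (rule sum.cong) (auto simp: power2_eq_square)
      then show ?thesis using N by (simp add: trH)
    qed
    also have "tr H (\<lambda>k. \<eta> $ k $ b) a = \<eta> $ a $ b - 2 * (sg a * w $ a) / N * (sg b * w $ b)"
    proof -
      have "(\<Sum>\<^sub>ui. w $ i * \<eta> $ i $ b) = sg b * w $ b"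
        by (simp add: minkowski_def if_distrib[of "\<lambda>x. _ * x"] cong: if_cong)
      then show ?thesis by (simp add: trH)
    qed
    finally show ?thesis by (simp add: mult_ac)
  qed
  ultimately have "pull1 H u = v0" "pull2 H \<eta> = \<eta>" by (simp_all add: vec_eq_iff)
  moreover have "invertible H"
  proof -
    have "det (transpose H ** \<eta> ** H) = - 1"
      using \<open>pull2 H \<eta> = \<eta>\<close> by (simp add: pull2_matrix det_minkowski)
    then have "det H \<noteq> 0" by (auto simp: det_mul)
    then show ?thesis by (simp add: invertible_det_nz)
  qed
  ultimately show ?thesis by blast
qed

lemma rest_frame:
  assumes "lorentzian g" "unit_timelike g v"
  shows "\<exists>P Q. frame_change P Q g \<and> pull2 P g = \<eta> \<and> pull1 P v = v0"
proof -
  obtain P0 where P0: "invertible P0" "pull2 P0 g = \<eta>"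
    using assms(1) by (auto simp: lorentzian_def pull2_matrix)
  have g: "invertible g" using assms(1) by (rule lorentzian_invertible)
  obtain P1 where P1: "P1 = P0 \<or> P1 = P0 ** flip5" and fc: "frame_change P1 (matrix_inv P1) g"
    using positive_frame[OF P0(1) g] by blast
  have m1: "pull2 P1 g = \<eta>"
    using P1 P0(2) by (auto simp: flip5_invariant simp flip: pull2_pull2)
  have "sq1 \<eta> (pull1 P1 v) = - 1"
    using frame_change.sq1_pull[OF fc, of v] assms(2) m1 by (simp add: unit_timelike_def)
  then obtain H where H: "invertible H" "pull2 H \<eta> = \<eta>" "pull1 H (pull1 P1 v) = v0"
    using householder by blast
  have "invertible P1"
    using frame_change.PQ[OF fc] frame_change.QP[OF fc] invertible_def by blast
  then have "invertible (P1 ** H)" using H(1) by (simp add: invertible_mult)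
  then obtain P where P: "P = P1 ** H \<or> P = P1 ** H ** flip5" and fc': "frame_change P (matrix_inv P) g"
    using positive_frame[OF _ g] by blast
  have "pull2 P g = \<eta>" "pull1 P v = v0"
    using P m1 H by (auto simp: flip5_invariant simp flip: pull2_pull2 pull1_pull1)
  then show ?thesis using fc' by blast
qed

lemma frame_change_comp:
  assumes "frame_change P Q g" "frame_change R S (pull2 P g)"
  shows "frame_change (P ** R) (S ** Q) g"
proof -
  have "P ** R ** (S ** Q) = P ** (R ** S) ** Q" by (simp add: matrix_mul_assoc)
  then show ?thesis
    using assms by unfold_locales (simp_all add: frame_change_def det_mul)
qed

lemma canonical_frame:
  assumes "lorentzian g" "unit_timelike g v" "B \<in> transverse2 g v"
  shows "\<exists>P Q. frame_change P Q g \<and> pull2 P g = \<eta> \<and> pull1 P v = v0 \<and> canonical (pull2 P B)"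
proof -
  obtain P Q where fc: "frame_change P Q g" and P: "pull2 P g = \<eta>" "pull1 P v = v0"
    using rest_frame[OF assms(1,2)] by blast
  have "pull2 P B \<in> trans0"
    using frame_change.transverse2_pull[OF fc assms(3)] P by simp
  then obtain R where R: "R \<in> rotations" "canonical (pull2 R (pull2 P B))"
    using canonical_rotation by blast
  have "invertible R"
    using R(1) unfolding rotations_def orthogonal_matrix_def invertible_def by blast
  then obtain S where S: "S = R \<or> S = R ** flip5" and fc': "frame_change S (matrix_inv S) \<eta>"
    using positive_frame[OF _ invertible_minkowski] by blast
  have "frame_change (P ** S) (matrix_inv S ** Q) g"
    using frame_change_comp[OF fc, of S] fc' P by simp
  moreover have "pull2 (P ** S) g = \<eta>" "pull1 (P ** S) v = v0" "canonical (pull2 (P ** S) B)"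
    using S P R rotations_minkowski[OF R(1)] by (auto simp: flip5_invariant simp flip: pull2_pull2 pull1_pull1)
  ultimately show ?thesis by blast
qed

section \<open>Gradients at a normal form\<close>

text \<open>A derivative within S says something only about directions in S. Along such a line it
  becomes a real derivative, to which uniqueness and parity apply.\<close>

lemma has_derivative_line:
  fixes f :: "'a::real_normed_vector \<Rightarrow> real"
  assumes f: "(f has_derivative f') (at x within S)" and S: "subspace S" "x \<in> S" "d \<in> S"
  shows "((\<lambda>t. f (x + t *\<^sub>R d)) has_real_derivative f' d) (at 0)"
proof -
  let ?h = "\<lambda>t::real. x + t *\<^sub>R d"
  have h: "(?h has_derivative (\<lambda>t. t *\<^sub>R d)) (at 0 within UNIV)"
    by (auto intro!: derivative_eq_intros)
  have "range ?h \<subseteq> S" using S by (auto intro: subspace_add subspace_scale)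
  then have "(f has_derivative f') (at (?h 0) within range ?h)"
    using has_derivative_subset[OF f] by simp
  from diff_chain_within[OF h this]
  have "((\<lambda>t. f (?h t)) has_derivative (\<lambda>t. f' (t *\<^sub>R d))) (at 0)" by (simp add: o_def)
  moreover have "f' (t *\<^sub>R d) = f' d * t" for t
    using has_derivative_linear[OF f] by (simp add: linear_cmul)
  ultimately show ?thesis by (simp add: has_field_derivative_def mult_commute_abs)
qed

text \<open>Increments between points of S lie in S, so any bounded linear map that agrees there is
  an equally good derivative. This lets gradients be written with \<open>contr2\<close> or with the
  inner product as convenient.\<close>

lemma has_derivative_within_subspace_cong:
  assumes f: "(f has_derivative f') (at x within S)" and S: "subspace S" "x \<in> S"
    and h: "bounded_linear h" "\<And>d. d \<in> S \<Longrightarrow> h d = f' d"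
  shows "(f has_derivative h) (at x within S)"
proof -
  have e: "\<forall>\<^sub>F y in at x within S. (1 / norm (y - x)) *\<^sub>R (f y - (f x + f' (y - x)))
      = (1 / norm (y - x)) *\<^sub>R (f y - (f x + h (y - x)))"
  proof -
    have "h (y - x) = f' (y - x)" if "y \<in> S" for y using S h(2) that by (simp add: subspace_diff)
    then show ?thesis unfolding eventually_at_filter by (intro always_eventually allI impI) simp
  qed
  then show ?thesis
    using f h(1) unfolding has_derivative_within tendsto_cong[OF e] by simp
qed

text \<open>The representing vector in the whole space is projected orthogonally to S, so that the
  gradient is itself an admissible tensor.\<close>

lemma riesz_subspace:
  fixes f :: "'a::euclidean_space \<Rightarrow> real"
  assumes S: "subspace S" and f: "linear f"
  shows "\<exists>G\<in>S. \<forall>d\<in>S. f d = G \<bullet> d"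
proof -
  define y where "y = (\<Sum>b\<in>Basis. f b *\<^sub>R b)"
  have y: "f d = y \<bullet> d" for d
  proof -
    have "f d = f (\<Sum>b\<in>Basis. (d \<bullet> b) *\<^sub>R b)" by (simp add: euclidean_representation)
    also have "\<dots> = (\<Sum>b\<in>Basis. (d \<bullet> b) * f b)" by (simp add: linear_sum[OF f] linear_cmul[OF f])
    finally show ?thesis by (simp add: y_def inner_sum_left inner_commute[of d] mult.commute)
  qed
  obtain G z where "G \<in> span S" "\<And>w. w \<in> span S \<Longrightarrow> orthogonal z w" "y = G + z"
    using orthogonal_subspace_decomp_exists[of S y] by blast
  moreover have "span S = S" using S by (simp add: span_eq_iff)
  ultimately show ?thesis using y by (auto simp: inner_add_left orthogonal_def)
qed

lemma gradient_exists:
  fixes f :: "'a::euclidean_space \<Rightarrow> real"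
  assumes "f differentiable (at x within S)" "subspace S" "x \<in> S"
  shows "\<exists>G\<in>S. (f has_derivative (\<lambda>d. G \<bullet> d)) (at x within S)"
proof -
  obtain f' where f': "(f has_derivative f') (at x within S)"
    using assms(1) by (auto simp: differentiable_def)
  obtain G where "G \<in> S" "\<forall>d\<in>S. f' d = G \<bullet> d"
    using riesz_subspace[OF assms(2) has_derivative_linear[OF f']] by blast
  then show ?thesis
    by (intro bexI[of _ G] has_derivative_within_subspace_cong[OF f' assms(2,3)] bounded_linear_inner_right) auto
qed

lemma gradient_unique:
  fixes f :: "'a::euclidean_space \<Rightarrow> real"
  assumes "(f has_derivative f') (at x within S)" "(f has_derivative f'') (at x within S)"
    and "subspace S" "x \<in> S" "d \<in> S"
  shows "f' d = f'' d"
  using DERIV_unique[OF has_derivative_line[OF assms(1,3,4,5)] has_derivative_line[OF assms(2,3,4,5)]] .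

lemma differentiable_sqrt:
  fixes f :: "'a::real_normed_vector \<Rightarrow> real"
  assumes "f differentiable (at x within S)" "0 < f x"
  shows "(\<lambda>x. sqrt (f x)) differentiable (at x within S)"
proof -
  obtain f' where "(f has_derivative f') (at x within S)" using assms(1) by (auto simp: differentiable_def)
  then have "((\<lambda>x. sqrt (f x)) has_derivative (\<lambda>d. f' d * (inverse (sqrt (f x)) / 2))) (at x within S)"
    by (intro DERIV_compose_FDERIV DERIV_real_sqrt assms(2))
  then show ?thesis by (rule differentiableI)
qed

lemma even_derivative:
  assumes f: "(f has_real_derivative d) (at 0)" and even: "\<And>t. f (- t) = f t"
  shows "d = 0"
proof -
  have "((\<lambda>t. f (- t)) has_real_derivative d * (- 1)) (at 0)"
    by (rule DERIV_chain2[of f]) (use f in \<open>auto intro!: derivative_eq_intros\<close>)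
  then have "(f has_real_derivative - d) (at 0)" by (simp add: even)
  then have "- d = d" by (rule DERIV_unique) (rule f)
  then show ?thesis by simp
qed

lemma abs_derivative_pos:
  fixes f :: "real \<Rightarrow> real"
  assumes f: "(f has_real_derivative d) (at x)" and pos: "0 < f x"
  shows "((\<lambda>t. \<bar>f t\<bar>) has_real_derivative d) (at x)"
proof -
  have "(abs has_real_derivative 1) (at (f x))"
    by (rule has_field_derivative_transform_within_open[of "\<lambda>y. y" _ _ "{0<..}"])
      (use pos in \<open>auto intro!: derivative_eq_intros\<close>)
  from DERIV_chain2[OF this f] show ?thesis by simp
qed

text \<open>The difference quotients tend to k h(0) from the right and to -k h(0) from the
  left.\<close>

lemma abs_not_differentiable:
  assumes "((\<lambda>t. k * \<bar>t\<bar> * h t) has_real_derivative d) (at 0)" and h: "isCont h 0"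
  shows "k * h 0 = 0"
proof -
  have "((\<lambda>t. k * \<bar>t\<bar> * h t / t) \<longlongrightarrow> d) (at 0)"
    using assms(1) by (simp add: has_field_derivative_iff)
  then have "((\<lambda>t. k * \<bar>t\<bar> * h t / t) \<longlongrightarrow> d) (at_right 0)" "((\<lambda>t. k * \<bar>t\<bar> * h t / t) \<longlongrightarrow> d) (at_left 0)"
    by (auto simp: filterlim_at_split)
  moreover have "\<forall>\<^sub>F t in at_right 0. k * \<bar>t\<bar> * h t / t = k * h t"
    by (simp add: eventually_at_filter)
  moreover have "\<forall>\<^sub>F t in at_left 0. k * \<bar>t\<bar> * h t / t = - (k * h t)"
    by (simp add: eventually_at_filter)
  ultimately have "((\<lambda>t. k * h t) \<longlongrightarrow> d) (at_right 0)" "((\<lambda>t. - (k * h t)) \<longlongrightarrow> d) (at_left 0)"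
    by (auto simp: tendsto_cong)
  moreover have "((\<lambda>t. k * h t) \<longlongrightarrow> k * h 0) (at_right 0)" "((\<lambda>t. - (k * h t)) \<longlongrightarrow> - (k * h 0)) (at_left 0)"
    using h by (auto intro!: tendsto_intros simp: isCont_def filterlim_at_split)
  ultimately have "d = k * h 0" "d = - (k * h 0)"
    using tendsto_unique trivial_limit_at_right_real trivial_limit_at_left_real by blast+
  then show ?thesis by simp
qed

section \<open>Gradients of functions of s and p, and of V\<close>

text \<open>The two-form dx^i \<and> dx^j.\<close>

definition plane :: "6 \<Rightarrow> 6 \<Rightarrow> tensor2" where
  "plane i j = (\<chi> a b. if a = i \<and> b = j then 1 else if a = j \<and> b = i then - 1 else 0)"

lemma plane_transverse:
  assumes "i \<noteq> 0" "j \<noteq> 0" "i \<noteq> j" shows "plane i j \<in> trans0"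
  using assms by (auto simp: transverse2_v0 two_forms_def plane_def)

lemma canonical_s_p:
  assumes B: "B \<in> trans0"
    "B$1$3 = 0" "B$1$4 = 0" "B$1$5 = 0" "B$2$3 = 0" "B$2$4 = 0" "B$2$5 = 0" "B$3$5 = 0" "B$4$5 = 0"
  shows "s_inv \<eta> B = ((B$1$2)\<^sup>2 + (B$3$4)\<^sup>2) / 2" "p0 B = \<bar>B$1$2\<bar> * \<bar>B$3$4\<bar>"
proof -
  show "s_inv \<eta> B = ((B$1$2)\<^sup>2 + (B$3$4)\<^sup>2) / 2"
    unfolding s_inv_minkowski[OF B(1)] by (simp add: B(2-))
  show "p0 B = \<bar>B$1$2\<bar> * \<bar>B$3$4\<bar>"
    unfolding p_inv_minkowski[OF B(1)] by (simp add: pf_def B(2-) abs_mult)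
qed

text \<open>Only derivatives along lines are asked for, so that the lemma serves functions of B and,
  through \<open>lift\<close>, functions of a self-dual form. As \<phi> is arbitrary, the two block
  components are characterised by a real derivative and not computed; the factor 2 counts each pair
  of indices twice.\<close>

lemma gradient_canonical:
  assumes B: "canonical B" and G: "G \<in> trans0"
    and der: "\<And>d. d \<in> trans0 \<Longrightarrow>
      ((\<lambda>t. \<phi> (s_inv \<eta> (B + t *\<^sub>R d)) (p0 (B + t *\<^sub>R d)))
        has_real_derivative contr2 \<eta> G d) (at 0)"
  shows "G$1$3 = 0" "G$1$4 = 0" "G$1$5 = 0" "G$2$3 = 0" "G$2$4 = 0" "G$2$5 = 0" "G$3$5 = 0" "G$4$5 = 0"
    and "((\<lambda>t. \<phi> (((B$1$2 + t * \<alpha>)\<^sup>2 + (B$3$4 + t * \<beta>)\<^sup>2) / 2) (\<bar>B$1$2 + t * \<alpha>\<bar> * \<bar>B$3$4 + t * \<beta>\<bar>))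
        has_real_derivative 2 * (\<alpha> * G$1$2 + \<beta> * G$3$4)) (at 0)"
proof -
  have Bt: "B \<in> trans0" using B by (simp add: canonical_def)
  have z: "B$1$3 = 0" "B$1$4 = 0" "B$1$5 = 0" "B$2$3 = 0" "B$2$4 = 0" "B$2$5 = 0" "B$3$5 = 0" "B$4$5 = 0"
    using B by (simp_all add: canonical_def)
  have line: "B + t *\<^sub>R d \<in> trans0" if "d \<in> trans0" for t d
    by (intro subspace_add subspace_scale subspace_transverse2 Bt that)
  have 0: "contr2 \<eta> G d = 0"
    if d: "d \<in> trans0"
      and e: "\<And>t. s_inv \<eta> (B + (- t) *\<^sub>R d) = s_inv \<eta> (B + t *\<^sub>R d)"
       "\<And>t. p0 (B + (- t) *\<^sub>R d) = p0 (B + t *\<^sub>R d)" for d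
    by (rule even_derivative[OF der[OF d]]) (simp only: e)
  have off: "contr2 \<eta> G (plane i j) = 0"
    if "(i, j) \<in> {(1,3), (1,4), (1,5), (2,3), (2,4), (2,5), (3,5), (4,5)}" for i j
  proof (rule 0)
    show pl: "plane i j \<in> trans0" using that by (intro plane_transverse) auto
    show "s_inv \<eta> (B + (- t) *\<^sub>R plane i j) = s_inv \<eta> (B + t *\<^sub>R plane i j)" for t
      unfolding s_inv_minkowski[OF line[OF pl]] using that by (auto simp: z plane_def)
    show "p0 (B + (- t) *\<^sub>R plane i j) = p0 (B + t *\<^sub>R plane i j)" for t
      unfolding p_inv_minkowski[OF line[OF pl]] pf_def using that
      by (elim insertE; simp add: z plane_def)
  qed
  have c: "contr2 \<eta> G (plane i j) = 2 * G $ i $ j"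
    if "(i, j) \<in> {(1,2), (1,3), (1,4), (1,5), (2,3), (2,4), (2,5), (3,4), (3,5), (4,5)}" for i j
  proof -
    have pl: "plane i j \<in> trans0" using that by (intro plane_transverse) auto
    show ?thesis unfolding contr2_transverse[OF G pl] using that
      by (elim insertE; simp add: plane_def)
  qed
  show "G$1$3 = 0" "G$1$4 = 0" "G$1$5 = 0" "G$2$3 = 0" "G$2$4 = 0" "G$2$5 = 0" "G$3$5 = 0" "G$4$5 = 0"
    using off[of 1 3] c[of 1 3] off[of 1 4] c[of 1 4] off[of 1 5] c[of 1 5] off[of 2 3] c[of 2 3]
      off[of 2 4] c[of 2 4] off[of 2 5] c[of 2 5] off[of 3 5] c[of 3 5] off[of 4 5] c[of 4 5] by simp_all
  define d where "d = \<alpha> *\<^sub>R plane 1 2 + \<beta> *\<^sub>R plane 3 4"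
  have d: "d \<in> trans0"
    unfolding d_def by (intro subspace_add subspace_scale subspace_transverse2 plane_transverse) auto
  have "contr2 \<eta> G d = 2 * (\<alpha> * G$1$2 + \<beta> * G$3$4)"
    unfolding contr2_transverse[OF G d] by (simp add: d_def plane_def)
  moreover have "s_inv \<eta> (B + t *\<^sub>R d) = ((B$1$2 + t * \<alpha>)\<^sup>2 + (B$3$4 + t * \<beta>)\<^sup>2) / 2"
    "p0 (B + t *\<^sub>R d) = \<bar>B$1$2 + t * \<alpha>\<bar> * \<bar>B$3$4 + t * \<beta>\<bar>" for t
    using canonical_s_p[OF line[OF d, of t]] by (simp_all add: z d_def plane_def)
  ultimately show "((\<lambda>t. \<phi> (((B$1$2 + t * \<alpha>)\<^sup>2 + (B$3$4 + t * \<beta>)\<^sup>2) / 2) (\<bar>B$1$2 + t * \<alpha>\<bar> * \<bar>B$3$4 + t * \<beta>\<bar>))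
        has_real_derivative 2 * (\<alpha> * G$1$2 + \<beta> * G$3$4)) (at 0)"
    using der[OF d] by (simp only:)
qed

lemma p_gradient_canonical:
  assumes B: "canonical B" and G: "G \<in> trans0"
    and der: "p_grad B G"
  shows "G$1$3 = 0" "G$1$4 = 0" "G$1$5 = 0" "G$2$3 = 0" "G$2$4 = 0" "G$2$5 = 0" "G$3$5 = 0" "G$4$5 = 0"
    and "G$1$2 = B$3$4 / 2" "G$3$4 = B$1$2 / 2"
proof -
  have Bt: "B \<in> trans0" and b: "0 \<le> B$3$4" "B$3$4 \<le> B$1$2"
    using B by (simp_all add: canonical_def)
  note gc = gradient_canonical[OF B G, of "\<lambda>s p. p", OF has_derivative_line[OF der subspace_transverse2 Bt]]
  show "G$1$3 = 0" "G$1$4 = 0" "G$1$5 = 0" "G$2$3 = 0" "G$2$4 = 0" "G$2$5 = 0" "G$3$5 = 0" "G$4$5 = 0"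
    using gc(1-8) by auto
  have 12: "((\<lambda>t. \<bar>B$1$2 + t\<bar> * B$3$4) has_real_derivative 2 * G$1$2) (at 0)"
    using gc(9)[of 1 0] b by simp
  have 34: "((\<lambda>t. B$1$2 * \<bar>B$3$4 + t\<bar>) has_real_derivative 2 * G$3$4) (at 0)"
    using gc(9)[of 0 1] b by simp
  have "G$1$2 = B$3$4 / 2 \<and> G$3$4 = B$1$2 / 2"
  proof (cases "B$3$4 = 0")
    \<comment> \<open>With a vanishing smaller block, p is x |t| along the plane 34, which is
      differentiable only for x = 0. Then B = 0 and both formulas read 0 = 0.\<close>
    case True
    then have "B$1$2 = 0"
      using abs_not_differentiable[of "B$1$2" "\<lambda>t. 1"] 34 by simp
    then show ?thesis using DERIV_unique[OF 12, of 0] DERIV_unique[OF 34, of 0] True by simp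
  next
    case False
    have d: "((\<lambda>t. \<bar>B$1$2 + t\<bar> * B$3$4) has_real_derivative B$3$4) (at 0)"
      "((\<lambda>t. B$1$2 * \<bar>B$3$4 + t\<bar>) has_real_derivative B$1$2) (at 0)"
      using b False by (auto intro!: derivative_eq_intros abs_derivative_pos)
    show ?thesis using DERIV_unique[OF 12 d(1)] DERIV_unique[OF 34 d(2)] by simp
  qed
  then show "G$1$2 = B$3$4 / 2" "G$3$4 = B$1$2 / 2" by auto
qed

text \<open>Every self-dual variation is the lift of a transverse one, so I along L + t
  \<open>lift d\<close> is evaluated on the slot B + t d, where it is 96 (s^2 - p^2).\<close>

lemma V_gradient_canonical:
  assumes L: "L \<in> sd0" and can: "canonical (slot0 L)"
    and G: "G \<in> trans0"
    and der: "V_grad V L G"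
  defines "B \<equiv> slot0 L"
  shows "G$1$3 = 0" "G$1$4 = 0" "G$1$5 = 0" "G$2$3 = 0" "G$2$4 = 0" "G$2$5 = 0" "G$3$5 = 0" "G$4$5 = 0"
    and "((\<lambda>t. V (24 * ((B$1$2 + t * \<alpha>)\<^sup>2 - (B$3$4 + t * \<beta>)\<^sup>2)\<^sup>2))
        has_real_derivative 2 * (\<alpha> * G$1$2 + \<beta> * G$3$4)) (at 0)"
proof -
  have I: "I_inv \<eta> (L + t *\<^sub>R lift d) = 96 * ((s_inv \<eta> (B + t *\<^sub>R d))\<^sup>2 - (p0 (B + t *\<^sub>R d))\<^sup>2)"
    if d: "d \<in> trans0" for t d
  proof -
    have "L + t *\<^sub>R lift d \<in> sd0"
      by (intro subspace_add subspace_scale subspace_self_dual L lift_self_dual d)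
    moreover have "slot0 (L + t *\<^sub>R lift d) = B + t *\<^sub>R d"
      using linear_slot[of \<eta> v0] slot_lift[OF d] by (simp add: linear_add linear_cmul B_def)
    ultimately show ?thesis using I_inv_minkowski by metis
  qed
  have line: "((\<lambda>t. V (96 * ((s_inv \<eta> (B + t *\<^sub>R d))\<^sup>2 - (p0 (B + t *\<^sub>R d))\<^sup>2)))
      has_real_derivative contr2 \<eta> G d) (at 0)" if d: "d \<in> trans0" for d
    using has_derivative_line[OF der subspace_self_dual L lift_self_dual[OF d]]
    by (simp add: I[OF d] slot_lift[OF d])
  note gc = gradient_canonical[OF can G, of "\<lambda>s p. V (96 * (s\<^sup>2 - p\<^sup>2))", folded B_def, OF line]
  show "G$1$3 = 0" "G$1$4 = 0" "G$1$5 = 0" "G$2$3 = 0" "G$2$4 = 0" "G$2$5 = 0" "G$3$5 = 0" "G$4$5 = 0"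
    using gc(1-8) by auto
  have "96 * (((x\<^sup>2 + y\<^sup>2) / 2)\<^sup>2 - (\<bar>x\<bar> * \<bar>y\<bar>)\<^sup>2) = 24 * (x\<^sup>2 - y\<^sup>2)\<^sup>2" for x y :: real
    by (simp add: power_mult_distrib power2_eq_square field_simps)
  then show "((\<lambda>t. V (24 * ((B$1$2 + t * \<alpha>)\<^sup>2 - (B$3$4 + t * \<beta>)\<^sup>2)\<^sup>2))
        has_real_derivative 2 * (\<alpha> * G$1$2 + \<beta> * G$3$4)) (at 0)"
    using gc(9)[of \<alpha> \<beta>] by simp
qed

lemma V_gradient_null:
  assumes L: "L \<in> sd0" and can: "canonical (slot0 L)"
    and G: "G \<in> trans0"
    and der: "V_grad V L G"
    and eq: "L$1$2$0 = L$3$4$0"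
  shows "G = 0"
proof -
  note vg = V_gradient_canonical[OF L can G der, unfolded slot_v0]
  have "2 * (G$1$2 - G$3$4) = 0"
    by (rule even_derivative[of "\<lambda>t. V (24 * ((L$3$4$0 + t * 1)\<^sup>2 - (L$3$4$0 + t * (- 1))\<^sup>2)\<^sup>2)"])
      (use vg(9)[of 1 "- 1"] eq in \<open>simp_all add: power2_commute\<close>)
  moreover have "2 * (G$1$2 + G$3$4) = 0"
    by (rule even_derivative[of "\<lambda>t. V (24 * ((L$3$4$0 + t * 1)\<^sup>2 - (L$3$4$0 + t * 1)\<^sup>2)\<^sup>2)"])
      (use vg(9)[of 1 1] eq in simp_all)
  ultimately show ?thesis
    using vg(1-8) by (intro transverse_eqI G subspace_0 subspace_transverse2) simp_all
qed

lemma V_gradient_sqrt: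
  assumes L: "L \<in> sd0" and can: "canonical (slot0 L)"
    and G: "G \<in> trans0"
    and der: "((\<lambda>L. k / 2 * sqrt (I_inv \<eta> L / 6)) has_derivative (\<lambda>D. contr2 \<eta> G (slot0 D)))
      (at L within sd0)"
  shows "G$1$2 = k * L$1$2$0" "G$3$4 = - k * L$3$4$0"
proof -
  let ?x = "L$1$2$0" and ?y = "L$3$4$0"
  have b: "0 \<le> ?y" "?y \<le> ?x" using can by (simp_all add: canonical_def slot_v0)
  have V: "k / 2 * sqrt (24 * u\<^sup>2 / 6) = k * \<bar>u\<bar>" for u
  proof -
    have "24 * u\<^sup>2 / 6 = (2 * u)\<^sup>2" by (simp add: power2_eq_square)
    then show ?thesis by (simp add: abs_mult real_sqrt_mult)
  qed
  note vg = V_gradient_canonical(9)[where V = "\<lambda>I. k / 2 * sqrt (I / 6)", OF L can G der, unfolded slot_v0 V]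
  have "G$1$2 = k * ?x \<and> G$3$4 = - k * ?y"
  proof (cases "?x = ?y")
    \<comment> \<open>At equal blocks the function is k |t| |2 y + t| along the plane 12.
      Differentiability forces k y = 0, and the claimed values then agree with G = 0.\<close>
    case True
    have "G = 0" by (rule V_gradient_null[where V = "\<lambda>I. k / 2 * sqrt (I / 6)", OF L can G der True])
    moreover have "\<bar>(?y + t)\<^sup>2 - ?y\<^sup>2\<bar> = \<bar>t\<bar> * \<bar>2 * ?y + t\<bar>" for t
      by (simp add: power2_eq_square algebra_simps flip: abs_mult)
    then have "((\<lambda>t. k * \<bar>t\<bar> * \<bar>2 * ?y + t\<bar>) has_real_derivative 2 * G$1$2) (at 0)"
      using vg[of 1 0] True by (simp add: mult.assoc)
    then have "k * \<bar>2 * ?y + 0\<bar> = 0" by (rule abs_not_differentiable) (auto intro!: continuous_intros)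
    ultimately show ?thesis using True by auto
  next
    case False
    then have "?y\<^sup>2 < ?x\<^sup>2" using b by (simp add: power_strict_mono)
    then have "((\<lambda>t. k * \<bar>(?x + t * \<alpha>)\<^sup>2 - (?y + t * \<beta>)\<^sup>2\<bar>) has_real_derivative k * (2 * \<alpha> * ?x - 2 * \<beta> * ?y)) (at 0)" for \<alpha> \<beta>
      by (intro DERIV_cmult abs_derivative_pos) (auto intro!: derivative_eq_intros)
    then have "2 * (\<alpha> * G$1$2 + \<beta> * G$3$4) = k * (2 * \<alpha> * ?x - 2 * \<beta> * ?y)" for \<alpha> \<beta>
      using DERIV_unique[OF vg] by blast
    from this[of 1 0] this[of 0 1] show ?thesis by (intro conjI; algebra)
  qed
  then show "G$1$2 = k * ?x" "G$3$4 = - k * ?y" by auto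
qed

section \<open>The INZ-type formulation\<close>

lemma linear_contr2: "linear (contr2 g G)" and contr2_linear_left: "linear (\<lambda>G. contr2 g G D)"
proof -
  have "linear (raise2 g)"
    by (rule linearI) (simp_all add: raise_tr vec_eq_iff tr2_add tr2_cmult)
  then show "linear (contr2 g G)"
    by (intro linearI) (simp_all add: contr2_def linear_add linear_cmul distrib_left sum.distrib
        sum_distrib_left mult.left_commute)
  show "linear (\<lambda>G. contr2 g G D)"
    by (intro linearI) (simp_all add: contr2_def distrib_right sum.distrib sum_distrib_left mult.assoc)
qed

lemma bounded_linear_contr2: "bounded_linear (contr2 g G)"
  using linear_contr2 linear_conv_bounded_linear by blast

lemma bilinear_contr2: "bounded_bilinear (contr2 g)"
  unfolding bilinear_conv_bounded_bilinear[symmetric] bilinear_def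
  using linear_contr2 contr2_linear_left by blast

section \<open>Covariance of the algebraic equations\<close>

context frame_change
begin

lemma transverse2_pull_back:
  assumes "B \<in> transverse2 (pull2 P g) (pull1 P v)" shows "pull2 Q B \<in> transverse2 g v"
  using frame_change.transverse2_pull[OF inverse_change assms] by (simp add: pull_inverse)

lemma self_dual_pull_back:
  assumes "L \<in> self_dual (pull2 P g)" shows "pull3 Q L \<in> self_dual g"
  using frame_change.self_dual_pull[OF inverse_change assms] by (simp add: pull_inverse)

lemma legendre_pair_pull:
  assumes "legendre_pair g v H B L"
  shows "legendre_pair (pull2 P g) (pull1 P v) H (pull2 P B) (pull3 P L)"
proof -
  obtain G where G: "G \<in> transverse2 g v" "2 *\<^sub>R G = - B - 2 *\<^sub>R slot g v L"
    and der: "((\<lambda>B. H (s_inv g B) (p_inv g v B)) has_derivative (\<lambda>D. contr2 g G D)) (at B within transverse2 g v)"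
    and BL: "B \<in> transverse2 g v" "L \<in> self_dual g"
    using assms by (auto simp: legendre_pair_def)
  let ?T = "transverse2 (pull2 P g) (pull1 P v)"
  have "(pull2 Q has_derivative pull2 Q) (at (pull2 P B) within ?T)"
    using linear_pull(2) by (simp add: linear_imp_has_derivative)
  moreover have "((\<lambda>B. H (s_inv g B) (p_inv g v B)) has_derivative (\<lambda>D. contr2 g G D))
      (at (pull2 Q (pull2 P B)) within pull2 Q ` ?T)"
    using der transverse2_pull_back by (auto simp: pull_inverse intro: has_derivative_subset)
  ultimately have "((\<lambda>B. H (s_inv g B) (p_inv g v B)) \<circ> pull2 Q has_derivative (\<lambda>D. contr2 g G D) \<circ> pull2 Q)
      (at (pull2 P B) within ?T)"
    by (rule diff_chain_within)
  moreover have "(\<lambda>B. H (s_inv g B) (p_inv g v B)) \<circ> pull2 Q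
      = (\<lambda>B. H (s_inv (pull2 P g) B) (p_inv (pull2 P g) (pull1 P v) B))"
    by (metis (no_types, lifting) comp_apply ext p_inv_pull pull_inverse(2) s_inv_pull)
  moreover have "(\<lambda>D. contr2 g G D) \<circ> pull2 Q = (\<lambda>D. contr2 (pull2 P g) (pull2 P G) D)"
    by (metis (no_types, lifting) comp_apply ext contr2_pull pull_inverse(2))
  moreover have "2 *\<^sub>R pull2 P G = - pull2 P B - 2 *\<^sub>R slot (pull2 P g) (pull1 P v) (pull3 P L)"
    using arg_cong[OF G(2), of "pull2 P"] linear_pull(2)[of P]
    by (simp add: slot_pull linear_cmul linear_diff linear_neg)
  ultimately show ?thesis
    using BL G by (auto simp: legendre_pair_def intro!: bexI[of _ "pull2 P G"] transverse2_pull self_dual_pull)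
qed

lemma inz_algebraic_eq_pull:
  assumes "inz_algebraic_eq g v V B L"
  shows "inz_algebraic_eq (pull2 P g) (pull1 P v) V (pull2 P B) (pull3 P L)"
proof -
  obtain G where G: "G \<in> transverse2 g v" "B = - slot g v L + G"
    and der: "((\<lambda>L. V (I_inv g L)) has_derivative (\<lambda>D. contr2 g G (slot g v D))) (at L within self_dual g)"
    and BL: "B \<in> transverse2 g v" "L \<in> self_dual g"
    using assms by (auto simp: inz_algebraic_eq_def)
  let ?T = "self_dual (pull2 P g)"
  have "(pull3 Q has_derivative pull3 Q) (at (pull3 P L) within ?T)"
    using linear_pull(3) by (simp add: linear_imp_has_derivative)
  moreover have "((\<lambda>L. V (I_inv g L)) has_derivative (\<lambda>D. contr2 g G (slot g v D)))
      (at (pull3 Q (pull3 P L)) within pull3 Q ` ?T)"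
    using der self_dual_pull_back by (auto simp: pull_inverse intro: has_derivative_subset)
  ultimately have "((\<lambda>L. V (I_inv g L)) \<circ> pull3 Q has_derivative (\<lambda>D. contr2 g G (slot g v D)) \<circ> pull3 Q)
      (at (pull3 P L) within ?T)"
    by (rule diff_chain_within)
  moreover have "(\<lambda>L. V (I_inv g L)) \<circ> pull3 Q = (\<lambda>L. V (I_inv (pull2 P g) L))"
    by (metis (no_types, lifting) comp_apply ext I_inv_pull pull_inverse(3))
  moreover have "(\<lambda>D. contr2 g G (slot g v D)) \<circ> pull3 Q
      = (\<lambda>D. contr2 (pull2 P g) (pull2 P G) (slot (pull2 P g) (pull1 P v) D))"
    by (metis (no_types, lifting) comp_apply ext contr2_pull slot_pull pull_inverse(3))
  moreover have "pull2 P B = - slot (pull2 P g) (pull1 P v) (pull3 P L) + pull2 P G"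
    using linear_pull(2)[of P] by (simp add: G(2) slot_pull linear_add linear_neg linear_diff)
  ultimately show ?thesis
    using BL G(1) transverse2_pull[OF BL(1)] by (auto simp: inz_algebraic_eq_def intro!: bexI[of _ "pull2 P G"] transverse2_pull self_dual_pull)
qed

lemma inz_hamiltonian_pull:
  "inz_hamiltonian (pull2 P g) (pull1 P v) V (pull2 P B) (pull3 P L) = inz_hamiltonian g v V B L"
  using linear_pull(2)[of P]
  by (simp add: inz_hamiltonian_def slot_pull I_inv_pull contr2_pull flip: linear_add)

end

lemma self_dual_three_forms: "L \<in> self_dual g \<Longrightarrow> L \<in> three_forms"
  by (simp add: self_dual_def)

section \<open>The algebraic equation at a normal form\<close>

text \<open>The frame is adapted to the auxiliary field and not to B: the gradient of V is known at
  a normal form of \<Lambda>, and the algebraic equation then produces B.\<close>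

lemma inz_canonical:
  assumes "lorentzian g" "unit_timelike g v" "inz_algebraic_eq g v V B L"
  shows "\<exists>P Q. frame_change P Q g \<and> pull2 P g = \<eta> \<and> pull1 P v = v0 \<and>
    canonical (slot0 (pull3 P L)) \<and> inz_algebraic_eq \<eta> v0 V (pull2 P B) (pull3 P L)"
proof -
  have "L \<in> self_dual g" using assms(3) by (simp add: inz_algebraic_eq_def)
  then have "slot g v L \<in> transverse2 g v" by (intro slot_transverse2 self_dual_three_forms)
  then obtain P Q where fc: "frame_change P Q g" and P: "pull2 P g = \<eta>" "pull1 P v = v0"
    and can: "canonical (pull2 P (slot g v L))"
    using canonical_frame[OF assms(1,2)] by blast
  show ?thesis
    using fc P can frame_change.slot_pull[OF fc, of v L] frame_change.inz_algebraic_eq_pull[OF fc assms(3)]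
    by metis
qed

text \<open>The parameter k covers both cases of \<open>V_lim\<close> (k = 1 and k = -1) and
  \<open>V_MM\<close> (k = -tanh (\<gamma>/2)). Here x and y are the blocks of \<Lambda>, while B
  has the blocks -(1 - k) x and -(1 + k) y.\<close>

lemma inz_sqrt:
  assumes "lorentzian g" "unit_timelike g v" "inz_algebraic_eq g v (\<lambda>I. k / 2 * sqrt (I / 6)) B L"
  shows "\<exists>x y. 0 \<le> y \<and> y \<le> x \<and> s_inv g B = (((1 - k) * x)\<^sup>2 + ((1 + k) * y)\<^sup>2) / 2 \<and>
    p_inv g v B = \<bar>(1 - k) * x\<bar> * \<bar>(1 + k) * y\<bar> \<and>
    inz_hamiltonian g v (\<lambda>I. k / 2 * sqrt (I / 6)) B L = (1 - k\<^sup>2) * (x\<^sup>2 + y\<^sup>2) / 2"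
proof -
  let ?V = "\<lambda>I. k / 2 * sqrt (I / 6)"
  obtain P Q where fc: "frame_change P Q g" and P: "pull2 P g = \<eta>" "pull1 P v = v0"
    and can: "canonical (slot0 (pull3 P L))"
    and inz: "inz_algebraic_eq \<eta> v0 ?V (pull2 P B) (pull3 P L)"
    using inz_canonical[OF assms] by blast
  define M C where "M = pull3 P L" and "C = pull2 P B"
  obtain G where G: "G \<in> trans0" and C: "C = - slot0 M + G"
    and der: "V_grad ?V M G"
    and CM: "C \<in> trans0" "M \<in> sd0"
    using inz by (auto simp: inz_algebraic_eq_def M_def C_def)
  have can': "canonical (slot0 M)" using can by (simp add: M_def)
  note z = V_gradient_canonical(1-8)[where V = ?V, OF CM(2) can' G der]
  note nz = V_gradient_sqrt[OF CM(2) can' G der]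
  define x y where "x = M$1$2$0" and "y = M$3$4$0"
  have xy: "0 \<le> y" "y \<le> x" using can' by (simp_all add: canonical_def x_def y_def slot_v0)
  have Mt: "slot0 M \<in> trans0" using can' by (simp add: canonical_def)
  have M0: "M$1$3$0 = 0" "M$1$4$0 = 0" "M$1$5$0 = 0" "M$2$3$0 = 0" "M$2$4$0 = 0" "M$2$5$0 = 0" "M$3$5$0 = 0" "M$4$5$0 = 0"
    using can' by (simp_all add: canonical_def slot_v0)
  have c: "C$1$3 = 0" "C$1$4 = 0" "C$1$5 = 0" "C$2$3 = 0" "C$2$4 = 0" "C$2$5 = 0" "C$3$5 = 0" "C$4$5 = 0"
    "C$1$2 = - ((1 - k) * x)" "C$3$4 = - ((1 + k) * y)"
    by (simp_all add: C slot_v0 z nz M0 x_def y_def algebra_simps)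
  have s: "s_inv \<eta> C = (((1 - k) * x)\<^sup>2 + ((1 + k) * y)\<^sup>2) / 2"
    and p: "p0 C = \<bar>(1 - k) * x\<bar> * \<bar>(1 + k) * y\<bar>"
    using canonical_s_p[OF CM(1) c(1-8)] unfolding c(9,10) by simp_all
  have "I_inv \<eta> M = 24 * (x\<^sup>2 - y\<^sup>2)\<^sup>2"
    unfolding I_inv_minkowski[OF CM(2)] canonical_s_p[OF Mt, unfolded slot_v0, OF M0] x_def y_def
    by (simp add: power_mult_distrib power2_eq_square field_simps)
  moreover have "24 * u\<^sup>2 / 6 = (2 * u)\<^sup>2" for u :: real
    by (simp add: power_mult_distrib)
  moreover have "y\<^sup>2 \<le> x\<^sup>2" using xy by (intro power_mono)
  ultimately have V: "?V (I_inv \<eta> M) = k * (x\<^sup>2 - y\<^sup>2)"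
    by (simp only: real_sqrt_abs) simp
  have "slot0 M + C = G" by (simp add: C)
  then have "inz_hamiltonian \<eta> v0 ?V C M = s_inv \<eta> C - contr2 \<eta> G G / 2 + k * (x\<^sup>2 - y\<^sup>2)"
    unfolding inz_hamiltonian_def V s_inv_def by simp
  also have "contr2 \<eta> G G / 2 = k\<^sup>2 * x\<^sup>2 + k\<^sup>2 * y\<^sup>2"
    unfolding contr2_transverse[OF G G] by (simp add: z nz x_def y_def power2_eq_square)
  finally have h: "inz_hamiltonian \<eta> v0 ?V C M = (1 - k\<^sup>2) * (x\<^sup>2 + y\<^sup>2) / 2"
    unfolding s by (simp add: power2_eq_square field_simps)
  show ?thesis
    using xy s p h frame_change.s_inv_pull[OF fc, of B] frame_change.p_inv_pull[OF fc, of v B]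
      frame_change.inz_hamiltonian_pull[OF fc, of v ?V B L] P
    unfolding C_def M_def by metis
qed

lemma inz_null:
  assumes "lorentzian g" "unit_timelike g v" "inz_algebraic_eq g v V B L" "I_inv g L = 0"
  shows "s_inv g B = p_inv g v B"
proof -
  obtain P Q where fc: "frame_change P Q g" and P: "pull2 P g = \<eta>" "pull1 P v = v0"
    and can: "canonical (slot0 (pull3 P L))"
    and inz: "inz_algebraic_eq \<eta> v0 V (pull2 P B) (pull3 P L)"
    using inz_canonical[OF assms(1-3)] by blast
  define M C where "M = pull3 P L" and "C = pull2 P B"
  obtain G where G: "G \<in> trans0" and C: "C = - slot0 M + G"
    and der: "V_grad V M G"
    and CM: "C \<in> trans0" "M \<in> sd0"
    using inz by (auto simp: inz_algebraic_eq_def M_def C_def)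
  have can': "canonical (slot0 M)" using can by (simp add: M_def)
  have Mt: "slot0 M \<in> trans0" using can' by (simp add: canonical_def)
  have M0: "M$1$3$0 = 0" "M$1$4$0 = 0" "M$1$5$0 = 0" "M$2$3$0 = 0" "M$2$4$0 = 0" "M$2$5$0 = 0" "M$3$5$0 = 0" "M$4$5$0 = 0"
    and b: "0 \<le> M$3$4$0" "M$3$4$0 \<le> M$1$2$0"
    using can' by (simp_all add: canonical_def slot_v0)
  have "I_inv \<eta> M = 24 * ((M$1$2$0)\<^sup>2 - (M$3$4$0)\<^sup>2)\<^sup>2"
    unfolding I_inv_minkowski[OF CM(2)] canonical_s_p[OF Mt, unfolded slot_v0, OF M0]
    by (simp add: power_mult_distrib power2_eq_square field_simps)
  moreover have "I_inv \<eta> M = 0"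
    using frame_change.I_inv_pull[OF fc, of L] assms(4) P by (simp add: M_def)
  ultimately have eq: "M$1$2$0 = M$3$4$0" using b by (simp add: power2_eq_iff_nonneg)
  have "C = - slot0 M" using V_gradient_null[OF CM(2) can' G der eq] C by simp
  then have c: "C$1$3 = 0" "C$1$4 = 0" "C$1$5 = 0" "C$2$3 = 0" "C$2$4 = 0" "C$2$5 = 0" "C$3$5 = 0" "C$4$5 = 0"
    "C$1$2 = - M$3$4$0" "C$3$4 = - M$3$4$0"
    by (simp_all add: slot_v0 M0 eq)
  have "s_inv \<eta> C = p0 C"
    unfolding canonical_s_p[OF CM(1) c(1-8)] c(9,10) by (simp add: power2_eq_square)
  then show ?thesis
    using frame_change.s_inv_pull[OF fc, of B] frame_change.p_inv_pull[OF fc, of v B] P by (simp add: C_def)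
qed

lemma s_p_canonical:
  assumes "lorentzian g" "unit_timelike g v" "B \<in> transverse2 g v"
  shows "\<exists>x y. 0 \<le> y \<and> y \<le> x \<and> s_inv g B = (x\<^sup>2 + y\<^sup>2) / 2 \<and> p_inv g v B = x * y"
proof -
  obtain P Q where fc: "frame_change P Q g" and P: "pull2 P g = \<eta>" "pull1 P v = v0"
    and can: "canonical (pull2 P B)"
    using canonical_frame[OF assms] by blast
  have "\<exists>x y. 0 \<le> y \<and> y \<le> x \<and> s_inv \<eta> C = (x\<^sup>2 + y\<^sup>2) / 2 \<and> p0 C = x * y"
    if "canonical C" for C
    using that canonical_s_p[of C] unfolding canonical_def
    by (intro exI[of _ "C$1$2"] exI[of _ "C$3$4"]) auto
  from this[OF can] show ?thesis
    using frame_change.s_inv_pull[OF fc, of B] frame_change.p_inv_pull[OF fc, of v B] P by simp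
qed

section \<open>The auxiliary field prescribed by H = p\<close>

lemma legendre_slot:
  assumes leg: "legendre_pair \<eta> v0 H_BB B L" and can: "canonical B"
  defines "S \<equiv> slot0 L"
  shows "S \<in> trans0"
    "S$1$3 = 0" "S$1$4 = 0" "S$1$5 = 0" "S$2$3 = 0" "S$2$4 = 0" "S$2$5 = 0" "S$3$5 = 0" "S$4$5 = 0"
    "S$1$2 = - (B$1$2 + B$3$4) / 2" "S$3$4 = - (B$1$2 + B$3$4) / 2"
proof -
  obtain G where G: "G \<in> trans0" "2 *\<^sub>R G = - B - 2 *\<^sub>R S"
    and der: "p_grad B G"
    and L: "L \<in> sd0"
    using leg by (auto simp: legendre_pair_def H_BB_def S_def)
  have S: "S $ i $ j = - B $ i $ j / 2 - G $ i $ j" for i j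
    using arg_cong[OF G(2), of "\<lambda>T. T $ i $ j"] by simp
  show "S \<in> trans0"
    unfolding S_def by (rule slot_transverse2[OF self_dual_three_forms[OF L]])
  show "S$1$3 = 0" "S$1$4 = 0" "S$1$5 = 0" "S$2$3 = 0" "S$2$4 = 0" "S$2$5 = 0" "S$3$5 = 0" "S$4$5 = 0"
    "S$1$2 = - (B$1$2 + B$3$4) / 2" "S$3$4 = - (B$1$2 + B$3$4) / 2"
    using can unfolding S p_gradient_canonical[OF can G(1) der] canonical_def by (simp_all add: field_simps)
qed

lemma legendre_canonical:
  assumes "lorentzian g" "unit_timelike g v" "B \<in> transverse2 g v"
  shows "\<exists>P Q. frame_change P Q g \<and> pull2 P g = \<eta> \<and> pull1 P v = v0 \<and> canonical (pull2 P B) \<and>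
    (\<forall>L. legendre_pair g v H_BB B L \<longrightarrow> legendre_pair \<eta> v0 H_BB (pull2 P B) (pull3 P L))"
proof -
  obtain P Q where fc: "frame_change P Q g" and P: "pull2 P g = \<eta>" "pull1 P v = v0"
    and can: "canonical (pull2 P B)"
    using canonical_frame[OF assms] by blast
  then show ?thesis using frame_change.legendre_pair_pull[OF fc, of v] by metis
qed

lemma legendre_I_zero:
  assumes "lorentzian g" "unit_timelike g v" "legendre_pair g v H_BB B L"
  shows "I_inv g L = 0"
proof -
  have "B \<in> transverse2 g v" using assms(3) by (simp add: legendre_pair_def)
  then obtain P Q where fc: "frame_change P Q g" and P: "pull2 P g = \<eta>"
    and can: "canonical (pull2 P B)" and leg: "legendre_pair \<eta> v0 H_BB (pull2 P B) (pull3 P L)"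
    using legendre_canonical[OF assms(1,2)] assms(3) by blast
  have L: "pull3 P L \<in> sd0" using leg by (simp add: legendre_pair_def)
  note S = legendre_slot[OF leg can]
  have "I_inv \<eta> (pull3 P L) = 0"
    unfolding I_inv_minkowski[OF L] canonical_s_p[OF S(1-9)] S(10,11) by (simp add: power2_eq_square)
  then show ?thesis using frame_change.I_inv_pull[OF fc, of L] P by simp
qed

text \<open>The frame depends on B alone, so both candidates are computed in the same frame and have
  the same slot there.\<close>

lemma legendre_unique:
  assumes "lorentzian g" "unit_timelike g v" "legendre_pair g v H_BB B L" "legendre_pair g v H_BB B L'"
  shows "L = L'"
proof -
  have "B \<in> transverse2 g v" using assms(3) by (simp add: legendre_pair_def)
  then obtain P Q where fc: "frame_change P Q g" and can: "canonical (pull2 P B)"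
    and leg: "legendre_pair \<eta> v0 H_BB (pull2 P B) (pull3 P L)"
     "legendre_pair \<eta> v0 H_BB (pull2 P B) (pull3 P L')"
    using legendre_canonical[OF assms(1,2)] assms(3,4) by blast
  note S = legendre_slot[OF leg(1) can] and S' = legendre_slot[OF leg(2) can]
  have "slot0 (pull3 P L) = slot0 (pull3 P L')"
    by (rule transverse_eqI[OF S(1) S'(1)]) (simp_all only: S(2-) S'(2-))
  moreover have "pull3 P L \<in> sd0" "pull3 P L' \<in> sd0"
    using leg by (auto simp: legendre_pair_def)
  ultimately have "pull3 P L = pull3 P L'" by (intro self_dual_eqI)
  then show ?thesis using frame_change.pull_inverse(6)[OF fc] by metis
qed

lemma contr2_inner_gradient:
  assumes "(f has_derivative (\<lambda>D. G \<bullet> D)) (at B within trans0)"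
    "B \<in> trans0" "G \<in> trans0"
  shows "(f has_derivative (\<lambda>D. contr2 \<eta> G D)) (at B within trans0)"
  using assms by (intro has_derivative_within_subspace_cong[OF assms(1) subspace_transverse2]
      bounded_linear_contr2) (simp_all add: transverse_inner)

text \<open>On transverse two-forms p is the square root of a polynomial, which is positive where p
  is nonzero.\<close>

lemma p_gradient_exists:
  assumes B: "B \<in> trans0" and p: "p0 B \<noteq> 0"
  shows "\<exists>G\<in>trans0. p_grad B G"
proof -
  define N where "N B = (pf B 2 3 4 5)\<^sup>2 + (pf B 1 3 4 5)\<^sup>2 + (pf B 1 2 4 5)\<^sup>2
    + (pf B 1 2 3 5)\<^sup>2 + (pf B 1 2 3 4)\<^sup>2" for B
  have pN: "p0 C = sqrt (N C)" if "C \<in> trans0" for C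
    unfolding N_def by (rule p_inv_minkowski[OF that])
  have "N B \<noteq> 0" using p pN[OF B] by auto
  moreover have "0 \<le> N B" by (simp add: N_def)
  ultimately have "0 < N B" by simp
  have comp: "(\<lambda>B::tensor2. B $ i $ j) differentiable (at B within S)" for i j S
    by (rule differentiableI, rule bounded_linear_imp_has_derivative,
        rule bounded_linear_compose[OF bounded_linear_vec_nth bounded_linear_vec_nth])
  have "N differentiable (at B within trans0)"
    unfolding N_def pf_def by (intro derivative_intros comp)
  then have "(\<lambda>B. sqrt (N B)) differentiable (at B within trans0)"
    by (rule differentiable_sqrt) (rule \<open>0 < N B\<close>)
  then obtain G where G: "G \<in> trans0"
    "((\<lambda>B. sqrt (N B)) has_derivative (\<lambda>D. G \<bullet> D)) (at B within trans0)"
    using gradient_exists[OF _ subspace_transverse2 B] by blast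
  from G(2) have "((\<lambda>B. p0 B) has_derivative (\<lambda>D. G \<bullet> D)) (at B within trans0)"
    by (rule has_derivative_transform[rotated 2]) (use B pN in auto)
  then show ?thesis using contr2_inner_gradient[OF _ B G(1)] G(1) by blast
qed

lemma legendre_exists:
  assumes "lorentzian g" "unit_timelike g v" "B \<in> transverse2 g v" "p_inv g v B \<noteq> 0"
  shows "\<exists>L. legendre_pair g v H_BB B L"
proof -
  obtain P Q where fc: "frame_change P Q g" and P: "pull2 P g = \<eta>" "pull1 P v = v0"
    using rest_frame[OF assms(1,2)] by blast
  interpret frame_change P Q g by (rule fc)
  define C where "C = pull2 P B"
  have C: "C \<in> trans0" using transverse2_pull[OF assms(3)] P by (simp add: C_def)
  moreover have "p0 C \<noteq> 0" using p_inv_pull[of v B] assms(4) P by (simp add: C_def)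
  ultimately obtain G where G: "G \<in> trans0"
    and der: "p_grad C G"
    using p_gradient_exists by blast
  define S where "S = (- 1 / 2) *\<^sub>R C - G"
  have S: "S \<in> trans0"
    unfolding S_def by (intro subspace_diff subspace_scale subspace_transverse2 C G)
  have "legendre_pair \<eta> v0 H_BB C (lift S)"
    unfolding legendre_pair_def H_BB_def slot_lift[OF S]
    using C G der lift_self_dual[OF S] by (intro conjI bexI[of _ G]) (auto simp: S_def algebra_simps)
  then have "legendre_pair (pull2 Q (pull2 P g)) (pull1 Q (pull1 P v)) H_BB (pull2 Q C) (pull3 Q (lift S))"
    using frame_change.legendre_pair_pull[OF inverse_change, of v0 H_BB C "lift S"] P by simp
  then show ?thesis unfolding C_def pull_inverse by blast
qed

lemma contr2_commute:
  assumes "lorentzian g" shows "contr2 g S T = contr2 g T S"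
proof -
  obtain P Q where fc: "frame_change P Q g" and P: "pull2 P g = \<eta>"
    using minkowski_frame[OF assms] by blast
  have "contr2 \<eta> S T = contr2 \<eta> T S" for S T
    by (simp add: contr2_def raise_minkowski mult_ac)
  then show ?thesis using frame_change.contr2_pull[OF fc] P by metis
qed

text \<open>The variation of the auxiliary field drops out by its own equation, so the derivative of the
  eliminated Lagrangian is the explicit one.\<close>

lemma inz_yields_legendre:
  assumes lor: "lorentzian g" and U: "openin (top_of_set (transverse2 g v)) U" "B \<in> U"
    and L: "L differentiable_on U"
    and eq: "\<And>B. B \<in> U \<Longrightarrow> inz_algebraic_eq g v V B (L B)"
    and H: "\<And>B. B \<in> U \<Longrightarrow> inz_hamiltonian g v V B (L B) = H (s_inv g B) (p_inv g v B)"
  shows "legendre_pair g v H B (L B)"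
proof -
  obtain T where T: "open T" "U = transverse2 g v \<inter> T" using U(1) by (auto simp: openin_open)
  obtain L' where L': "(L has_derivative L') (at B within U)"
    using L U(2) by (auto simp: differentiable_on_def differentiable_def)
  obtain G where G: "G \<in> transverse2 g v" "B = - slot g v (L B) + G"
    and der: "((\<lambda>L. V (I_inv g L)) has_derivative (\<lambda>D. contr2 g G (slot g v D))) (at (L B) within self_dual g)"
    and BL: "B \<in> transverse2 g v" "L B \<in> self_dual g"
    using eq[OF U(2)] by (auto simp: inz_algebraic_eq_def)
  \<comment> \<open>V(I) has a derivative within the self-dual forms only, so the chain rule needs
    the branch to stay there.\<close>
  have "L ` U \<subseteq> self_dual g" using eq by (auto simp: inz_algebraic_eq_def)
  then have "((\<lambda>L. V (I_inv g L)) \<circ> L has_derivative (\<lambda>D. contr2 g G (slot g v D)) \<circ> L') (at B within U)"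
    by (intro diff_chain_within L' has_derivative_subset[OF der])
  then have V: "((\<lambda>B. V (I_inv g (L B))) has_derivative (\<lambda>D. contr2 g G (slot g v (L' D)))) (at B within U)"
    by (simp add: o_def)
  note bil = bilinear_contr2[of g]
  have "(slot g v has_derivative slot g v) (at (L B) within L ` U)"
    by (rule linear_imp_has_derivative[OF linear_slot])
  from diff_chain_within[OF L' this]
  have s: "((\<lambda>B. slot g v (L B)) has_derivative (\<lambda>D. slot g v (L' D))) (at B within U)" by (simp add: o_def)
  let ?N = "\<lambda>D. contr2 g (- (1 / 2) *\<^sub>R B - slot g v (L B)) D"
  \<comment> \<open>This is the cancellation: the gradient of V equals \<Lambda> + B, so the two
    contributions of \<open>L'\<close> to the derivative of the Hamiltonian are opposite.\<close>
  have GL: "G = slot g v (L B) + B" using G(2) by (simp add: algebra_simps)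
  have "((\<lambda>B. inz_hamiltonian g v V B (L B)) has_derivative ?N) (at B within U)"
  proof -
    have sB: "((\<lambda>B. slot g v (L B) + B) has_derivative (\<lambda>D. slot g v (L' D) + D)) (at B within U)"
      by (intro has_derivative_add s has_derivative_ident)
    have "((\<lambda>B. inz_hamiltonian g v V B (L B)) has_derivative
        (\<lambda>D. (contr2 g B D + contr2 g D B) / 4
          - (contr2 g (slot g v (L B) + B) (slot g v (L' D) + D) + contr2 g (slot g v (L' D) + D) (slot g v (L B) + B)) / 2
          + contr2 g G (slot g v (L' D)))) (at B within U)"
      unfolding inz_hamiltonian_def
      by (intro has_derivative_add has_derivative_diff V bounded_linear.has_derivative[OF bounded_linear_divide]
          bounded_bilinear.FDERIV[OF bil] sB has_derivative_ident)
    moreover have "(contr2 g B D + contr2 g D B) / 4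
          - (contr2 g (slot g v (L B) + B) (slot g v (L' D) + D) + contr2 g (slot g v (L' D) + D) (slot g v (L B) + B)) / 2
          + contr2 g G (slot g v (L' D)) = ?N D" for D
    proof -
      have "contr2 g D B = contr2 g B D"
        "contr2 g (slot g v (L' D) + D) (slot g v (L B) + B) = contr2 g (slot g v (L B) + B) (slot g v (L' D) + D)"
        by (rule contr2_commute[OF lor])+
      then show ?thesis
        unfolding GL
        by (simp add: bounded_bilinear.add_left[OF bil] bounded_bilinear.add_right[OF bil]
            bounded_bilinear.diff_left[OF bil] bounded_bilinear.minus_left[OF bil]
            bounded_bilinear.scaleR_left[OF bil] field_simps)
    qed
    ultimately show ?thesis by simp
  qed
  then have "((\<lambda>B. H (s_inv g B) (p_inv g v B)) has_derivative ?N) (at B within U)"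
    by (rule has_derivative_transform[rotated 2]) (use U H in auto)
  \<comment> \<open>U is relatively open, so the derivative along U is a derivative along all
    transverse two-forms, as \<open>legendre_pair\<close> requires.\<close>
  moreover have "at B within U = at B within transverse2 g v"
    using T U(2) by (intro at_within_nhd[of _ T]) auto
  moreover have "- (1 / 2) *\<^sub>R B - slot g v (L B) \<in> transverse2 g v"
    by (intro subspace_diff subspace_scale subspace_transverse2 slot_transverse2 BL self_dual_three_forms[of _ g])
  ultimately show ?thesis
    using BL by (auto simp: legendre_pair_def algebra_simps intro!: bexI[of _ "- (1 / 2) *\<^sub>R B - slot g v (L B)"])
qed

lemma vol_pos: assumes "lorentzian g" shows "0 < vol g" "vol g * vol g = - det g"
proof -
  obtain P where P: "transpose P ** g ** P = \<eta>" using assms by (auto simp: lorentzian_def)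
  have "det (transpose P ** g ** P) = - 1" unfolding P by (rule det_minkowski)
  then have e: "(det P)\<^sup>2 * det g = - 1" by (simp add: det_mul power2_eq_square mult_ac)
  then have "det g < 0"
    by (metis linorder_not_less mult_nonneg_nonneg neg_0_le_iff_le not_one_le_zero zero_le_power2)
  then show "0 < vol g" "vol g * vol g = - det g" by (simp_all add: vol_def)
qed

lemma not_inz_yields_H_BB:
  assumes lor: "lorentzian g" "unit_timelike g v"
    and U: "openin (top_of_set (transverse2 g v)) U" "U \<noteq> {}"
  shows "\<not> inz_yields g v V H_BB U"
proof
  assume "inz_yields g v V H_BB U"
  then obtain L where L: "L differentiable_on U" and eq: "\<And>B. B \<in> U \<Longrightarrow> inz_algebraic_eq g v V B (L B)"
    and lag: "\<And>B E. B \<in> U \<Longrightarrow> E \<in> transverse2 g v \<Longrightarrow> inz_lagrangian g v V E B (L B) = pst_lagrangian g v H_BB E B"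
    unfolding inz_yields_def by blast
  \<comment> \<open>Both Lagrangians contain the same term in E, so the choice E = 0 isolates the
    Hamiltonians.\<close>
  have ham: "inz_hamiltonian g v V B (L B) = H_BB (s_inv g B) (p_inv g v B)" if "B \<in> U" for B
  proof -
    have "0 \<in> transverse2 g v" by (simp add: subspace_0 subspace_transverse2)
    moreover have "contr2 g 0 B = 0" "contr2 g (- B) B = - contr2 g B B"
      using contr2_linear_left[of g B] linear_0 linear_neg by blast+
    ultimately have "vol g * (- inz_hamiltonian g v V B (L B)) = vol g * (- H_BB (s_inv g B) (p_inv g v B))"
      using lag[OF that, of 0]
      by (simp add: inz_lagrangian_def pst_lagrangian_def inz_hamiltonian_def add.commute algebra_simps)
    then show ?thesis using vol_pos(1)[OF lor(1)] by simp
  qed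
  have sp: "s_inv g B = p_inv g v B" if "B \<in> U" for B
    using inz_null[OF lor eq[OF that]] legendre_I_zero[OF lor inz_yields_legendre[OF lor(1) U(1) that L eq ham]]
    by blast
  obtain B where B: "B \<in> U" using U(2) by blast
  obtain T where T: "open T" "U = transverse2 g v \<inter> T" using U(1) by (auto simp: openin_open)
  obtain P Q where fc: "frame_change P Q g" and P: "pull2 P g = \<eta>" "pull1 P v = v0"
    and can: "canonical (pull2 P B)"
    using canonical_frame[OF lor, of B] B T by blast
  interpret frame_change P Q g by (rule fc)
  \<comment> \<open>The set s = p has no relative interior: in a normal form s - p = (x - y)^2 / 2,
    and this direction enlarges the larger block, so the difference becomes positive for every t >
    0.\<close>
  let ?d = "plane 1 2"
  have d: "?d \<in> trans0" by (rule plane_transverse) auto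
  then have Qd: "pull2 Q ?d \<in> transverse2 g v" using transverse2_pull_back[of ?d v] P by simp
  have "((\<lambda>t::real. B + t *\<^sub>R pull2 Q ?d) \<longlongrightarrow> B) (at_right 0)"
    by (auto intro!: tendsto_eq_intros)
  moreover have "B \<in> T" using B T by simp
  ultimately have "\<forall>\<^sub>F t in at_right 0. B + t *\<^sub>R pull2 Q ?d \<in> T" using T(1) topological_tendstoD by blast
  then have "\<forall>\<^sub>F t in at_right 0. (0::real) < t \<and> B + t *\<^sub>R pull2 Q ?d \<in> T"
    using eventually_at_right_less[of 0] by eventually_elim simp
  then obtain t :: real where t: "0 < t" "B + t *\<^sub>R pull2 Q ?d \<in> T"
    using eventually_happens trivial_limit_at_right_real by blast
  have "B + t *\<^sub>R pull2 Q ?d \<in> transverse2 g v"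
    using B T Qd by (intro subspace_add subspace_scale subspace_transverse2) auto
  then have "s_inv g (B + t *\<^sub>R pull2 Q ?d) = p_inv g v (B + t *\<^sub>R pull2 Q ?d)"
    using sp t T by blast
  moreover define C where "C = pull2 P B"
  moreover have "pull2 P (B + t *\<^sub>R pull2 Q ?d) = pull2 P B + t *\<^sub>R ?d"
    using linear_pull(2)[of P] by (simp add: linear_add linear_cmul pull_inverse)
  ultimately have spt: "s_inv \<eta> (C + t *\<^sub>R ?d) = p0 (C + t *\<^sub>R ?d)"
    using s_inv_pull[of "B + t *\<^sub>R pull2 Q ?d"] p_inv_pull[of v "B + t *\<^sub>R pull2 Q ?d"] P by simp
  have C: "C \<in> trans0" and c: "C$1$3 = 0" "C$1$4 = 0" "C$1$5 = 0" "C$2$3 = 0" "C$2$4 = 0"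
    "C$2$5 = 0" "C$3$5 = 0" "C$4$5 = 0" "0 \<le> C$3$4" "C$3$4 \<le> C$1$2"
    using can by (simp_all add: canonical_def C_def)
  have Ct: "C + t *\<^sub>R ?d \<in> trans0"
    by (intro subspace_add subspace_scale subspace_transverse2 C d)
  have "((C$1$2 + t)\<^sup>2 + (C$3$4)\<^sup>2) / 2 = \<bar>C$1$2 + t\<bar> * \<bar>C$3$4\<bar>"
    using spt canonical_s_p[OF Ct] c by (simp add: plane_def)
  then have "(C$1$2 + t - C$3$4)\<^sup>2 = 0" using c t(1) by (simp add: power2_eq_square algebra_simps)
  then show False using c t(1) by simp
qed

section \<open>Bianchi identities\<close>

lemma derivative_along:
  fixes f :: "'a::real_normed_vector \<Rightarrow> real"
  assumes "(f has_derivative f') (at (z + t *\<^sub>R u))"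
  shows "((\<lambda>t. f (z + t *\<^sub>R u)) has_real_derivative f' u) (at t)"
proof -
  have "((\<lambda>t. z + t *\<^sub>R u) has_derivative (\<lambda>t. t *\<^sub>R u)) (at t)"
    by (auto intro!: derivative_eq_intros)
  from diff_chain_at[OF this assms]
  have "((\<lambda>t. f (z + t *\<^sub>R u)) has_derivative (\<lambda>t. f' (t *\<^sub>R u))) (at t)" by (simp add: o_def)
  moreover have "f' (t *\<^sub>R u) = f' u * t" for t
    using has_derivative_linear[OF assms] by (simp add: linear_cmul)
  ultimately show ?thesis by (simp add: has_field_derivative_def mult_commute_abs)
qed

text \<open>The mean value theorem twice: along u for the increment of f in the direction v, then
  along v for the derivative of f in the direction u.\<close>

lemma second_difference:
  fixes f :: "'a::real_normed_vector \<Rightarrow> real"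
  assumes f: "\<And>y. y \<in> U \<Longrightarrow> (f has_derivative Df y) (at y)"
    and u: "\<And>y. y \<in> U \<Longrightarrow> ((\<lambda>y. Df y u) has_derivative Du y) (at y)"
    and h: "0 < h" "\<And>s t. 0 \<le> s \<Longrightarrow> s \<le> h \<Longrightarrow> 0 \<le> t \<Longrightarrow> t \<le> h \<Longrightarrow> x + s *\<^sub>R u + t *\<^sub>R v \<in> U"
  shows "\<exists>s t. 0 \<le> s \<and> s \<le> h \<and> 0 \<le> t \<and> t \<le> h \<and>
    f (x + h *\<^sub>R u + h *\<^sub>R v) - f (x + h *\<^sub>R u) - f (x + h *\<^sub>R v) + f x = h * (h * Du (x + s *\<^sub>R u + t *\<^sub>R v) v)"
proof -
  define \<phi> where "\<phi> s = f (x + h *\<^sub>R v + s *\<^sub>R u) - f (x + s *\<^sub>R u)" for s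
  have in_U: "x + h *\<^sub>R v + s *\<^sub>R u \<in> U" "x + s *\<^sub>R u \<in> U" if "0 \<le> s" "s \<le> h" for s
    using h(2)[OF that, of h] h(2)[OF that, of 0] h(1) by (simp_all add: add_ac)
  have d1: "(\<phi> has_real_derivative Df (x + h *\<^sub>R v + s *\<^sub>R u) u - Df (x + s *\<^sub>R u) u) (at s)"
    if "0 \<le> s" "s \<le> h" for s
    unfolding \<phi>_def by (intro derivative_intros derivative_along f in_U that)
  obtain s where s: "0 < s" "s < h"
    "\<phi> h - \<phi> 0 = (h - 0) * (Df (x + h *\<^sub>R v + s *\<^sub>R u) u - Df (x + s *\<^sub>R u) u)"
    using MVT2[OF h(1) d1] by blast
  define \<psi> where "\<psi> t = Df (x + s *\<^sub>R u + t *\<^sub>R v) u" for t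
  have d2: "(\<psi> has_real_derivative Du (x + s *\<^sub>R u + t *\<^sub>R v) v) (at t)" if "0 \<le> t" "t \<le> h" for t
    unfolding \<psi>_def using s that by (intro derivative_along[of "\<lambda>y. Df y u"] u h(2)) auto
  obtain t where t: "0 < t" "t < h" "\<psi> h - \<psi> 0 = (h - 0) * Du (x + s *\<^sub>R u + t *\<^sub>R v) v"
    using MVT2[OF h(1) d2] by blast
  have "f (x + h *\<^sub>R u + h *\<^sub>R v) - f (x + h *\<^sub>R u) - f (x + h *\<^sub>R v) + f x = \<phi> h - \<phi> 0"
    by (simp add: \<phi>_def add_ac)
  also have "\<dots> = h * (\<psi> h - \<psi> 0)" using s(3) by (simp add: \<psi>_def add_ac)
  finally show ?thesis using s t by (intro exI[of _ s] exI[of _ t]) auto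
qed

text \<open>The second difference is symmetric in u and v. Its two mean value forms evaluate the
  mixed derivatives at points arbitrarily close to x, and continuity at x does the rest. The form
  with fixed directions fits \<open>ck_on\<close>, which iterates partial derivatives.\<close>

lemma mixed_partials:
  fixes f :: "'a::real_normed_vector \<Rightarrow> real"
  assumes U: "open U" "x \<in> U"
    and f: "\<And>y. y \<in> U \<Longrightarrow> (f has_derivative Df y) (at y)"
    and u: "\<And>y. y \<in> U \<Longrightarrow> ((\<lambda>y. Df y u) has_derivative Du y) (at y)"
    and v: "\<And>y. y \<in> U \<Longrightarrow> ((\<lambda>y. Df y v) has_derivative Dv y) (at y)"
    and cont: "isCont (\<lambda>y. Du y v) x" "isCont (\<lambda>y. Dv y u) x"
  shows "Du x v = Dv x u"
proof (rule ccontr)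
  assume ne: "Du x v \<noteq> Dv x u"
  define e where "e = \<bar>Du x v - Dv x u\<bar> / 2"
  have "0 < e" using ne by (simp add: e_def)
  then obtain d1 d2 where d: "0 < d1" "\<And>y. dist y x < d1 \<Longrightarrow> dist (Du y v) (Du x v) < e"
    "0 < d2" "\<And>y. dist y x < d2 \<Longrightarrow> dist (Dv y u) (Dv x u) < e"
    using cont unfolding continuous_at_eps_delta by metis
  obtain d3 where d3: "0 < d3" "ball x d3 \<subseteq> U" using U openE by blast
  define r where "r = min d1 (min d2 d3)"
  have r: "0 < r" using d d3 by (simp add: r_def)
  \<comment> \<open>Small enough for the whole parallelogram spanned by h u and h v to stay within r
    of x.\<close>
  define h where "h = r / (2 * (norm u + norm v + 1))"
  have n: "0 < norm u + norm v + 1" by (simp add: add_nonneg_pos)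
  have h: "0 < h" using r n by (simp add: h_def)
  have near: "dist (x + s *\<^sub>R u + t *\<^sub>R v) x < r" if "0 \<le> s" "s \<le> h" "0 \<le> t" "t \<le> h" for s t
  proof -
    have "dist (x + s *\<^sub>R u + t *\<^sub>R v) x = norm (s *\<^sub>R u + t *\<^sub>R v)" by (simp add: dist_norm)
    also have "\<dots> \<le> s * norm u + t * norm v" using that norm_triangle_ineq[of "s *\<^sub>R u" "t *\<^sub>R v"] by simp
    also have "\<dots> \<le> h * norm u + h * norm v" using that by (intro add_mono mult_right_mono) auto
    also have "\<dots> \<le> h * (norm u + norm v + 1)" using h by (simp add: algebra_simps)
    also have "\<dots> = r / 2" using n by (simp add: h_def field_simps)
    finally show ?thesis using r by simp
  qed
  have in_U: "x + s *\<^sub>R u + t *\<^sub>R v \<in> U" if "0 \<le> s" "s \<le> h" "0 \<le> t" "t \<le> h" for s t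
    using near[OF that] d3 by (auto simp: r_def dist_commute)
  obtain s t where st: "0 \<le> s" "s \<le> h" "0 \<le> t" "t \<le> h"
    "f (x + h *\<^sub>R u + h *\<^sub>R v) - f (x + h *\<^sub>R u) - f (x + h *\<^sub>R v) + f x = h * (h * Du (x + s *\<^sub>R u + t *\<^sub>R v) v)"
    using second_difference[OF f u h in_U] by blast
  have in_U': "x + s *\<^sub>R v + t *\<^sub>R u \<in> U" if "0 \<le> s" "s \<le> h" "0 \<le> t" "t \<le> h" for s t
    using in_U[OF that(3,4,1,2)] by (simp add: add_ac)
  obtain t' s' where st': "0 \<le> t'" "t' \<le> h" "0 \<le> s'" "s' \<le> h"
    "f (x + h *\<^sub>R v + h *\<^sub>R u) - f (x + h *\<^sub>R v) - f (x + h *\<^sub>R u) + f x = h * (h * Dv (x + t' *\<^sub>R v + s' *\<^sub>R u) u)"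
    using second_difference[OF f v h in_U'] by blast
  have e: "x + h *\<^sub>R v + h *\<^sub>R u = x + h *\<^sub>R u + h *\<^sub>R v" "x + t' *\<^sub>R v + s' *\<^sub>R u = x + s' *\<^sub>R u + t' *\<^sub>R v"
    by (simp_all add: add_ac)
  have "h * (h * Du (x + s *\<^sub>R u + t *\<^sub>R v) v) = h * (h * Dv (x + s' *\<^sub>R u + t' *\<^sub>R v) u)"
    using st(5) st'(5)[unfolded e] by linarith
  then have "Du (x + s *\<^sub>R u + t *\<^sub>R v) v = Dv (x + s' *\<^sub>R u + t' *\<^sub>R v) u" using h by simp
  moreover have "dist (Du (x + s *\<^sub>R u + t *\<^sub>R v) v) (Du x v) < e"
    using near[OF st(1-4)] by (intro d) (simp add: r_def)
  moreover have "dist (Dv (x + s' *\<^sub>R u + t' *\<^sub>R v) u) (Dv x u) < e"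
    using near[OF st'(3,4,1,2)] by (intro d) (simp add: r_def)
  ultimately show False by (simp add: dist_real_def e_def abs_if split: if_splits)
qed

lemma partial_eq: "(f has_derivative f') (at x) \<Longrightarrow> partial \<mu> f x = f' (axis \<mu> 1)"
  by (simp add: partial_def frechet_derivative_at[symmetric])

lemma bounded_linear_component2: "bounded_linear (\<lambda>T::'a::real_normed_vector^6^6. T $ i $ j)"
  by (rule bounded_linear_compose[OF bounded_linear_vec_nth bounded_linear_vec_nth])

lemma bounded_linear_component3: "bounded_linear (\<lambda>T::tensor3. T $ i $ j $ k)"
  by (rule bounded_linear_compose[OF bounded_linear_vec_nth bounded_linear_component2])

section \<open>The metric-free dual and the Bianchi identity\<close>

text \<open>The Hodge dual with upper indices, up to the factor in \<open>inner_eps3\<close>. It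
  involves no metric, so it commutes with coordinate derivatives and the Bianchi identities hold
  without derivatives of the metric.\<close>

definition eps3 :: "tensor3 \<Rightarrow> tensor3" where
  "eps3 X = (\<chi> \<mu> \<nu> \<rho>. \<Sum>\<^sub>u\<sigma> \<tau> \<kappa>. eps \<mu> \<nu> \<rho> \<sigma> \<tau> \<kappa> * X $ \<sigma> $ \<tau> $ \<kappa>)"

lemma linear_eps3: "linear eps3"
  by (rule linearI) (simp_all add: eps3_def vec_eq_iff distrib_left sum.distrib sum_distrib_left mult.left_commute)

lemma eps3_three_forms: "eps3 X \<in> three_forms"
proof -
  have "eps3 X $ b $ a $ c = - eps3 X $ a $ b $ c" for a b c
    unfolding eps3_def vec_lambda_beta by (subst eps_swap(1)) (simp add: sum_negf)
  moreover have "eps3 X $ a $ c $ b = - eps3 X $ a $ b $ c" for a b c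
    unfolding eps3_def vec_lambda_beta by (subst eps_swap(2)) (simp add: sum_negf)
  ultimately show ?thesis unfolding three_forms_def mem_Collect_eq by blast
qed

lemma inner_tensor3: "S \<bullet> T = (\<Sum>\<^sub>u\<mu> \<nu> \<rho>. S $ \<mu> $ \<nu> $ \<rho> * T $ \<mu> $ \<nu> $ \<rho>)" for S T :: tensor3
  by (simp add: inner_vec_def)

text \<open>Moving three indices past three others takes nine transpositions, an odd number.\<close>

lemma eps_block: "eps l m n i j k = - eps i j k l m n"
proof -
  have "eps l m n i j k = - eps i l m n j k"
    by (simp only: eps_swap(3)[of l m n i j k] eps_swap(2)[of l m i n j k] eps_swap(1)[of l i m n j k] minus_minus)
  also have "eps i l m n j k = - eps i j l m n k"
    by (simp only: eps_swap(4)[of i l m n j k] eps_swap(3)[of i l m j n k] eps_swap(2)[of i l j m n k] minus_minus)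
  also have "eps i j l m n k = - eps i j k l m n"
    by (simp only: eps_swap(5)[of i j l m n k] eps_swap(4)[of i j l m k n] eps_swap(3)[of i j l k m n] minus_minus)
  finally show ?thesis by simp
qed

lemma sum_swap_pairs:
  "(\<Sum>a\<in>A. \<Sum>b\<in>B. \<Sum>c\<in>C. \<Sum>d\<in>D. t a b c d) = (\<Sum>c\<in>C. \<Sum>d\<in>D. \<Sum>a\<in>A. \<Sum>b\<in>B. t a b c d)"
proof -
  have "(\<Sum>a\<in>A. \<Sum>b\<in>B. \<Sum>c\<in>C. \<Sum>d\<in>D. t a b c d) = (\<Sum>a\<in>A. \<Sum>c\<in>C. \<Sum>d\<in>D. \<Sum>b\<in>B. t a b c d)"
    by (rule sum.cong[OF refl sum_rotate3])
  then show ?thesis by (simp only: sum_rotate3[of _ D C A])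
qed

lemma sum_rotate4: "(\<Sum>d\<in>D. \<Sum>a\<in>A. \<Sum>b\<in>B. \<Sum>c\<in>C. g d a b c) = (\<Sum>a\<in>A. \<Sum>b\<in>B. \<Sum>c\<in>C. \<Sum>d\<in>D. g d a b c)"
  by (subst sum.swap, rule sum.cong[OF refl], rule sum_rotate3)

lemma sum_swap_triples:
  "(\<Sum>a\<in>A. \<Sum>b\<in>B. \<Sum>c\<in>C. \<Sum>d\<in>D. \<Sum>e\<in>E. \<Sum>f\<in>F. t a b c d e f)
   = (\<Sum>d\<in>D. \<Sum>e\<in>E. \<Sum>f\<in>F. \<Sum>a\<in>A. \<Sum>b\<in>B. \<Sum>c\<in>C. t a b c d e f)"
proof -
  have "(\<Sum>d\<in>D. \<Sum>e\<in>E. \<Sum>f\<in>F. \<Sum>a\<in>A. \<Sum>b\<in>B. \<Sum>c\<in>C. t a b c d e f)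
     = (\<Sum>d\<in>D. \<Sum>e\<in>E. \<Sum>a\<in>A. \<Sum>b\<in>B. \<Sum>c\<in>C. \<Sum>f\<in>F. t a b c d e f)"
    by (intro sum.cong refl sum_rotate4)
  also have "\<dots> = (\<Sum>d\<in>D. \<Sum>a\<in>A. \<Sum>b\<in>B. \<Sum>c\<in>C. \<Sum>e\<in>E. \<Sum>f\<in>F. t a b c d e f)"
    by (intro sum.cong refl sum_rotate4)
  also have "\<dots> = (\<Sum>a\<in>A. \<Sum>b\<in>B. \<Sum>c\<in>C. \<Sum>d\<in>D. \<Sum>e\<in>E. \<Sum>f\<in>F. t a b c d e f)" by (rule sum_rotate4)
  finally show ?thesis ..
qed

text \<open>For this reason the topological term contributes with opposite signs to the momenta of
  the two gauge fields of the clone theory.\<close>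

lemma eps3_skew: "F \<bullet> eps3 Q = - (Q \<bullet> eps3 F)"
proof -
  have "F \<bullet> eps3 Q = (\<Sum>\<^sub>ua b c d e f.
      eps a b c d e f * (F$a$b$c * Q$d$e$f))"
    by (simp add: inner_tensor3 eps3_def sum_distrib_left mult_ac)
  also have "\<dots> = (\<Sum>\<^sub>ud e f a b c.
      eps a b c d e f * (F$a$b$c * Q$d$e$f))" by (rule sum_swap_triples)
  also have "\<dots> = - (Q \<bullet> eps3 F)"
    by (subst eps_block) (simp add: inner_tensor3 eps3_def sum_distrib_left sum_negf mult_ac)
  finally show ?thesis .
qed

lemma gauge_field_derivatives:
  assumes A: "smooth_on U A" and x: "x \<in> U"
  shows "(A has_derivative frechet_derivative A (at x)) (at x)"
    "(partial \<sigma> A has_derivative frechet_derivative (partial \<sigma> A) (at x)) (at x)"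
    "continuous_on U (partial \<mu> (partial \<sigma> A))"
proof -
  have "ck_on (Suc (Suc 0)) U A" using A unfolding smooth_on_def by blast
  then show "(A has_derivative frechet_derivative A (at x)) (at x)"
    "(partial \<sigma> A has_derivative frechet_derivative (partial \<sigma> A) (at x)) (at x)"
    "continuous_on U (partial \<mu> (partial \<sigma> A))"
    using x by (simp_all add: frechet_derivative_works[symmetric])
qed

lemma field_strength_eq:
  assumes "A differentiable (at x)"
  shows "field_strength A x $ \<sigma> $ \<tau> $ \<kappa> = partial \<sigma> A x $ \<tau> $ \<kappa> + partial \<tau> A x $ \<kappa> $ \<sigma> + partial \<kappa> A x $ \<sigma> $ \<tau>"
proof -
  have "(A has_derivative frechet_derivative A (at x)) (at x)"
    using assms by (simp add: frechet_derivative_works)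
  from partial_eq[OF bounded_linear.has_derivative[OF bounded_linear_component2 this]]
  have "partial \<mu> (\<lambda>y. A y $ a $ b) x = partial \<mu> A x $ a $ b" for \<mu> a b
    unfolding partial_def[of \<mu> A] .
  then show ?thesis by (simp add: field_strength_def)
qed

lemma field_strength_three_forms:
  assumes U: "open U" "x \<in> U" and A: "smooth_on U A" "\<And>y. y \<in> U \<Longrightarrow> A y \<in> two_forms"
  shows "field_strength A x \<in> three_forms"
proof -
  let ?A' = "frechet_derivative A (at x)"
  note d = gauge_field_derivatives(1)[OF A(1) U(2)]
  have "?A' d $ b $ a = - ?A' d $ a $ b" for d a b
  proof -
    note c = bounded_linear.has_derivative[OF bounded_linear_component2 d]
    have "((\<lambda>y. - A y $ a $ b) has_derivative (\<lambda>d. ?A' d $ b $ a)) (at x)"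
      by (rule has_derivative_transform_within_open[OF c U]) (rule two_forms_skew[OF A(2)])
    moreover have "((\<lambda>y. - A y $ a $ b) has_derivative (\<lambda>d. - ?A' d $ a $ b)) (at x)"
      by (rule has_derivative_minus[OF c])
    ultimately have "(\<lambda>d. ?A' d $ b $ a) = (\<lambda>d. - ?A' d $ a $ b)" by (rule has_derivative_unique)
    then show ?thesis by metis
  qed
  then have p: "partial \<mu> A x $ b $ a = - partial \<mu> A x $ a $ b" for \<mu> a b
    unfolding partial_def .
  have diff: "A differentiable (at x)" using d by (auto simp: differentiable_def)
  have "field_strength A x $ b $ a $ c = - field_strength A x $ a $ b $ c"
    "field_strength A x $ a $ c $ b = - field_strength A x $ a $ b $ c" for a b c
    unfolding field_strength_eq[OF diff] p[of _ c b] p[of _ c a] p[of _ b a] by simp_all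
  then show ?thesis unfolding three_forms_def by blast
qed

lemma has_derivative_vec:
  fixes f :: "'a::euclidean_space \<Rightarrow> 'n::finite \<Rightarrow> 'b::euclidean_space"
  assumes "\<And>i. ((\<lambda>x. f x i) has_derivative (\<lambda>h. f' h i)) (at x within S)"
  shows "((\<lambda>x. \<chi> i. f x i) has_derivative (\<lambda>h. \<chi> i. f' h i)) (at x within S)"
proof -
  have e: "(\<chi> i. g i) = (\<Sum>\<^sub>ui. axis i (g i))" for g :: "'n \<Rightarrow> 'b"
    by (simp add: vec_eq_iff axis_def if_distrib cong: if_cong)
  have bl: "bounded_linear (\<lambda>z::'b. axis i z :: 'b^'n)" for i
    unfolding linear_conv_bounded_linear[symmetric] by (rule linearI) (auto simp: axis_def vec_eq_iff)
  show ?thesis unfolding e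
    by (rule has_derivative_sum) (rule bounded_linear.has_derivative[OF bl assms])
qed

lemma eps_transpose: "eps d b c a e f = - eps a b c d e f"
  using eps_swap(1)[of d b c a e f] eps_swap(2)[of b d c a e f] eps_swap(3)[of b c d a e f]
    eps_swap(2)[of b a c d e f] eps_swap(1)[of b a c d e f] eps_swap by smt

text \<open>A cyclic permutation of three indices is even, so the three terms of a field strength
  contribute equally to its dual.\<close>

lemma eps3_cyclic: "eps3 (\<chi> i j k. T j k i) = eps3 (\<chi> i j k. T i j k)"
proof -
  have e: "eps a b c i j k = eps a b c j k i" for a b c i j k
    by (simp only: eps_swap(5)[of a b c j k i] eps_swap(4)[of a b c j i k] minus_minus)
  have "(\<Sum>\<^sub>ui j k. eps a b c i j k * T j k i) = (\<Sum>\<^sub>uj k i. eps a b c j k i * T j k i)" for a b c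
    by (subst sum_rotate3) (subst e, rule refl)
  then show ?thesis by (simp add: eps3_def)
qed

text \<open>The identity d d A = 0 as a divergence: \<open>eps\<close> is antisymmetric in the
  divergence index and the index of the first derivative, in which second derivatives of A are
  symmetric. The derivative F' is returned as well, since the divergence is later combined with
  those of products.\<close>

lemma bianchi:
  assumes U: "open U" "x \<in> U" and A: "smooth_on U A"
  shows "\<exists>F'. (field_strength A has_derivative F') (at x) \<and>
    (\<forall>\<nu> \<rho>. (\<Sum>\<^sub>u\<mu>. eps3 (F' (axis \<mu> 1)) $ \<mu> $ \<nu> $ \<rho>) = 0)"
proof -
  define D where "D \<sigma> = frechet_derivative (partial \<sigma> A) (at x)" for \<sigma>
  define F' where "F' d = (\<chi> \<sigma> \<tau> \<kappa>. D \<sigma> d $ \<tau> $ \<kappa> + D \<tau> d $ \<kappa> $ \<sigma> + D \<kappa> d $ \<sigma> $ \<tau>)" for d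
  define K where "K y = (\<chi> \<sigma> \<tau> \<kappa>. partial \<sigma> A y $ \<tau> $ \<kappa> + partial \<tau> A y $ \<kappa> $ \<sigma> + partial \<kappa> A y $ \<sigma> $ \<tau>)" for y
  have DA: "((\<lambda>y. partial \<sigma> A y $ \<tau> $ \<kappa>) has_derivative (\<lambda>d. D \<sigma> d $ \<tau> $ \<kappa>)) (at x)" for \<sigma> \<tau> \<kappa>
    unfolding D_def by (rule bounded_linear.has_derivative[OF bounded_linear_component2 gauge_field_derivatives(2)[OF A U(2)]])
  have "(K has_derivative F') (at x)"
    unfolding K_def[abs_def] F'_def[abs_def] by (intro has_derivative_vec has_derivative_add DA)
  moreover have "field_strength A y = K y" if "y \<in> U" for y
    using field_strength_eq gauge_field_derivatives(1)[OF A that]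
    by (simp add: K_def vec_eq_iff differentiable_def) blast
  ultimately have F': "(field_strength A has_derivative F') (at x)"
    using U has_derivative_transform_within_open[of K F' x UNIV U "field_strength A"] by simp
  have sym: "D \<sigma> (axis \<mu> 1) $ \<tau> $ \<kappa> = D \<mu> (axis \<sigma> 1) $ \<tau> $ \<kappa>" for \<mu> \<sigma> \<tau> \<kappa>
    unfolding D_def
  proof (rule mixed_partials[OF U, where f = "\<lambda>y. A y $ \<tau> $ \<kappa>"
        and Df = "\<lambda>y d. frechet_derivative A (at y) d $ \<tau> $ \<kappa>"
        and Du = "\<lambda>y d. frechet_derivative (partial \<sigma> A) (at y) d $ \<tau> $ \<kappa>"
        and Dv = "\<lambda>y d. frechet_derivative (partial \<mu> A) (at y) d $ \<tau> $ \<kappa>"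
        and u = "axis \<sigma> 1" and v = "axis \<mu> 1"])
    fix y assume y: "y \<in> U"
    note d = bounded_linear.has_derivative[OF bounded_linear_component2]
    show "((\<lambda>y. A y $ \<tau> $ \<kappa>) has_derivative (\<lambda>d. frechet_derivative A (at y) d $ \<tau> $ \<kappa>)) (at y)"
      by (rule d[OF gauge_field_derivatives(1)[OF A y]])
    show "((\<lambda>y. frechet_derivative A (at y) (axis \<sigma> 1) $ \<tau> $ \<kappa>) has_derivative
        (\<lambda>d. frechet_derivative (partial \<sigma> A) (at y) d $ \<tau> $ \<kappa>)) (at y)"
      using d[OF gauge_field_derivatives(2)[OF A y]] by (simp add: partial_def[abs_def])
    show "((\<lambda>y. frechet_derivative A (at y) (axis \<mu> 1) $ \<tau> $ \<kappa>) has_derivative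
        (\<lambda>d. frechet_derivative (partial \<mu> A) (at y) d $ \<tau> $ \<kappa>)) (at y)"
      using d[OF gauge_field_derivatives(2)[OF A y]] by (simp add: partial_def[abs_def])
  next
    have "isCont (\<lambda>y. partial \<mu> (partial \<sigma> A) y $ \<tau> $ \<kappa>) x" for \<mu> \<sigma>
      using gauge_field_derivatives(3)[OF A U(2)] U
      by (intro continuous_intros) (simp add: continuous_on_eq_continuous_at)
    then show "isCont (\<lambda>y. frechet_derivative (partial \<sigma> A) (at y) (axis \<mu> 1) $ \<tau> $ \<kappa>) x"
      "isCont (\<lambda>y. frechet_derivative (partial \<mu> A) (at y) (axis \<sigma> 1) $ \<tau> $ \<kappa>) x"
      by (simp_all add: partial_def[abs_def])
  qed
  have zero: "(\<Sum>\<^sub>u\<mu> \<sigma>. q \<mu> \<sigma> * D \<sigma> (axis \<mu> 1) $ \<tau> $ \<kappa>) = 0"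
    if "\<And>\<mu> \<sigma>. q \<sigma> \<mu> = - q \<mu> \<sigma>" for q :: "6 \<Rightarrow> 6 \<Rightarrow> real" and \<tau> \<kappa>
  proof -
    have "(\<Sum>\<^sub>u\<mu> \<sigma>. q \<mu> \<sigma> * D \<sigma> (axis \<mu> 1) $ \<tau> $ \<kappa>)
        = (\<Sum>\<^sub>u\<sigma> \<mu>. q \<mu> \<sigma> * D \<sigma> (axis \<mu> 1) $ \<tau> $ \<kappa>)" by (rule sum.swap)
    also have "\<dots> = - (\<Sum>\<^sub>u\<sigma> \<mu>. q \<sigma> \<mu> * D \<mu> (axis \<sigma> 1) $ \<tau> $ \<kappa>)"
      by (subst that, subst sym) (simp add: sum_negf)
    finally show ?thesis by simp
  qed
  have "(\<Sum>\<^sub>u\<mu>. eps3 (F' (axis \<mu> 1)) $ \<mu> $ \<nu> $ \<rho>) = 0" for \<nu> \<rho>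
  proof -
    have "eps3 (F' d) = 3 *\<^sub>R eps3 (\<chi> \<sigma> \<tau> \<kappa>. D \<sigma> d $ \<tau> $ \<kappa>)" for d
    proof -
      have e: "F' d = (\<chi> \<sigma> \<tau> \<kappa>. D \<sigma> d $ \<tau> $ \<kappa>) + (\<chi> \<sigma> \<tau> \<kappa>. D \<tau> d $ \<kappa> $ \<sigma>) + (\<chi> \<sigma> \<tau> \<kappa>. D \<kappa> d $ \<sigma> $ \<tau>)"
        by (simp add: F'_def vec_eq_iff)
      show ?thesis
        unfolding e linear_add[OF linear_eps3] eps3_cyclic[of "\<lambda>\<sigma> \<tau> \<kappa>. D \<tau> d $ \<kappa> $ \<sigma>"]
          eps3_cyclic[of "\<lambda>\<sigma> \<tau> \<kappa>. D \<sigma> d $ \<tau> $ \<kappa>"]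
        by (simp add: vec_eq_iff)
    qed
    moreover have "(\<Sum>\<^sub>u\<mu> \<sigma> \<tau> \<kappa>. eps \<mu> \<nu> \<rho> \<sigma> \<tau> \<kappa> * D \<sigma> (axis \<mu> 1) $ \<tau> $ \<kappa>)
        = (\<Sum>\<^sub>u\<tau> \<kappa> \<mu> \<sigma>. eps \<mu> \<nu> \<rho> \<sigma> \<tau> \<kappa> * D \<sigma> (axis \<mu> 1) $ \<tau> $ \<kappa>)"
      by (rule sum_swap_pairs)
    ultimately show ?thesis
      by (simp add: eps3_def zero[of "\<lambda>\<mu> \<sigma>. eps \<mu> \<nu> \<rho> \<sigma> _ _", OF eps_transpose] flip: sum_distrib_left)
  qed
  then show ?thesis using F' by blast
qed

section \<open>The clone formulation\<close>

lemma bilinear_contr3: "bounded_bilinear (contr3 g)"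
proof -
  have "linear (contr3 g S)" for S
    by (intro linearI) (simp_all add: contr3_def linear_add[OF linear_raise3] linear_cmul[OF linear_raise3]
        distrib_left sum.distrib sum_distrib_left mult.left_commute)
  moreover have "linear (\<lambda>S. contr3 g S T)" for T
    by (intro linearI) (simp_all add: contr3_def distrib_right sum.distrib sum_distrib_left mult.assoc)
  ultimately show ?thesis unfolding bilinear_conv_bounded_bilinear[symmetric] bilinear_def by blast
qed

lemma contr3_commute:
  assumes "lorentzian g" shows "contr3 g S T = contr3 g T S"
proof -
  obtain P Q where fc: "frame_change P Q g" and P: "pull2 P g = \<eta>"
    using minkowski_frame[OF assms] by blast
  have "contr3 \<eta> S T = contr3 \<eta> T S" for S T
    by (simp add: contr3_def raise_minkowski mult_ac)
  then show ?thesis using frame_change.contr3_pull[OF fc] P by metis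
qed

lemma tr3_adjoint:
  assumes "P ** Q = mat 1"
  shows "(\<Sum>\<^sub>ua b c. x a b c * tr3 P y a b c)
    = (\<Sum>\<^sub>ua b c. tr3 (transpose P) x a b c * y a b c)"
proof -
  have "transpose P ** transpose Q = mat 1"
    using assms by (metis matrix_left_right_inverse matrix_transpose_mul transpose_mat)
  then have "tr3 (transpose Q) (tr3 (transpose P) x) a b c = x a b c" for a b c
    by (simp add: tr3_tr3 tr3_one)
  then show ?thesis using tr3_contr[OF assms, of y "tr3 (transpose P) x"] by (simp add: mult.commute)
qed

text \<open>Lowering the indices of \<open>eps3\<close> with the metric costs the determinant of the
  inverse metric, which is -1 / vol^2. Lorentzian signature is the origin of the minus sign, and 6
  is the normalisation of \<open>dual3\<close>.\<close>

lemma inner_eps3: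
  assumes "lorentzian g"
  shows "eps3 X \<bullet> D = - 6 * vol g * contr3 g (dual3 g X) D"
proof -
  define u where "u = transpose (matrix_inv g)"
  have gi: "g ** matrix_inv g = mat 1" "matrix_inv g ** g = mat 1"
    using matrix_inv_inverse[OF lorentzian_invertible[OF assms]] by auto
  have u: "u ** transpose g = mat 1"
    unfolding u_def by (metis gi(1) matrix_transpose_mul transpose_mat)
  have "det (matrix_inv g) * det g = 1" using gi(2) by (metis det_I det_mul)
  then have "det (matrix_inv g) * (vol g * vol g) = - 1"
    unfolding vol_pos(2)[OF assms] by simp
  then have d: "vol g * det (transpose u) = - 1 / vol g"
    using vol_pos(1)[OF assms] by (simp add: u_def transpose_transpose field_simps)
  have e: "tr3 (transpose u) (\<lambda>i j k. tr3 (transpose u) (eps i j k) d e f) a b c = det (transpose u) * eps a b c d e f"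
    for a b c d e f
    unfolding eps_tr[symmetric] tr3_def tr2_def ..
  have "tr3 (transpose u) (\<lambda>i j k. dual3 g X $ i $ j $ k) a b c = - 1 / (6 * vol g) * eps3 X $ a $ b $ c" for a b c
  proof -
    have "dual3 g X $ i $ j $ k = vol g / 6 * (\<Sum>\<^sub>ud e f.
        tr3 (transpose u) (eps i j k) d e f * X $ d $ e $ f)" for i j k
      unfolding dual3_def vec_lambda_beta raise_tr u_def[symmetric] tr3_adjoint[OF u] ..
    then have "tr3 (transpose u) (\<lambda>i j k. dual3 g X $ i $ j $ k) a b c
        = vol g / 6 * (\<Sum>\<^sub>ud e f. det (transpose u) * eps a b c d e f * X $ d $ e $ f)"
      by (simp only: tr3_cmult tr3_sum tr3_mult_right e)
    also have "\<dots> = (vol g * det (transpose u)) / 6 * eps3 X $ a $ b $ c"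
      by (simp add: eps3_def sum_distrib_left mult_ac)
    finally show ?thesis unfolding d by simp
  qed
  then have "contr3 g (dual3 g X) D = (\<Sum>\<^sub>ua b c. - 1 / (6 * vol g) * eps3 X $ a $ b $ c * D $ a $ b $ c)"
    unfolding contr3_def raise_tr u_def[symmetric] tr3_adjoint[OF u] by simp
  also have "\<dots> = - 1 / (6 * vol g) * (eps3 X \<bullet> D)"
    by (simp add: inner_tensor3 sum_distrib_left mult_ac sum_negf)
  finally show ?thesis using vol_pos(1)[OF assms] by (simp add: field_simps)
qed

section \<open>From the clone field equations to an equation at a point\<close>

lemma inner_wedge:
  assumes T: "T \<in> three_forms" and n: "\<And>\<nu> \<rho>. (\<Sum>\<^sub>u\<mu>. n $ \<mu> * T $ \<mu> $ \<nu> $ \<rho>) = 0"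
  shows "T \<bullet> wedge n \<omega> = 0"
proof -
  have c: "T $ i $ j $ k = T $ j $ k $ i" for i j k
    using three_forms_skew(2)[OF T, of j k i] three_forms_skew(1)[OF T, of j i k] by simp
  have "(\<Sum>\<^sub>ui j k. T $ i $ j $ k * (n $ i * \<omega> $ j $ k)) = (\<Sum>\<^sub>uj k i. T $ i $ j $ k * (n $ i * \<omega> $ j $ k))"
    by (rule sum_rotate3)
  also have "\<dots> = (\<Sum>\<^sub>uj k. (\<Sum>\<^sub>ui. n $ i * T $ i $ j $ k) * \<omega> $ j $ k)"
    by (simp add: sum_distrib_right sum_distrib_left mult_ac)
  finally have "(\<Sum>\<^sub>ui j k. T $ i $ j $ k * (n $ i * \<omega> $ j $ k)) = 0" by (simp add: n)
  moreover have "(\<Sum>\<^sub>ui j k. T $ i $ j $ k * (n $ j * \<omega> $ k $ i)) = (\<Sum>\<^sub>uj k i. T $ j $ k $ i * (n $ j * \<omega> $ k $ i))"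
    by (subst sum_rotate3) (subst c, rule refl)
  moreover have "(\<Sum>\<^sub>ui j k. T $ i $ j $ k * (n $ k * \<omega> $ i $ j)) = (\<Sum>\<^sub>uk i j. T $ k $ i $ j * (n $ k * \<omega> $ i $ j))"
    by (subst sum_rotate3[symmetric]) (subst c[symmetric], rule refl)
  ultimately show ?thesis by (simp add: inner_tensor3 wedge_def distrib_left sum.distrib)
qed

text \<open>The clone equations at a point: the variation of \<open>\<V>\<close> along \<open>n \<and> \<omega>\<close>, where \<open>n\<close> is the gradient
  of the auxiliary scalar.\<close>

definition clone_alg :: "real \<Rightarrow> tensor2 \<Rightarrow> vec6 \<Rightarrow> (real \<Rightarrow> real) \<Rightarrow> tensor3 \<Rightarrow> bool" where
  "clone_alg k g n V X \<longleftrightarrow> X \<in> three_forms \<and>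
     (\<exists>W. ((\<lambda>X. V (I_inv g (plus_part g X))) has_derivative W) (at X within three_forms) \<and>
       (\<forall>\<omega>\<in>two_forms. W (wedge n \<omega>) = 6 * k * contr3 g (dual3 g X) (wedge n \<omega>) - contr3 g X (wedge n \<omega>) / 12))"

text \<open>The part of the Lagrangian that sees F and Q only through X; splitting it off leaves the
  topological term.\<close>

definition clone_f :: "tensor2 \<Rightarrow> (real \<Rightarrow> real) \<Rightarrow> tensor3 \<Rightarrow> real" where
  "clone_f g V X = - vol g / 24 * contr3 g X X - vol g * V (I_inv g (plus_part g X))"

lemma clone_lagrangian_eq:
  "clone_lagrangian k g V F Q a = clone_f g V (F + a *\<^sub>R Q) + k * a * (F \<bullet> eps3 Q)"
proof -
  have "F \<bullet> eps3 Q = (\<Sum>\<^sub>u\<mu> \<nu> \<rho> \<sigma> \<tau> \<kappa>.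
      eps \<mu> \<nu> \<rho> \<sigma> \<tau> \<kappa> * F $ \<mu> $ \<nu> $ \<rho> * Q $ \<sigma> $ \<tau> $ \<kappa>)"
    by (simp add: inner_tensor3 eps3_def sum_distrib_left mult_ac)
  then show ?thesis by (simp add: clone_lagrangian_def clone_f_def Let_def fact_numeral)
qed

text \<open>A variation D of F changes X by D, one of Q changes it by a D. With Z the derivative of
  \<open>clone_f\<close> this gives P = Z + k a \<open>eps3 Q\<close> and P' = a Z - k a
  \<open>eps3 F\<close>; eliminating Z ties the two momenta together.\<close>

lemma clone_momenta:
  assumes F: "F \<in> three_forms" and Q: "Q \<in> three_forms"
    and P: "P \<in> three_forms"
      "((\<lambda>F. clone_lagrangian k g V F Q a) has_derivative (\<lambda>D. P \<bullet> D)) (at F within three_forms)"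
    and P': "P' \<in> three_forms"
      "((\<lambda>Q. clone_lagrangian k g V F Q a) has_derivative (\<lambda>D. P' \<bullet> D)) (at Q within three_forms)"
  shows "(clone_f g V has_derivative (\<lambda>D. (P - (k * a) *\<^sub>R eps3 Q) \<bullet> D)) (at (F + a *\<^sub>R Q) within three_forms)"
    and "P' = a *\<^sub>R P - (k * a) *\<^sub>R eps3 (F + a *\<^sub>R Q)"
proof -
  let ?X = "F + a *\<^sub>R Q" and ?Z = "P - (k * a) *\<^sub>R eps3 Q"
  have X: "?X \<in> three_forms" by (intro subspace_add subspace_scale subspace_three_forms F Q)
  have "((\<lambda>Y. Y - a *\<^sub>R Q) has_derivative (\<lambda>D. D)) (at ?X within three_forms)"
    by (auto intro!: derivative_eq_intros)
  moreover have "((\<lambda>F. clone_lagrangian k g V F Q a) has_derivative (\<lambda>D. P \<bullet> D))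
      (at (?X - a *\<^sub>R Q) within (\<lambda>Y. Y - a *\<^sub>R Q) ` three_forms)"
    by (rule has_derivative_subset[of _ _ _ three_forms])
      (use P Q in \<open>auto intro!: subspace_diff subspace_scale subspace_three_forms\<close>)
  ultimately have "((\<lambda>F. clone_lagrangian k g V F Q a) \<circ> (\<lambda>Y. Y - a *\<^sub>R Q) has_derivative (\<lambda>D. P \<bullet> D) \<circ> (\<lambda>D. D))
      (at ?X within three_forms)"
    by (rule diff_chain_within)
  then have "((\<lambda>Y. clone_lagrangian k g V (Y - a *\<^sub>R Q) Q a - k * a * ((Y - a *\<^sub>R Q) \<bullet> eps3 Q)) has_derivative
      (\<lambda>D. P \<bullet> D - k * a * (D \<bullet> eps3 Q))) (at ?X within three_forms)"
    unfolding o_def by (auto intro!: derivative_eq_intros)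
  moreover have "P \<bullet> D - k * a * (D \<bullet> eps3 Q) = ?Z \<bullet> D" for D
    by (simp add: inner_diff_left inner_commute[of D])
  ultimately show Z: "(clone_f g V has_derivative (\<lambda>D. ?Z \<bullet> D)) (at ?X within three_forms)"
    by (simp add: clone_lagrangian_eq)
  have "((\<lambda>Y. F + a *\<^sub>R Y) has_derivative (\<lambda>D. a *\<^sub>R D)) (at Q within three_forms)"
    by (auto intro!: derivative_eq_intros)
  moreover have "(clone_f g V has_derivative (\<lambda>D. ?Z \<bullet> D)) (at (F + a *\<^sub>R Q) within (\<lambda>Y. F + a *\<^sub>R Y) ` three_forms)"
    by (rule has_derivative_subset[OF Z]) (use F in \<open>auto intro!: subspace_add subspace_scale subspace_three_forms\<close>)
  ultimately have "(clone_f g V \<circ> (\<lambda>Y. F + a *\<^sub>R Y) has_derivative (\<lambda>D. ?Z \<bullet> D) \<circ> (\<lambda>D. a *\<^sub>R D)) (at Q within three_forms)"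
    by (rule diff_chain_within)
  then have "((\<lambda>Y. clone_f g V (F + a *\<^sub>R Y) - k * a * (Y \<bullet> eps3 F)) has_derivative
      (\<lambda>D. ?Z \<bullet> (a *\<^sub>R D) - k * a * (D \<bullet> eps3 F))) (at Q within three_forms)"
    unfolding o_def by (auto intro!: derivative_eq_intros)
  moreover have "clone_lagrangian k g V F Y a = clone_f g V (F + a *\<^sub>R Y) - k * a * (Y \<bullet> eps3 F)" for Y
    by (simp add: clone_lagrangian_eq eps3_skew[of F Y])
  ultimately have L: "((\<lambda>Q. clone_lagrangian k g V F Q a) has_derivative
      (\<lambda>D. ?Z \<bullet> (a *\<^sub>R D) - k * a * (D \<bullet> eps3 F))) (at Q within three_forms)" by simp
  let ?R = "P' - (a *\<^sub>R P - (k * a) *\<^sub>R eps3 ?X)"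
  have R: "?R \<in> three_forms"
    using P P' eps3_three_forms by (intro subspace_diff subspace_scale subspace_three_forms) auto
  have "?R \<bullet> D = 0" if "D \<in> three_forms" for D
    using gradient_unique[OF P'(2) L subspace_three_forms Q that]
    by (simp add: inner_diff_left inner_diff_right inner_add_left inner_commute[of D] linear_add[OF linear_eps3]
        linear_cmul[OF linear_eps3] algebra_simps)
  from this[OF R] show "P' = a *\<^sub>R P - (k * a) *\<^sub>R eps3 ?X" by simp
qed

text \<open>Take the divergence of P' = a P - k a \<open>eps3 X\<close>. Both momenta are
  divergence-free, and the derivatives of F and Q drop out by the Bianchi identities. Only terms
  with the gradient n of a remain, namely the contraction of n with Z - k \<open>eps3 X\<close>, so
  this tensor annihilates every n \<and> \<omega>.\<close>

lemma clone_on_shell_alg: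
  assumes U: "open U" "x \<in> U" and on: "clone_on_shell k U h V A A' a"
  shows "clone_alg k (h x) (grad a x) V (clone_X A A' a x)"
proof -
  let ?F = "field_strength A" and ?Q = "field_strength A'"
  have sm: "smooth_on U A" "smooth_on U A'" "smooth_on U a" and tf: "\<And>y. y \<in> U \<Longrightarrow> A y \<in> two_forms"
    "\<And>y. y \<in> U \<Longrightarrow> A' y \<in> two_forms" and lor: "lorentzian (h x)"
    and eqF: "two_form_eq U (\<lambda>x F. clone_lagrangian k (h x) V F (?Q x) (a x)) ?F"
    and eqQ: "two_form_eq U (\<lambda>x Q. clone_lagrangian k (h x) V (?F x) Q (a x)) ?Q"
    using on U(2) by (auto simp: clone_on_shell_def metric_field_def gauge_field_def Let_def)
  obtain P where P: "\<And>y. y \<in> U \<Longrightarrow> P y \<in> three_forms"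
    "\<And>y. y \<in> U \<Longrightarrow> ((\<lambda>F. clone_lagrangian k (h y) V F (?Q y) (a y)) has_derivative (\<lambda>D. P y \<bullet> D)) (at (?F y) within three_forms)"
    "P differentiable (at x)" "\<And>\<nu> \<rho>. (\<Sum>\<^sub>u\<mu>. partial \<mu> (\<lambda>y. P y $ \<mu> $ \<nu> $ \<rho>) x) = 0"
    using eqF U(2) unfolding two_form_eq_def by blast
  obtain P' where P': "\<And>y. y \<in> U \<Longrightarrow> P' y \<in> three_forms"
    "\<And>y. y \<in> U \<Longrightarrow> ((\<lambda>Q. clone_lagrangian k (h y) V (?F y) Q (a y)) has_derivative (\<lambda>D. P' y \<bullet> D)) (at (?Q y) within three_forms)"
    "\<And>\<nu> \<rho>. (\<Sum>\<^sub>u\<mu>. partial \<mu> (\<lambda>y. P' y $ \<mu> $ \<nu> $ \<rho>) x) = 0"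
    using eqQ U(2) unfolding two_form_eq_def by blast
  have FQ: "?F y \<in> three_forms" "?Q y \<in> three_forms" if "y \<in> U" for y
    using field_strength_three_forms[OF U(1) that] sm tf by blast+
  define X where "X y = ?F y + a y *\<^sub>R ?Q y" for y
  define n where "n = grad a x"
  define Z where "Z = P x - (k * a x) *\<^sub>R eps3 (?Q x)"
  note mom = clone_momenta[OF FQ(1) FQ(2) P(1,2) P'(1,2), folded X_def]
  have P'_eq: "P' y = a y *\<^sub>R P y - (k * a y) *\<^sub>R eps3 (X y)" if "y \<in> U" for y
    using mom(2) that by blast
  have f: "(clone_f (h x) V has_derivative (\<lambda>D. Z \<bullet> D)) (at (X x) within three_forms)"
    unfolding Z_def using mom(1) U(2) by blast
  have Xx: "X x \<in> three_forms" unfolding X_def by (intro subspace_add subspace_scale subspace_three_forms FQ U)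
  obtain F' Q' where F': "(?F has_derivative F') (at x)" "\<And>\<nu> \<rho>. (\<Sum>\<^sub>u\<mu>. eps3 (F' (axis \<mu> 1)) $ \<mu> $ \<nu> $ \<rho>) = 0"
    and Q': "(?Q has_derivative Q') (at x)" "\<And>\<nu> \<rho>. (\<Sum>\<^sub>u\<mu>. eps3 (Q' (axis \<mu> 1)) $ \<mu> $ \<nu> $ \<rho>) = 0"
    using bianchi[OF U sm(1)] bianchi[OF U sm(2)] by blast
  obtain DP where DP: "(P has_derivative DP) (at x)" using P(3) by (auto simp: differentiable_def)
  define a' where "a' = frechet_derivative a (at x)"
  have a': "(a has_derivative a') (at x)"
  proof -
    have "ck_on (Suc 0) U a" using sm(3) unfolding smooth_on_def by blast
    then show ?thesis using U(2) by (simp add: a'_def frechet_derivative_works)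
  qed
  have n: "a' (axis \<mu> 1) = n $ \<mu>" for \<mu>
    by (simp add: n_def grad_def partial_def a'_def)
  have beps: "bounded_linear eps3" using linear_eps3 linear_conv_bounded_linear by blast
  define R where "R d = (a x *\<^sub>R DP d + a' d *\<^sub>R P x) - ((k * a x) *\<^sub>R eps3 (F' d + (a x *\<^sub>R Q' d + a' d *\<^sub>R ?Q x))
      + (k * a' d) *\<^sub>R eps3 (X x))" for d
  have "((\<lambda>y. a y *\<^sub>R P y - (k * a y) *\<^sub>R eps3 (X y)) has_derivative R) (at x)"
    unfolding R_def[abs_def] X_def
    by (intro has_derivative_diff has_derivative_scaleR has_derivative_mult_right a' DP
        bounded_linear.has_derivative[OF beps] has_derivative_add F' Q')
  then have R: "(P' has_derivative R) (at x)"
    by (rule has_derivative_transform_within_open[OF _ U]) (simp add: P'_eq)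
  have div: "(\<Sum>\<^sub>u\<mu>. R (axis \<mu> 1) $ \<mu> $ \<nu> $ \<rho>) = 0" "(\<Sum>\<^sub>u\<mu>. DP (axis \<mu> 1) $ \<mu> $ \<nu> $ \<rho>) = 0" for \<nu> \<rho>
    using P'(3)[of \<nu> \<rho>] P(4)[of \<nu> \<rho>]
    by (simp_all add: partial_eq[OF bounded_linear.has_derivative[OF bounded_linear_component3 R]]
        partial_eq[OF bounded_linear.has_derivative[OF bounded_linear_component3 DP]])
  define T where "T = Z - k *\<^sub>R eps3 (X x)"
  have "(\<Sum>\<^sub>u\<mu>. n $ \<mu> * T $ \<mu> $ \<nu> $ \<rho>) = 0" for \<nu> \<rho>
  proof -
    have "R (axis \<mu> 1) $ \<mu> $ \<nu> $ \<rho> = a x * DP (axis \<mu> 1) $ \<mu> $ \<nu> $ \<rho> - k * a x * eps3 (F' (axis \<mu> 1)) $ \<mu> $ \<nu> $ \<rho>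
        - k * a x * a x * eps3 (Q' (axis \<mu> 1)) $ \<mu> $ \<nu> $ \<rho> + n $ \<mu> * T $ \<mu> $ \<nu> $ \<rho>" for \<mu>
      by (simp add: R_def T_def Z_def n linear_add[OF linear_eps3] linear_cmul[OF linear_eps3] algebra_simps)
    then have "(\<Sum>\<^sub>u\<mu>. R (axis \<mu> 1) $ \<mu> $ \<nu> $ \<rho>) = a x * (\<Sum>\<^sub>u\<mu>. DP (axis \<mu> 1) $ \<mu> $ \<nu> $ \<rho>)
        - k * a x * (\<Sum>\<^sub>u\<mu>. eps3 (F' (axis \<mu> 1)) $ \<mu> $ \<nu> $ \<rho>)
        - k * a x * a x * (\<Sum>\<^sub>u\<mu>. eps3 (Q' (axis \<mu> 1)) $ \<mu> $ \<nu> $ \<rho>) + (\<Sum>\<^sub>u\<mu>. n $ \<mu> * T $ \<mu> $ \<nu> $ \<rho>)"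
      by (simp add: sum.distrib sum_subtractf sum_distrib_left)
    then show ?thesis by (simp add: div F'(2) Q'(2))
  qed
  moreover have "T \<in> three_forms"
    unfolding T_def Z_def using P(1)[OF U(2)] eps3_three_forms
    by (intro subspace_diff subspace_scale subspace_three_forms) auto
  ultimately have "T \<bullet> wedge n \<omega> = 0" for \<omega> by (intro inner_wedge)
  then have Zw: "Z \<bullet> wedge n \<omega> = - 6 * k * vol (h x) * contr3 (h x) (dual3 (h x) (X x)) (wedge n \<omega>)" for \<omega>
    by (simp add: T_def inner_diff_left inner_eps3[OF lor] mult_ac eq_neg_iff_add_eq_0)
  have vol: "0 < vol (h x)" by (rule vol_pos[OF lor])
  let ?W = "\<lambda>D. - (Z \<bullet> D) / vol (h x) - (contr3 (h x) (X x) D + contr3 (h x) D (X x)) / 24"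
  have "((\<lambda>Y. - clone_f (h x) V Y / vol (h x) - contr3 (h x) Y Y / 24) has_derivative ?W) (at (X x) within three_forms)"
    by (intro has_derivative_diff bounded_linear.has_derivative[OF bounded_linear_divide] has_derivative_minus f
        bounded_bilinear.FDERIV[OF bilinear_contr3] has_derivative_ident)
  moreover have "- clone_f (h x) V Y / vol (h x) - contr3 (h x) Y Y / 24 = V (I_inv (h x) (plus_part (h x) Y))" for Y
    using vol by (simp add: clone_f_def field_simps)
  ultimately have "((\<lambda>Y. V (I_inv (h x) (plus_part (h x) Y))) has_derivative ?W) (at (X x) within three_forms)" by simp
  moreover have "?W (wedge n \<omega>) = 6 * k * contr3 (h x) (dual3 (h x) (X x)) (wedge n \<omega>) - contr3 (h x) (X x) (wedge n \<omega>) / 12" for \<omega>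
    using vol by (simp add: Zw contr3_commute[OF lor, of "wedge n \<omega>" "X x"])
  moreover have "clone_X A A' a x = X x" by (simp add: clone_X_def X_def)
  ultimately show ?thesis
    unfolding clone_alg_def n_def[symmetric] using Xx by auto
qed

section \<open>From the clone equation to the INZ equation\<close>

lemma wedge_pull: "wedge (pull1 P n) (pull2 P \<omega>) = pull3 P (wedge n \<omega>)"
proof -
  have 1: "tr3 P (\<lambda>i j k. n $ i * \<omega> $ j $ k) a b c = tr P (\<lambda>i. n $ i) a * tr2 P (\<lambda>i j. \<omega> $ i $ j) b c" for a b c
    by (simp add: tr3_def tr2_cmult tr_mult_right)
  have 2: "tr3 P (\<lambda>i j k. n $ j * \<omega> $ k $ i) a b c = tr P (\<lambda>i. n $ i) b * tr2 P (\<lambda>i j. \<omega> $ i $ j) c a" for a b c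
    by (simp add: tr3_def tr2_def tr_cmult tr_mult_right tr_commute[of P P _ c])
  have 3: "tr3 P (\<lambda>i j k. n $ k * \<omega> $ i $ j) a b c = tr P (\<lambda>i. n $ i) c * tr2 P (\<lambda>i j. \<omega> $ i $ j) a b" for a b c
    by (simp add: tr3_def tr2_def tr_cmult tr_mult_right)
  show ?thesis
    by (simp add: vec_eq_iff wedge_def pull1_def pull2_def pull3_def tr3_add 1 2 3)
qed

lemma wedge_scale: "wedge (c *\<^sub>R n) \<omega> = c *\<^sub>R wedge n \<omega>"
  by (simp add: wedge_def vec_eq_iff algebra_simps)

text \<open>The equation is linear in n, so a timelike gradient may be normalised to the unit
  covector that defines B.\<close>

lemma clone_alg_scale:
  assumes "clone_alg k g n V X" shows "clone_alg k g (c *\<^sub>R n) V X"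
proof -
  obtain W where W: "((\<lambda>X. V (I_inv g (plus_part g X))) has_derivative W) (at X within three_forms)"
    "\<And>\<omega>. \<omega> \<in> two_forms \<Longrightarrow> W (wedge n \<omega>) = 6 * k * contr3 g (dual3 g X) (wedge n \<omega>) - contr3 g X (wedge n \<omega>) / 12"
    and X: "X \<in> three_forms"
    using assms unfolding clone_alg_def by blast
  have "W (wedge (c *\<^sub>R n) \<omega>) = 6 * k * contr3 g (dual3 g X) (wedge (c *\<^sub>R n) \<omega>) - contr3 g X (wedge (c *\<^sub>R n) \<omega>) / 12"
    if "\<omega> \<in> two_forms" for \<omega>
    using has_derivative_linear[OF W(1)]
    by (simp add: wedge_scale linear_cmul bounded_bilinear.scaleR_right[OF bilinear_contr3] W(2)[OF that]
        right_diff_distrib)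
  then show ?thesis using W(1) X unfolding clone_alg_def by blast
qed

lemma (in frame_change) clone_alg_pull:
  assumes "clone_alg k g n V X"
  shows "clone_alg k (pull2 P g) (pull1 P n) V (pull3 P X)"
proof -
  obtain W where W: "((\<lambda>X. V (I_inv g (plus_part g X))) has_derivative W) (at X within three_forms)"
    "\<And>\<omega>. \<omega> \<in> two_forms \<Longrightarrow> W (wedge n \<omega>) = 6 * k * contr3 g (dual3 g X) (wedge n \<omega>) - contr3 g X (wedge n \<omega>) / 12"
    and X: "X \<in> three_forms"
    using assms unfolding clone_alg_def by blast
  have "(pull3 Q has_derivative pull3 Q) (at (pull3 P X) within three_forms)"
    using linear_pull(3) by (simp add: linear_imp_has_derivative)
  moreover have "((\<lambda>X. V (I_inv g (plus_part g X))) has_derivative W)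
      (at (pull3 Q (pull3 P X)) within pull3 Q ` three_forms)"
    using W(1) frame_change.three_forms_pull[OF inverse_change]
    by (auto simp: pull_inverse intro: has_derivative_subset)
  ultimately have "((\<lambda>X. V (I_inv g (plus_part g X))) \<circ> pull3 Q has_derivative W \<circ> pull3 Q)
      (at (pull3 P X) within three_forms)"
    by (rule diff_chain_within)
  moreover have "(\<lambda>X. V (I_inv g (plus_part g X))) \<circ> pull3 Q = (\<lambda>X. V (I_inv (pull2 P g) (plus_part (pull2 P g) X)))"
  proof
    fix X
    have "I_inv (pull2 P g) (plus_part (pull2 P g) (pull3 P (pull3 Q X))) = I_inv g (plus_part g (pull3 Q X))"
      unfolding plus_part_pull I_inv_pull ..
    then show "((\<lambda>X. V (I_inv g (plus_part g X))) \<circ> pull3 Q) X = V (I_inv (pull2 P g) (plus_part (pull2 P g) X))"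
      by (simp add: pull_inverse)
  qed
  moreover have "(W \<circ> pull3 Q) (wedge (pull1 P n) \<omega>) = 6 * k * contr3 (pull2 P g) (dual3 (pull2 P g) (pull3 P X)) (wedge (pull1 P n) \<omega>)
      - contr3 (pull2 P g) (pull3 P X) (wedge (pull1 P n) \<omega>) / 12" if "\<omega> \<in> two_forms" for \<omega>
  proof -
    have w: "wedge (pull1 P n) \<omega> = pull3 P (wedge n (pull2 Q \<omega>))"
      using wedge_pull[of P n "pull2 Q \<omega>"] by (simp add: pull_inverse)
    show ?thesis
      using W(2)[OF pull2_two_forms[OF that, of Q]] by (simp add: w pull_inverse dual3_pull contr3_pull)
  qed
  ultimately show ?thesis unfolding clone_alg_def using three_forms_pull[OF X] by auto
qed

lemma plus_part_self_dual: "L \<in> self_dual g \<Longrightarrow> plus_part g L = L"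
  by (simp add: self_dual_def plus_part_def flip: scaleR_2)

text \<open>V(I) depends on X only through its self-dual part. Its derivative therefore ignores
  anti-self-dual directions and is the gradient that occurs in the INZ equation.\<close>

lemma clone_gradient:
  assumes X: "X \<in> three_forms"
    and W: "((\<lambda>X. V (I_inv \<eta> (plus_part \<eta> X))) has_derivative W) (at X within three_forms)"
  shows "\<exists>G\<in>trans0.
    V_grad V (plus_part \<eta> X) G \<and>
    (\<forall>D\<in>three_forms. W D = contr2 \<eta> G (slot0 (plus_part \<eta> D)))"
proof -
  let ?pl = "plus_part \<eta>" and ?sl = "slot0"
  define L where "L = ?pl X"
  have L: "L \<in> sd0" unfolding L_def by (rule plus_part_minkowski[OF X])
  have lin: "linear W" by (rule has_derivative_linear[OF W])
  note pl = linear_add[OF linear_plus_part] linear_diff[OF linear_plus_part] linear_cmul[OF linear_plus_part]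
  have sd3: "Y \<in> three_forms" if "Y \<in> sd0" for Y :: tensor3
    using that by (rule self_dual_three_forms)
  \<comment> \<open>Moving X along self-dual directions only: the self-dual part of X + (Y - L) is Y
    itself, so the composition with this map is V(I) on self-dual forms.\<close>
  have "((\<lambda>Y. X + (Y - L)) has_derivative (\<lambda>D. D)) (at L within sd0)"
    by (auto intro!: derivative_eq_intros)
  moreover have "((\<lambda>X. V (I_inv \<eta> (?pl X))) has_derivative W) (at (X + (L - L)) within (\<lambda>Y. X + (Y - L)) ` sd0)"
    by (rule has_derivative_subset[of _ _ _ three_forms])
      (use W X sd3 L in \<open>auto intro!: subspace_add subspace_diff subspace_three_forms\<close>)
  ultimately have "((\<lambda>X. V (I_inv \<eta> (?pl X))) \<circ> (\<lambda>Y. X + (Y - L)) has_derivative W \<circ> (\<lambda>D. D)) (at L within sd0)"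
    by (rule diff_chain_within)
  then have "((\<lambda>Y. V (I_inv \<eta> (?pl (X + (Y - L))))) has_derivative W) (at L within sd0)"
    by (simp add: o_def)
  moreover have "?pl (X + (Y - L)) = Y" if "Y \<in> sd0" for Y
    using that L by (simp add: pl plus_part_self_dual) (simp add: L_def)
  ultimately have VI: "((\<lambda>L. V (I_inv \<eta> L)) has_derivative W) (at L within sd0)"
    using L by (auto intro: has_derivative_transform[rotated 2])
  have "linear (\<lambda>d. W (lift d))" using linear_compose[OF linear_lift lin] by (simp add: o_def)
  then obtain G where G: "G \<in> trans0" "\<And>d. d \<in> trans0 \<Longrightarrow> W (lift d) = G \<bullet> d"
    using riesz_subspace[OF subspace_transverse2] by blast
  have GW: "contr2 \<eta> G (?sl D) = W D" if "D \<in> sd0" for D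
    using G(2)[of "?sl D"] transverse_inner[OF G(1), of "?sl D"] slot_transverse2[OF sd3[OF that]] lift_slot[OF that] by simp
  have "bounded_linear (\<lambda>D. contr2 \<eta> G (?sl D))"
    using linear_compose[OF linear_slot linear_contr2] linear_conv_bounded_linear by (fastforce simp: o_def)
  then have "((\<lambda>L. V (I_inv \<eta> L)) has_derivative (\<lambda>D. contr2 \<eta> G (?sl D))) (at L within sd0)"
    by (rule has_derivative_within_subspace_cong[OF VI subspace_self_dual L]) (rule GW)
  moreover have "W D = contr2 \<eta> G (?sl (?pl D))" if D: "D \<in> three_forms" for D
  proof -
    have sd: "?pl D \<in> sd0" by (rule plus_part_minkowski[OF D])
    \<comment> \<open>Along the anti-self-dual part of D the self-dual part of X stays fixed, so the
      function is constant.\<close>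
    have "D - ?pl D \<in> three_forms" by (intro subspace_diff subspace_three_forms D sd3 sd)
    from has_derivative_line[OF W subspace_three_forms X this]
    have "((\<lambda>t::real. V (I_inv \<eta> L)) has_real_derivative W (D - ?pl D)) (at 0)"
      by (simp add: pl plus_part_self_dual[OF sd] L_def)
    then have "W (D - ?pl D) = 0" using DERIV_const DERIV_unique by blast
    then show ?thesis using GW[OF sd] lin by (simp add: linear_diff)
  qed
  ultimately show ?thesis using G(1) by (auto simp: L_def)
qed

text \<open>Testing with v0 \<and> \<omega> gives G = E/2 - 36 k B, while the slot of X^+ is (E +
  B)/2. In -\<Lambda> + G the field E cancels and -(72 k + 1)/2 times B remains; for k = 1/72 this
  is -B.\<close>

lemma clone_alg_inz:
  assumes "clone_alg k \<eta> v0 V X"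
  shows "inz_algebraic_eq \<eta> v0 V ((- (72 * k + 1) / 2) *\<^sub>R B0 X) (plus_part \<eta> X)"
proof -
  let ?B = "B0 X" and ?E = "slot0 X"
  obtain W where W: "((\<lambda>X. V (I_inv \<eta> (plus_part \<eta> X))) has_derivative W) (at X within three_forms)"
    "\<And>\<omega>. \<omega> \<in> two_forms \<Longrightarrow> W (wedge v0 \<omega>) = 6 * k * contr3 \<eta> (dual3 \<eta> X) (wedge v0 \<omega>)
      - contr3 \<eta> X (wedge v0 \<omega>) / 12"
    and X: "X \<in> three_forms"
    using assms unfolding clone_alg_def by blast
  obtain G where G: "G \<in> trans0"
    "V_grad V (plus_part \<eta> X) G"
    "\<And>D. D \<in> three_forms \<Longrightarrow> W D = contr2 \<eta> G (slot0 (plus_part \<eta> D))"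
    using clone_gradient[OF X W(1)] by blast
  have B: "?B \<in> trans0" and E: "?E \<in> trans0"
    unfolding B_of_def by (intro slot_transverse2 dual3_three_forms X)+
  note sl = linear_add[OF linear_slot] linear_cmul[OF linear_slot] linear_neg[OF linear_slot]
  define R where "R = G + (36 * k) *\<^sub>R ?B - (1 / 2) *\<^sub>R ?E"
  have R: "R \<in> trans0"
    unfolding R_def by (intro subspace_add subspace_diff subspace_scale subspace_transverse2 G B E)
  have "contr2 \<eta> R \<omega> = 0" if \<omega>: "\<omega> \<in> trans0" for \<omega>
  proof -
    have w: "wedge v0 \<omega> \<in> three_forms" by (rule wedge_three_forms[OF transverse2_two_forms[OF \<omega>]])
    have "slot0 (plus_part \<eta> (wedge v0 \<omega>)) = (- 1 / 2) *\<^sub>R \<omega>"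
      unfolding plus_part_def by (simp add: sl slot_wedge_v0[OF \<omega>])
    then have "- contr2 \<eta> G \<omega> / 2 = 18 * k * contr2 \<eta> ?B \<omega> - contr2 \<eta> ?E \<omega> / 4"
      using W(2)[OF transverse2_two_forms[OF \<omega>]] G(3)[OF w] linear_contr2[of \<eta> G]
      by (simp add: contr3_wedge_v0[OF X \<omega>] contr3_wedge_v0[OF dual3_three_forms \<omega>] B_of_def linear_cmul linear_neg)
    then show ?thesis
      unfolding R_def
      by (simp add: bounded_bilinear.add_left[OF bilinear_contr2] bounded_bilinear.diff_left[OF bilinear_contr2]
          bounded_bilinear.scaleR_left[OF bilinear_contr2])
  qed
  from this[OF R] have "R = 0" by (simp add: transverse_inner[OF R R])
  then have "G = (1 / 2) *\<^sub>R ?E - (36 * k) *\<^sub>R ?B" by (simp add: R_def algebra_simps)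
  then have "(- (72 * k + 1) / 2) *\<^sub>R ?B = - slot0 (plus_part \<eta> X) + G"
    by (simp add: plus_part_def sl B_of_def vec_eq_iff field_simps)
  moreover have "(- (72 * k + 1) / 2) *\<^sub>R ?B \<in> trans0"
    by (intro subspace_scale subspace_transverse2 B)
  ultimately show ?thesis
    unfolding inz_algebraic_eq_def using G(1,2) plus_part_minkowski[OF X] by blast
qed

lemma p_inv_scale: "p_inv g v (c *\<^sub>R B) = c\<^sup>2 * p_inv g v B"
proof -
  have p: "p_vec g v (c *\<^sub>R B) $ i = c\<^sup>2 * p_vec g v B $ i" for i
    by (simp add: p_vec_def sum_distrib_left power2_eq_square mult_ac)
  have "(\<Sum>\<^sub>u\<mu> \<nu>. g $ \<mu> $ \<nu> * p_vec g v (c *\<^sub>R B) $ \<mu> * p_vec g v (c *\<^sub>R B) $ \<nu>)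
      = (c\<^sup>2)\<^sup>2 * (\<Sum>\<^sub>u\<mu> \<nu>. g $ \<mu> $ \<nu> * p_vec g v B $ \<mu> * p_vec g v B $ \<nu>)"
    unfolding p by (simp add: sum_distrib_left power2_eq_square mult_ac)
  then show ?thesis by (simp only: p_inv_def real_sqrt_mult real_sqrt_abs abs_power2)
qed

lemma lorentzian_minkowski: "lorentzian \<eta>"
proof -
  have "transpose \<eta> = \<eta>" by (simp add: transpose_def minkowski_def vec_eq_iff)
  moreover have "invertible (mat 1 :: real^6^6)" by (auto simp: invertible_def)
  ultimately show ?thesis unfolding lorentzian_def by (intro conjI exI[of _ "mat 1"]) simp_all
qed

lemma unit_timelike_v0: "unit_timelike \<eta> v0"
  by (simp add: unit_timelike_def sq1_minkowski axis_def)

lemma V_lim_eq: "V_lim e = (\<lambda>I. e / 2 * sqrt (I / 6))"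
  by (simp add: V_lim_def fun_eq_iff)

lemma clone_V_lim:
  assumes "lorentzian g" "unit_timelike g w" "clone_alg k g w (V_lim e) X"
    and e: "e \<in> {1, - 1}" and k: "k \<in> clone_coeffs"
  shows "p_inv g w (B_of g w X) = 0"
proof -
  obtain P Q where fc: "frame_change P Q g" and P: "pull2 P g = \<eta>" "pull1 P w = v0"
    using rest_frame[OF assms(1,2)] by blast
  interpret frame_change P Q g by (rule fc)
  let ?Y = "pull3 P X"
  have "clone_alg k \<eta> v0 (V_lim e) ?Y" using clone_alg_pull[OF assms(3)] P by simp
  from inz_sqrt[OF lorentzian_minkowski unit_timelike_v0 clone_alg_inz[OF this, unfolded V_lim_eq]]
  have "p0 ((- (72 * k + 1) / 2) *\<^sub>R B0 ?Y) = 0" using e by auto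
  moreover have "72 * k + 1 \<noteq> 0" using k by (auto simp: clone_coeffs_def)
  ultimately have "p0 (B0 ?Y) = 0" by (simp add: p_inv_scale)
  moreover have "B0 ?Y = pull2 P (B_of g w X)"
    using dual3_pull[of X] slot_pull[of w "dual3 g X"] P by (simp add: B_of_def)
  ultimately show ?thesis using p_inv_pull[of w "B_of g w X"] P by simp
qed

lemma sq1_scale: "sq1 g (c *\<^sub>R u) = c\<^sup>2 * sq1 g u"
proof -
  have "raise1 g (c *\<^sub>R u) $ i = c * raise1 g u $ i" for i by (simp add: raise_tr tr_cmult)
  then show ?thesis by (simp add: sq1_def sum_distrib_left power2_eq_square mult_ac)
qed

lemma unit_timelike_unit_of:
  assumes "sq1 g u < 0" shows "unit_timelike g (unit_of g u)"
  using assms by (simp add: unit_timelike_def unit_of_def sq1_scale power_divide field_simps)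

lemma clone_on_shell_V_lim:
  assumes "open U" "x \<in> U" "clone_on_shell k U h (V_lim e) A A' a"
    and "e \<in> {1, - 1}" "k \<in> clone_coeffs" and time: "sq1 (h x) (grad a x) < 0"
  defines "w \<equiv> unit_of (h x) (grad a x)"
  shows "p_inv (h x) w (B_of (h x) w (clone_X A A' a x)) = 0"
proof -
  have "lorentzian (h x)" using assms(2,3) by (simp add: clone_on_shell_def metric_field_def)
  moreover have "clone_alg k (h x) w (V_lim e) (clone_X A A' a x)"
    unfolding w_def unit_of_def by (intro clone_alg_scale clone_on_shell_alg[OF assms(1-3)])
  ultimately show ?thesis
    using unit_timelike_unit_of[OF time] assms(4,5) clone_V_lim unfolding w_def by blast
qed

section \<open>A Bialynicki-Birula configuration\<close>

lemma ck_on_const: "ck_on k U (\<lambda>x. c)"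
proof (induction k arbitrary: c)
  case (Suc k)
  have "partial \<mu> (\<lambda>x. c) = (\<lambda>x. 0)" for \<mu>
    by (simp add: fun_eq_iff partial_eq[OF has_derivative_const])
  then show ?case using Suc by simp
qed simp

lemma partial_linear:
  assumes "bounded_linear f" shows "partial \<mu> f x = f (axis \<mu> 1)"
  by (rule partial_eq[OF bounded_linear_imp_has_derivative[OF assms]])

lemma smooth_on_linear:
  assumes f: "bounded_linear f" shows "smooth_on U f"
proof -
  have "ck_on k U f" for k
  proof (cases k)
    case 0
    then show ?thesis using f by (simp add: linear_continuous_on)
  next
    case (Suc n)
    have "partial \<mu> f = (\<lambda>x. f (axis \<mu> 1))" for \<mu> by (simp add: fun_eq_iff partial_linear[OF f])
    moreover have "f differentiable (at x)" for x
      by (rule differentiableI[OF bounded_linear_imp_has_derivative[OF f]])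
    ultimately show ?thesis using Suc by (simp add: ck_on_const)
  qed
  then show ?thesis by (simp add: smooth_on_def)
qed

lemma differentiable_sum_UNIV:
  "(\<And>i. f i differentiable F) \<Longrightarrow> (\<lambda>x. \<Sum>i\<in>(UNIV :: 'i::finite set). f i x) differentiable F"
  by (simp add: differentiable_sum)

text \<open>The constant field strength below is \<open>(dx\<^sup>0 + dx\<^sup>5) \<and> (dx\<^sup>1 \<and> dx\<^sup>2 + 2 dx\<^sup>3 \<and> dx\<^sup>4)\<close>: the
  solutions of the Bialynicki-Birula theory have a null factor, which a covector that is not null
  cannot annihilate.\<close>

definition bb_form :: tensor2 where "bb_form = plane 1 2 + 2 *\<^sub>R plane 3 4"

definition bb_null :: vec6 where "bb_null = axis 0 1 + axis 5 1"

definition bb_potential :: "vec6 \<Rightarrow> tensor2" where "bb_potential x = (x $ 0 + x $ 5) *\<^sub>R bb_form"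

definition bb_field :: tensor3 where "bb_field = wedge bb_null bb_form"

lemma bounded_linear_bb_potential: "bounded_linear bb_potential"
  unfolding linear_conv_bounded_linear[symmetric] bb_potential_def
  by (rule linearI) (simp_all add: algebra_simps)

lemma bb_form_transverse: "bb_form \<in> trans0"
  unfolding bb_form_def by (intro subspace_add subspace_scale subspace_transverse2 plane_transverse) auto

lemma bb_field_three_forms: "bb_field \<in> three_forms"
  unfolding bb_field_def by (rule wedge_three_forms[OF transverse2_two_forms[OF bb_form_transverse]])

lemma field_strength_bb_potential: "field_strength bb_potential x = bb_field"
proof -
  have "partial \<mu> bb_potential x = bb_null $ \<mu> *\<^sub>R bb_form" for \<mu>
    unfolding partial_linear[OF bounded_linear_bb_potential]
    by (simp add: bb_potential_def bb_null_def axis_def)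
  moreover have "bb_potential differentiable (at x)"
    by (rule differentiableI[OF bounded_linear_imp_has_derivative[OF bounded_linear_bb_potential]])
  ultimately show ?thesis
    by (simp add: vec_eq_iff field_strength_eq bb_field_def wedge_def)
qed

lemma bb_field_components:
  "bb_field$0$1$2 = 1" "bb_field$0$1$3 = 0" "bb_field$0$1$4 = 0" "bb_field$0$1$5 = 0" "bb_field$0$2$3 = 0"
  "bb_field$0$2$4 = 0" "bb_field$0$2$5 = 0" "bb_field$0$3$4 = 2" "bb_field$0$3$5 = 0" "bb_field$0$4$5 = 0"
  "bb_field$1$2$3 = 0" "bb_field$1$2$4 = 0" "bb_field$1$2$5 = 1" "bb_field$1$3$4 = 0" "bb_field$1$3$5 = 0"
  "bb_field$1$4$5 = 0" "bb_field$2$3$4 = 0" "bb_field$2$3$5 = 0" "bb_field$2$4$5 = 0" "bb_field$3$4$5 = 2"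
  by (simp_all add: bb_field_def wedge_def bb_null_def bb_form_def plane_def axis_def)

lemmas bb_dual_components = dual3_minkowski[OF bb_field_three_forms, unfolded bb_field_components]

lemma slot_v0_time:
  assumes "F \<in> three_forms"
  shows "slot0 F $1$2 = F$0$1$2" "slot0 F $1$3 = F$0$1$3" "slot0 F $1$4 = F$0$1$4"
    "slot0 F $1$5 = F$0$1$5" "slot0 F $2$3 = F$0$2$3" "slot0 F $2$4 = F$0$2$4"
    "slot0 F $2$5 = F$0$2$5" "slot0 F $3$4 = F$0$3$4" "slot0 F $3$5 = F$0$3$5"
    "slot0 F $4$5 = F$0$4$5"
  by (simp_all add: slot_v0 less_6 three_forms_sort[OF assms])

lemmas bb_E_components = slot_v0_time[OF bb_field_three_forms, unfolded bb_field_components]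

lemmas bb_B_components = slot_v0_time[OF dual3_three_forms, of \<eta> bb_field, unfolded bb_dual_components]

lemma bb_B_canonical: "canonical (B0 bb_field)"
  unfolding canonical_def B_of_def bb_B_components by (simp add: slot_transverse2[OF dual3_three_forms])

lemma bb_p: "p0 (B0 bb_field) = 2"
proof -
  have B: "B0 bb_field \<in> trans0" using bb_B_canonical by (simp add: canonical_def)
  show ?thesis using canonical_s_p(2)[OF B] unfolding B_of_def bb_B_components by simp
qed

text \<open>E has the blocks 1 and 2 and B the blocks 2 and 1, so both blocks of the slot of X^+ are
  3/2 and the gradient of V vanishes. What is left asks that 72 k X^* - X vanish on every n \<and>
  \<omega>. The unequal amplitudes prevent X^* from being a multiple of X: its coefficients are 144
  k - 1 and 72 k - 2, both nonzero as 72 k is 6 or 1.\<close>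

lemma bb_no_clone:
  assumes clone: "clone_alg k \<eta> n V bb_field" and k: "k \<in> clone_coeffs" and n: "sq1 \<eta> n \<noteq> 0"
  shows False
proof -
  let ?L = "plus_part \<eta> bb_field" and ?D = "dual3 \<eta> bb_field"
  obtain W where W: "((\<lambda>X. V (I_inv \<eta> (plus_part \<eta> X))) has_derivative W) (at bb_field within three_forms)"
    "\<And>\<omega>. \<omega> \<in> two_forms \<Longrightarrow> W (wedge n \<omega>) = 6 * k * contr3 \<eta> ?D (wedge n \<omega>)
      - contr3 \<eta> bb_field (wedge n \<omega>) / 12"
    using clone unfolding clone_alg_def by blast
  obtain G where G: "G \<in> trans0"
    "V_grad V ?L G"
    "\<And>D. D \<in> three_forms \<Longrightarrow> W D = contr2 \<eta> G (slot0 (plus_part \<eta> D))"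
    using clone_gradient[OF bb_field_three_forms W(1)] by blast
  have L: "?L \<in> sd0" by (rule plus_part_minkowski[OF bb_field_three_forms])
  have sl: "slot0 ?L $ i $ j = (slot0 bb_field $ i $ j + slot0 ?D $ i $ j) / 2" for i j
    by (simp add: plus_part_def linear_add[OF linear_slot] linear_cmul[OF linear_slot])
  have "canonical (slot0 ?L)"
    unfolding canonical_def sl bb_E_components bb_B_components
    by (simp add: slot_transverse2[OF self_dual_three_forms[OF L]])
  moreover have "?L$1$2$0 = ?L$3$4$0"
    unfolding slot_v0[symmetric] sl bb_E_components bb_B_components by simp
  ultimately have "G = 0" using V_gradient_null[OF L _ G(1,2)] by blast
  then have "W D = 0" if "D \<in> three_forms" for D
    using G(3)[OF that] contr2_linear_left[of \<eta>] linear_0 by fastforce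
  then have eq: "72 * k * contr3 \<eta> ?D (wedge n \<omega>) = contr3 \<eta> bb_field (wedge n \<omega>)" if "\<omega> \<in> two_forms" for \<omega>
    using W(2)[OF that] wedge_three_forms[OF that] by simp
  have pl: "plane i j \<in> two_forms" if "i \<noteq> j" for i j
    using that by (auto simp: two_forms_def plane_def)
  have e: "72 * k * (wedge n (plane i j) $1$2$5 * 2 + wedge n (plane i j) $3$4$5
      - wedge n (plane i j) $0$1$2 * 2 - wedge n (plane i j) $0$3$4)
    = wedge n (plane i j) $1$2$5 + wedge n (plane i j) $3$4$5 * 2
      - wedge n (plane i j) $0$1$2 - wedge n (plane i j) $0$3$4 * 2" if "i \<noteq> j" for i j
    using eq[OF pl[OF that]]
    unfolding contr3_minkowski[OF dual3_three_forms wedge_three_forms[OF pl[OF that]]]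
      contr3_minkowski[OF bb_field_three_forms wedge_three_forms[OF pl[OF that]]]
      bb_field_components bb_dual_components by algebra
  have c: "72 * k * 2 - 1 \<noteq> 0" "72 * k - 2 \<noteq> 0" using k by (auto simp: clone_coeffs_def)
  \<comment> \<open>The plane 12 yields the null relation between n_0 and n_5; each plane 0i
    isolates the component of n along the partner of i in its block.\<close>
  have "(72 * k * 2 - 1) * (n $ 5 - n $ 0) = 0" using e[of 1 2] by (simp add: wedge_def plane_def algebra_simps)
  moreover have "(72 * k * 2 - 1) * n $ 2 = 0" using e[of 0 1] by (simp add: wedge_def plane_def algebra_simps)
  moreover have "(72 * k * 2 - 1) * n $ 1 = 0" using e[of 0 2] by (simp add: wedge_def plane_def algebra_simps)
  moreover have "(72 * k - 2) * n $ 4 = 0" using e[of 0 3] by (simp add: wedge_def plane_def algebra_simps)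
  moreover have "(72 * k - 2) * n $ 3 = 0" using e[of 0 4] by (simp add: wedge_def plane_def algebra_simps)
  ultimately have "n $ 5 = n $ 0" "n $ 1 = 0" "n $ 2 = 0" "n $ 3 = 0" "n $ 4 = 0" using c by auto
  then show False using n by (simp add: sq1_minkowski)
qed

lemma bb_self_duality:
  "\<exists>G\<in>trans0.
     p_grad (B0 bb_field) G \<and>
     E_of \<eta> v0 bb_field = 2 *\<^sub>R G"
proof -
  let ?B = "B0 bb_field"
  have B: "?B \<in> trans0" using bb_B_canonical by (simp add: canonical_def)
  obtain G where G: "G \<in> trans0"
    "p_grad ?B G"
    using p_gradient_exists[OF B] bb_p by auto
  note g = p_gradient_canonical[OF bb_B_canonical G]
  have "E_of \<eta> v0 bb_field = 2 *\<^sub>R G"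
    unfolding E_of_def
    by (intro transverse_eqI slot_transverse2 bb_field_three_forms subspace_scale subspace_transverse2 G(1);
        simp only: bb_E_components vector_scaleR_component g B_of_def bb_B_components) simp_all
  then show ?thesis using G by blast
qed

text \<open>The field strength, metric and v0 are constant, so the momentum can be chosen constant
  and has no divergence. Only differentiability of the Lagrangian at this field has to be
  shown.\<close>

lemma bb_two_form_eq:
  "two_form_eq UNIV (\<lambda>x F. pst_lagrangian \<eta> v0 H_BB (E_of \<eta> v0 F) (B0 F)) (\<lambda>x. bb_field)"
proof -
  let ?p = "\<lambda>B. p0 B"
  have "?p differentiable (at (B0 bb_field) within trans0)"
    using bb_self_duality by (auto simp: differentiable_def)
  moreover have B: "bounded_linear (B0)"
    using linear_compose[OF linear_dual3 linear_slot] linear_conv_bounded_linear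
    by (fastforce simp: o_def B_of_def[abs_def])
  moreover have "B0 ` three_forms \<subseteq> trans0"
    unfolding B_of_def using slot_transverse2[OF dual3_three_forms] by auto
  ultimately have p: "(\<lambda>F. ?p (B0 F)) differentiable (at bb_field within three_forms)"
    using differentiable_chain_within[of "B0" bb_field three_forms ?p]
      differentiableI[OF bounded_linear_imp_has_derivative[OF B]] differentiable_within_subset
    by (fastforce simp: o_def)
  have E: "bounded_linear (E_of \<eta> v0)"
    using linear_slot linear_conv_bounded_linear by (fastforce simp: E_of_def[abs_def])
  have "(\<lambda>F. contr2 \<eta> (E_of \<eta> v0 F) (B0 F)) differentiable (at bb_field within three_forms)"
    by (rule differentiableI[OF bounded_bilinear.FDERIV[OF bilinear_contr2
            bounded_linear_imp_has_derivative[OF E] bounded_linear_imp_has_derivative[OF B]]])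
  then have "(\<lambda>F. pst_lagrangian \<eta> v0 H_BB (E_of \<eta> v0 F) (B0 F))
      differentiable (at bb_field within three_forms)"
    unfolding pst_lagrangian_def H_BB_def using p by (intro derivative_intros) auto
  then obtain P where P: "P \<in> three_forms" "((\<lambda>F. pst_lagrangian \<eta> v0 H_BB (E_of \<eta> v0 F) (B0 F))
      has_derivative (\<lambda>D. P \<bullet> D)) (at bb_field within three_forms)"
    using gradient_exists[OF _ subspace_three_forms bb_field_three_forms] by blast
  then show ?thesis
    unfolding two_form_eq_def
    by (intro exI[of _ "\<lambda>x. P"]) (simp add: partial_eq[OF has_derivative_const])
qed

lemma unit_of_v0: "unit_of \<eta> v0 = v0"
  by (simp add: unit_of_def sq1_minkowski axis_def)

text \<open>Again the momentum is constant, and existence of the derivative suffices. The two square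
  roots, in the normalisation of the gradient and in p, are differentiable because their arguments
  are positive here (p = 2).\<close>

lemma bb_scalar_eq:
  "scalar_eq UNIV (\<lambda>x u. pst_lagrangian \<eta> (unit_of \<eta> u) H_BB
     (E_of \<eta> (unit_of \<eta> u) bb_field) (B_of \<eta> (unit_of \<eta> u) bb_field)) (\<lambda>x. v0)"
proof -
  let ?w = "\<lambda>u. unit_of \<eta> u"
  have comp: "(\<lambda>u::vec6. u $ i) differentiable (at z)" for i z
    by (rule differentiableI[OF bounded_linear_imp_has_derivative[OF bounded_linear_vec_nth]])
  have "(\<lambda>u. sqrt (- sq1 \<eta> u)) differentiable (at v0)"
    by (rule differentiable_sqrt) (auto simp: sq1_minkowski axis_def intro!: derivative_intros comp)
  then have "(\<lambda>u. 1 / sqrt (- sq1 \<eta> u)) differentiable (at v0)"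
    by (intro derivative_intros) (auto simp: sq1_minkowski axis_def)
  then have w: "(\<lambda>u. ?w u $ i) differentiable (at v0)" for i
    unfolding unit_of_def vector_scaleR_component real_scaleR_def by (rule differentiable_mult[OF _ comp])
  have slot: "(\<lambda>u. slot \<eta> (?w u) T $ i $ j) differentiable (at v0)" for T i j
    unfolding slot_def raise_minkowski vec_lambda_beta by (intro differentiable_sum_UNIV differentiable_mult differentiable_const w)
  have contr: "(\<lambda>u. contr2 \<eta> (slot \<eta> (?w u) S) (slot \<eta> (?w u) T)) differentiable (at v0)" for S T
    unfolding contr2_def raise_minkowski by (intro differentiable_sum_UNIV differentiable_mult differentiable_const slot)
  have pvec: "(\<lambda>u. p_vec \<eta> (?w u) (slot \<eta> (?w u) T) $ i) differentiable (at v0)" for T i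
    unfolding p_vec_def vec_lambda_beta by (intro differentiable_sum_UNIV differentiable_mult differentiable_const slot w)
  define N where "N u = (\<Sum>\<^sub>u\<mu> \<nu>. \<eta> $ \<mu> $ \<nu> * p_vec \<eta> (?w u) (B_of \<eta> (?w u) bb_field) $ \<mu>
      * p_vec \<eta> (?w u) (B_of \<eta> (?w u) bb_field) $ \<nu>)" for u
  have "N differentiable (at v0)"
    unfolding N_def B_of_def by (intro differentiable_sum_UNIV differentiable_mult differentiable_const pvec)
  moreover have "sqrt (N v0) = 2" using bb_p by (simp add: N_def unit_of_v0 p_inv_def)
  then have "0 < N v0" by (metis real_sqrt_gt_0_iff zero_less_numeral)
  ultimately have "(\<lambda>u. sqrt (N u)) differentiable (at v0)" by (rule differentiable_sqrt)
  then have "(\<lambda>u. pst_lagrangian \<eta> (?w u) H_BB (E_of \<eta> (?w u) bb_field) (B_of \<eta> (?w u) bb_field))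
      differentiable (at v0)"
    using contr[of bb_field "dual3 \<eta> bb_field"]
    unfolding pst_lagrangian_def H_BB_def p_inv_def N_def E_of_def B_of_def by (intro derivative_intros) auto
  then obtain P where "((\<lambda>u. pst_lagrangian \<eta> (?w u) H_BB (E_of \<eta> (?w u) bb_field) (B_of \<eta> (?w u) bb_field))
      has_derivative (\<lambda>D. P \<bullet> D)) (at v0)"
    using gradient_exists[of _ v0 UNIV] by auto
  then show ?thesis
    unfolding scalar_eq_def
    by (intro exI[of _ "\<lambda>x. P"]) (simp add: partial_eq[OF has_derivative_const])
qed

lemma grad_time: "grad (\<lambda>x. - x $ 0) = (\<lambda>x. v0)"
proof -
  have b: "bounded_linear (\<lambda>x::vec6. - x $ 0)" by (intro bounded_linear_minus bounded_linear_vec_nth)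
  show ?thesis by (simp add: fun_eq_iff grad_def partial_linear[OF b] vec_eq_iff axis_def)
qed

lemma bb_on_shell: "pst_on_shell UNIV (\<lambda>x. \<eta>) H_BB bb_potential (\<lambda>x. - x $ 0)"
proof -
  have "smooth_on UNIV (\<lambda>x::vec6. \<eta>)" by (simp add: smooth_on_def ck_on_const)
  moreover have "smooth_on UNIV (\<lambda>x::vec6. - x $ 0)"
    by (intro smooth_on_linear bounded_linear_minus bounded_linear_vec_nth)
  moreover have "bb_potential x \<in> two_forms" for x
    unfolding bb_potential_def by (intro subspace_scale subspace_two_forms transverse2_two_forms[OF bb_form_transverse])
  moreover have "sq1 \<eta> v0 < 0" by (simp add: sq1_minkowski axis_def)
  ultimately show ?thesis
    using bb_two_form_eq bb_scalar_eq bb_self_duality smooth_on_linear[OF bounded_linear_bb_potential]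
    by (simp add: pst_on_shell_def metric_field_def gauge_field_def lorentzian_minkowski grad_time unit_of_v0
        field_strength_bb_potential[abs_def] H_BB_def Let_def)
qed

section \<open>The ModMax theory\<close>

text \<open>Once the root is (x^2 - y^2)/2, cosh and sinh recombine into a growing exponential on
  the smaller block and a decaying one on the larger block.\<close>

lemma H_MM_canonical:
  assumes "0 \<le> y" "y \<le> x"
  shows "H_MM \<gamma> ((x\<^sup>2 + y\<^sup>2) / 2) (x * y) = exp \<gamma> * y\<^sup>2 / 2 + exp (- \<gamma>) * x\<^sup>2 / 2"
    "sqrt (((x\<^sup>2 + y\<^sup>2) / 2)\<^sup>2 - (x * y)\<^sup>2) = (x\<^sup>2 - y\<^sup>2) / 2"
proof -
  have "((x\<^sup>2 + y\<^sup>2) / 2)\<^sup>2 - (x * y)\<^sup>2 = ((x\<^sup>2 - y\<^sup>2) / 2)\<^sup>2"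
    by (simp add: power2_eq_square field_simps)
  moreover have "y\<^sup>2 \<le> x\<^sup>2" using assms by (intro power_mono)
  ultimately show r: "sqrt (((x\<^sup>2 + y\<^sup>2) / 2)\<^sup>2 - (x * y)\<^sup>2) = (x\<^sup>2 - y\<^sup>2) / 2" by simp
  show "H_MM \<gamma> ((x\<^sup>2 + y\<^sup>2) / 2) (x * y) = exp \<gamma> * y\<^sup>2 / 2 + exp (- \<gamma>) * x\<^sup>2 / 2"
    unfolding H_MM_def r by (simp add: cosh_field_def sinh_field_def field_simps)
qed

lemma inz_V_MM:
  assumes "lorentzian g" "unit_timelike g v" "0 \<le> \<gamma>" "inz_algebraic_eq g v (V_MM \<gamma>) B L"
  shows "inz_hamiltonian g v (V_MM \<gamma>) B L = H_MM \<gamma> (s_inv g B) (p_inv g v B)"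
proof -
  define k where "k = - tanh (\<gamma> / 2)"
  have V: "V_MM \<gamma> = (\<lambda>I. k / 2 * sqrt (I / 6))" by (simp add: V_MM_def k_def fun_eq_iff)
  \<comment> \<open>In terms of r the function k and both exponentials are rational, with 1 - k =
    2/(1 + r) and 1 + k = 2 r/(1 + r), and the claim becomes an identity of fractions.\<close>
  define r where "r = exp (- \<gamma>)"
  have r: "0 < r" "r \<le> 1" using assms(3) by (simp_all add: r_def)
  have "k = - (1 - r) / (1 + r)" by (simp add: k_def r_def tanh_real_altdef minus_divide_left)
  then have k: "1 - k = 2 / (1 + r)" "1 + k = 2 * r / (1 + r)" using r by (simp_all add: field_simps)
  obtain x y where xy: "0 \<le> y" "y \<le> x" and s: "s_inv g B = (((1 - k) * x)\<^sup>2 + ((1 + k) * y)\<^sup>2) / 2"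
    and p: "p_inv g v B = \<bar>(1 - k) * x\<bar> * \<bar>(1 + k) * y\<bar>"
    and h: "inz_hamiltonian g v (V_MM \<gamma>) B L = (1 - k\<^sup>2) * (x\<^sup>2 + y\<^sup>2) / 2"
    using inz_sqrt[OF assms(1,2) assms(4)[unfolded V]] unfolding V by blast
  \<comment> \<open>For \<gamma> \<ge> 0 the parameter k is at most 0, so B has its blocks in the
    same order as \<Lambda>. This order decides the sign of the root in \<open>H_MM\<close>.\<close>
  have pos: "0 \<le> (1 + k) * y" "0 \<le> (1 - k) * x" "(1 + k) * y \<le> (1 - k) * x"
  proof -
    show "0 \<le> (1 + k) * y" "0 \<le> (1 - k) * x" using xy r by (simp_all add: k)
    show "(1 + k) * y \<le> (1 - k) * x"
      using xy r by (intro mult_mono) (simp_all add: k divide_right_mono)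
  qed
  have "H_MM \<gamma> (s_inv g B) (p_inv g v B) = exp \<gamma> * ((1 + k) * y)\<^sup>2 / 2 + exp (- \<gamma>) * ((1 - k) * x)\<^sup>2 / 2"
    unfolding s p using H_MM_canonical(1)[OF pos(1,3), of \<gamma>] pos by simp
  also have "exp \<gamma> = 1 / r" by (simp add: r_def exp_minus divide_inverse)
  also have "(1 / r) * ((1 + k) * y)\<^sup>2 / 2 + exp (- \<gamma>) * ((1 - k) * x)\<^sup>2 / 2 = (1 / r) * ((2 * r / (1 + r)) * y)\<^sup>2 / 2 + r * ((2 / (1 + r)) * x)\<^sup>2 / 2"
    unfolding k r_def[symmetric] ..
  also have "\<dots> = ((2 / (1 + r)) * (2 * r / (1 + r))) * (x\<^sup>2 + y\<^sup>2) / 2"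
    using r by (simp add: power2_eq_square field_simps) (simp flip: add_divide_distrib)
  also have "(2 / (1 + r)) * (2 * r / (1 + r)) = 1 - k\<^sup>2"
    unfolding k[symmetric] by (simp add: power2_eq_square algebra_simps)
  finally show ?thesis using h by simp
qed

text \<open>The gap s - sqrt (s^2 - p^2) is y^2, and half of it is the coefficient of exp \<gamma>.
  Finiteness of the limit is expressed by boundedness at infinity; without the growing term the rest
  decays to 0.\<close>

lemma H_MM_bounded:
  assumes "0 \<le> y" "y \<le> x" and s: "s = (x\<^sup>2 + y\<^sup>2) / 2" and p: "p = x * y"
  shows "(Bfun (\<lambda>\<gamma>. H_MM \<gamma> s p) at_top \<longleftrightarrow> s - sqrt (s\<^sup>2 - p\<^sup>2) = 0) \<and>
        (s - sqrt (s\<^sup>2 - p\<^sup>2) = 0 \<longleftrightarrow> p = 0) \<and>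
        (p = 0 \<longrightarrow> ((\<lambda>\<gamma>. H_MM \<gamma> s p) \<longlongrightarrow> 0) at_top)"
proof -
  have y0: "y = 0 \<longleftrightarrow> p = 0" using assms by auto
  have gap: "s - sqrt (s\<^sup>2 - p\<^sup>2) = y\<^sup>2"
    unfolding s p H_MM_canonical(2)[OF assms(1,2)] by (simp add: field_simps)
  have H: "H_MM \<gamma> s p = exp \<gamma> * y\<^sup>2 / 2 + exp (- \<gamma>) * x\<^sup>2 / 2" for \<gamma>
    unfolding s p by (rule H_MM_canonical(1)[OF assms(1,2)])
  have "((\<lambda>\<gamma>::real. exp (- \<gamma>) * x\<^sup>2 / 2) \<longlongrightarrow> 0 * x\<^sup>2 / 2) at_top"
    by (intro tendsto_intros filterlim_compose[OF exp_at_bot filterlim_uminus_at_bot_at_top]) simp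
  then have lim: "((\<lambda>\<gamma>. H_MM \<gamma> s p) \<longlongrightarrow> 0) at_top" if "y = 0" using that by (simp add: H)
  have unb: "\<not> Bfun (\<lambda>\<gamma>. H_MM \<gamma> s p) at_top" if "y \<noteq> 0"
  proof
    assume "Bfun (\<lambda>\<gamma>. H_MM \<gamma> s p) at_top"
    then obtain K where "\<forall>\<^sub>F \<gamma> in at_top. norm (H_MM \<gamma> s p) \<le> K" unfolding Bfun_def by blast
    moreover have "\<forall>\<^sub>F \<gamma>::real in at_top. 2 * K / y\<^sup>2 < exp \<gamma>"
      using exp_at_top by (simp add: filterlim_at_top_dense)
    ultimately have "\<forall>\<^sub>F \<gamma>::real in at_top. norm (H_MM \<gamma> s p) \<le> K \<and> 2 * K / y\<^sup>2 < exp \<gamma>"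
      by (rule eventually_conj)
    then obtain \<gamma> where \<gamma>: "norm (H_MM \<gamma> s p) \<le> K" "2 * K / y\<^sup>2 < exp \<gamma>"
      using eventually_happens trivial_limit_at_top_linorder by blast
    have "K < exp \<gamma> * y\<^sup>2 / 2" using \<gamma>(2) that by (simp add: field_simps)
    moreover have "exp \<gamma> * y\<^sup>2 / 2 \<le> H_MM \<gamma> s p" by (simp add: H)
    ultimately show False using \<gamma>(1) by simp
  qed
  have "Bfun (\<lambda>\<gamma>. H_MM \<gamma> s p) at_top" if "y = 0"
    by (rule BfunI[of _ 1]) (use tendstoD[OF lim[OF that], of 1] in \<open>auto elim: eventually_mono\<close>)
  then show ?thesis using y0 gap lim unb by (metis zero_eq_power2)
qed

lemma V_MM_limits:
  "((\<lambda>\<gamma>. V_MM \<gamma> I) \<longlongrightarrow> V_lim (- 1) I) at_top" "((\<lambda>\<gamma>. V_MM \<gamma> I) \<longlongrightarrow> V_lim 1 I) at_bot"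
proof -
  have "((\<lambda>\<gamma>::real. tanh (\<gamma> / 2)) \<longlongrightarrow> 1) at_top"
    by (rule filterlim_compose[OF tanh_real_at_top]) (auto intro!: filterlim_tendsto_pos_mult_at_top[where f = "\<lambda>x. 1 / 2", simplified] filterlim_ident)
  then have "((\<lambda>\<gamma>. - (1 / 2) * tanh (\<gamma> / 2) * sqrt (I / 6)) \<longlongrightarrow> - (1 / 2) * 1 * sqrt (I / 6)) at_top"
    by (intro tendsto_intros)
  then show "((\<lambda>\<gamma>. V_MM \<gamma> I) \<longlongrightarrow> V_lim (- 1) I) at_top" by (simp add: V_MM_def V_lim_def)
  have "filterlim (\<lambda>\<gamma>::real. \<gamma> / 2) at_bot at_bot"
    using filterlim_tendsto_pos_mult_at_bot[OF tendsto_const _ filterlim_ident, of "1 / 2 :: real"] by simp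
  then have "((\<lambda>\<gamma>::real. tanh (\<gamma> / 2)) \<longlongrightarrow> - 1) at_bot"
    by (rule filterlim_compose[OF tanh_real_at_bot])
  then have "((\<lambda>\<gamma>. - (1 / 2) * tanh (\<gamma> / 2) * sqrt (I / 6)) \<longlongrightarrow> - (1 / 2) * (- 1) * sqrt (I / 6)) at_bot"
    by (intro tendsto_intros)
  then show "((\<lambda>\<gamma>. V_MM \<gamma> I) \<longlongrightarrow> V_lim 1 I) at_bot" by (simp add: V_MM_def V_lim_def)
qed

text \<open>At k = 1 or k = -1 one of the two blocks (1 - k) x and (1 + k) y of B is zero, and the
  Hamiltonian carries the factor 1 - k^2.\<close>

lemma inz_V_lim:
  assumes "lorentzian g" "unit_timelike g v" "e \<in> {1, - 1}" "inz_algebraic_eq g v (V_lim e) B L"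
  shows "p_inv g v B = 0 \<and> inz_hamiltonian g v (V_lim e) B L = 0"
  using inz_sqrt[OF assms(1,2) assms(4)[unfolded V_lim_eq]] assms(3) unfolding V_lim_eq by auto

(* The conjuncts, in order: the INZ-type formulation does not include H = p; nor does the clone
   formulation, H = p having on-shell configurations with p nonzero; (i) in three parts; (ii) for
   the INZ-type and the clone formulation; the ModMax limit. *)

theorem mainTheorem13:
  fixes g :: tensor2 and v :: vec6
  assumes "lorentzian g" and "unit_timelike g v"
  shows
    "(\<forall>V U. openin (top_of_set (transverse2 g v)) U \<and> U \<noteq> {} \<longrightarrow> \<not> inz_yields g v V H_BB U) \<and>

     (\<exists>A a. pst_on_shell UNIV (\<lambda>x. minkowski) H_BB A a \<and>
        (\<forall>x. let w = unit_of minkowski (grad a x)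
             in p_inv minkowski w (B_of minkowski w (field_strength A x)) \<noteq> 0) \<and>
        (\<forall>k\<in>clone_coeffs. \<forall>V U C C' b.
           open U \<and> U \<noteq> {} \<and> clone_on_shell k U (\<lambda>x. minkowski) V C C' b \<longrightarrow>
           (\<exists>x\<in>U. clone_X C C' b x \<noteq> field_strength A x))) \<and>

     (\<forall>B\<in>transverse2 g v. p_inv g v B \<noteq> 0 \<longrightarrow> (\<exists>!L. legendre_pair g v H_BB B L)) \<and>
     (\<forall>B L. legendre_pair g v H_BB B L \<longrightarrow> I_inv g L = 0) \<and>
     (\<forall>V B L. legendre_pair g v H_BB B L \<and> inz_algebraic_eq g v V B L \<longrightarrow> s_inv g B = p_inv g v B) \<and>

     (\<forall>e\<in>{1, - 1}. \<forall>B L. inz_algebraic_eq g v (V_lim e) B L \<longrightarrow>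
        p_inv g v B = 0 \<and> inz_hamiltonian g v (V_lim e) B L = 0) \<and>
     (\<forall>e\<in>{1, - 1}. \<forall>k\<in>clone_coeffs. \<forall>U h A A' a.
        open U \<and> clone_on_shell k U h (V_lim e) A A' a \<longrightarrow>
        (\<forall>x\<in>U. sq1 (h x) (grad a x) < 0 \<longrightarrow>
           (let w = unit_of (h x) (grad a x)
            in p_inv (h x) w (B_of (h x) w (clone_X A A' a x)) = 0))) \<and>

     (\<forall>I. ((\<lambda>\<gamma>. V_MM \<gamma> I) \<longlongrightarrow> V_lim (- 1) I) at_top \<and> ((\<lambda>\<gamma>. V_MM \<gamma> I) \<longlongrightarrow> V_lim 1 I) at_bot) \<and>
     (\<forall>\<gamma>\<ge>0. \<forall>B L. inz_algebraic_eq g v (V_MM \<gamma>) B L \<longrightarrow>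
        inz_hamiltonian g v (V_MM \<gamma>) B L = H_MM \<gamma> (s_inv g B) (p_inv g v B)) \<and>
     (\<forall>B\<in>transverse2 g v. let s = s_inv g B; p = p_inv g v B in
        (Bfun (\<lambda>\<gamma>. H_MM \<gamma> s p) at_top \<longleftrightarrow> s - sqrt (s\<^sup>2 - p\<^sup>2) = 0) \<and>
        (s - sqrt (s\<^sup>2 - p\<^sup>2) = 0 \<longleftrightarrow> p = 0) \<and>
        (p = 0 \<longrightarrow> ((\<lambda>\<gamma>. H_MM \<gamma> s p) \<longlongrightarrow> 0) at_top))"
proof (intro conjI, goal_cases)
  note lor = assms
  case 1
  show ?case using not_inz_yields_H_BB[OF lor] by blast
  case 2
  show ?case
  proof (intro exI conjI ballI allI impI)
    show "pst_on_shell UNIV (\<lambda>x. \<eta>) H_BB bb_potential (\<lambda>x. - x $ 0)" by (rule bb_on_shell)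
    show "let w = unit_of \<eta> (grad (\<lambda>x. - x $ 0) x)
        in p_inv \<eta> w (B_of \<eta> w (field_strength bb_potential x)) \<noteq> 0" for x
      by (simp add: grad_time unit_of_v0 field_strength_bb_potential bb_p)
    fix k V U C C' b
    assume k: "k \<in> clone_coeffs" and on: "open U \<and> U \<noteq> {} \<and> clone_on_shell k U (\<lambda>x. \<eta>) V C C' b"
    then obtain x where x: "x \<in> U" by blast
    have "clone_alg k \<eta> (grad b x) V (clone_X C C' b x)"
      using clone_on_shell_alg[OF _ x] on by blast
    moreover have "sq1 \<eta> (grad b x) \<noteq> 0" using on x by (simp add: clone_on_shell_def)
    ultimately have "clone_X C C' b x \<noteq> bb_field" using bb_no_clone k by metis
    then show "\<exists>x\<in>U. clone_X C C' b x \<noteq> field_strength bb_potential x"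
      using x by (auto simp: field_strength_bb_potential)
  qed
  case 3
  show ?case using legendre_exists[OF lor] legendre_unique[OF lor] by blast
  case 4
  show ?case using legendre_I_zero[OF lor] by blast
  case 5
  show ?case using legendre_I_zero[OF lor] inz_null[OF lor] by blast
  case 6
  show ?case using inz_V_lim[OF lor] by blast
  case 7
  show ?case unfolding Let_def using clone_on_shell_V_lim by blast
  case 8
  show ?case using V_MM_limits by blast
  case 9
  show ?case using inz_V_MM[OF lor] by blast
  case 10
  show ?case unfolding Let_def using s_p_canonical[OF lor] H_MM_bounded by metis
qed

end
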